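(* Let $X\subset \mathbb{P}^N$ be a projective variety over $K$ of dimension $n\geq 1$. Let $D_1,\ldots, D_q$ be hypersurfaces in $\mathbb{P}^N$ over $K$ such that all intersections amongst $D_1,\ldots, D_q$, and $X$ are transverse. Let $f:K\to X$ be a nonconstant analytic map whose image is not completely contained in any of the hypersurfaces $D_1,\ldots, D_q$. Then for all $r\geq 1$, $$\sum_{i=1}^q \frac{m_f(r,D_i)}{\deg D_i}\leq \left(n-1+\max_{1\le i\le q} \frac{1}{\deg D_i}\right)T_f(r)+O(1),$$ where the implied constant in $O(1)$ is independent of $r$. In particular, if $\deg D_i=d$ for all $i$, then for all $r\geq 1$, $$\frac{1}{d}\sum_{i=1}^q m_f(r,D_i)\leq \left(n-1+\frac{1}{d}\right)T_f(r)+O(1).$$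
   Context: $K$ is an algebraically closed field, of arbitrary characteristic, complete with respect to a non-archimedean absolute value $|\cdot|$. An entire function on $K$ is a power series $g(z)=\sum_{i\ge 0} a_iz^i$ with coefficients in $K$ converging on all of $K$; for real $r\geq 0$ put $|g|_r=\sup_i |a_i|r^i$. An analytic map $f:K\to\mathbb{P}^N$ is written $f=(f_0,\ldots,f_N)$ with $f_0,\ldots,f_N$ entire functions without a common zero; a map $f:K\to X$ is an analytic map to $\mathbb{P}^N$ with image in $X$. Put $\|f\|_r=\max\{|f_0|_r,\ldots,|f_N|_r\}$. The characteristic function is $T_f(r)=\log\|f\|_r$, well defined up to an additive constant independently of the representation of $f$. A hypersurface $D\subset\mathbb{P}^N$ of degree $d\geq 1$ is the closed subscheme defined by a homogeneous polynomial $Q\in K[x_0,\ldots,x_N]$ of degree $d$. If $Q\circ f=Q(f_0,\ldots,f_N)\not\equiv 0$, the proximity function is $$m_f(r,D)=\log\frac{\|f\|_r^d}{|Q\circ f|_r},$$ which depends on the choice of $Q$ only up to an additive constant. Transversality (standard meaning): all intersections amongst $D_1,\ldots,D_q$ and $X$ are transverse if for every subfamily with at least two members of the family $D_1,\ldots,D_q,X$ of closed subschemes of $\mathbb{P}^N$, and every point $P$ common to all members of the subfamily, each member is nonsingular at $P$ and the codimension in $T_P\mathbb{P}^N$ of the intersection of the tangent spaces at $P$ of the members equals the sum of the codimensions of the members (1 for each $D_i$, and $N-n$ for $X$). In particular, a subfamily whose codimensions sum to more than $N$ has empty intersection. *)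

theory Defs
  imports
    "HOL-Analysis.Analysis"
    "HOL-Computational_Algebra.Computational_Algebra"
    "HOL-Library.Poly_Mapping"
    "HOL-Library.Function_Algebras"
begin

locale nonarch_absval =
  fixes v :: "'a::field \<Rightarrow> real"
  assumes nonneg: "v x \<ge> 0"
    and eq_0_iff: "v x = 0 \<longleftrightarrow> x = 0"
    and mult: "v (x * y) = v x * v y"
    and ultrametric: "v (x + y) \<le> max (v x) (v y)"

definition absval_dist :: "('a::field \<Rightarrow> real) \<Rightarrow> 'a \<Rightarrow> 'a \<Rightarrow> real" where
  "absval_dist v x y = v (x - y)"

lemma (in nonarch_absval) Metric_space_absval: "Metric_space UNIV (absval_dist v)"
proof
  have one: "v 1 = 1"
    using mult[of 1 1] eq_0_iff[of 1] by simp
  have "v (-1) * v (-1) = 1"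
    using mult[of "-1" "-1"] one by simp
  then have minus_one: "v (-1) = 1"
    using nonneg[of "-1"] by (metis power2_eq_square power2_eq_1_iff zero_le_one neg_0_le_iff_le not_one_le_zero)
  have minus: "v (- x) = v x" for x
    using mult[of "-1" x] minus_one by simp
  show "0 \<le> absval_dist v x y" for x y
    by (simp add: absval_dist_def nonneg)
  show "absval_dist v x y = absval_dist v y x" for x y
    using minus[of "x - y"] by (simp add: absval_dist_def)
  show "absval_dist v x y = 0 \<longleftrightarrow> x = y" for x y
    by (simp add: absval_dist_def eq_0_iff)
  show "absval_dist v x z \<le> absval_dist v x y + absval_dist v y z" for x y z
    using ultrametric[of "x - y" "y - z"] nonneg[of "x - y"] nonneg[of "y - z"]
    by (simp add: absval_dist_def)
qed

definition complete_absval :: "('a::field \<Rightarrow> real) \<Rightarrow> bool" where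
  "complete_absval v \<longleftrightarrow> Metric_space.mcomplete UNIV (absval_dist v)"

definition fps_sums_at :: "('a::field \<Rightarrow> real) \<Rightarrow> 'a fps \<Rightarrow> 'a \<Rightarrow> 'a \<Rightarrow> bool" where
  "fps_sums_at v g z s \<longleftrightarrow>
     limitin (Metric_space.mtopology UNIV (absval_dist v))
       (\<lambda>k. \<Sum>i<k. fps_nth g i * z ^ i) s sequentially"

definition entire :: "('a::field \<Rightarrow> real) \<Rightarrow> 'a fps \<Rightarrow> bool" where
  "entire v g \<longleftrightarrow> (\<forall>z. \<exists>s. fps_sums_at v g z s)"

definition entire_eval :: "('a::field \<Rightarrow> real) \<Rightarrow> 'a fps \<Rightarrow> 'a \<Rightarrow> 'a" where
  "entire_eval v g z = (THE s. fps_sums_at v g z s)"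

text \<open>The norm \<open>|g|\<^sub>r\<close>. For entire \<open>g\<close> the set of which the supremum is taken is bounded.\<close>

definition gauss_norm :: "('a::field \<Rightarrow> real) \<Rightarrow> 'a fps \<Rightarrow> real \<Rightarrow> real" where
  "gauss_norm v g r = (SUP i. v (fps_nth g i) * r ^ i)"

type_synonym 'a mpoly = "(nat \<Rightarrow>\<^sub>0 nat) \<Rightarrow>\<^sub>0 'a"

text \<open>Substitution of the \<open>x i\<close> for the variables, in a ring to which coefficients are mapped
  by \<open>h\<close>.\<close>

definition mpoly_subst ::
    "('a::zero \<Rightarrow> 'b::comm_semiring_1) \<Rightarrow> (nat \<Rightarrow> 'b) \<Rightarrow> 'a mpoly \<Rightarrow> 'b" where
  "mpoly_subst h x p =
     (\<Sum>m\<in>Poly_Mapping.keys p. h (Poly_Mapping.lookup p m) *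
        (\<Prod>i\<in>Poly_Mapping.keys m. x i ^ Poly_Mapping.lookup m i))"

abbreviation mpoly_eval :: "(nat \<Rightarrow> 'a::comm_semiring_1) \<Rightarrow> 'a mpoly \<Rightarrow> 'a" where
  "mpoly_eval \<equiv> mpoly_subst (\<lambda>c. c)"

abbreviation mpoly_comp_fps :: "(nat \<Rightarrow> 'a::comm_semiring_1 fps) \<Rightarrow> 'a mpoly \<Rightarrow> 'a fps" where
  "mpoly_comp_fps \<equiv> mpoly_subst fps_const"

text \<open>If \<open>x\<^sub>i\<close> does not occur in the monomial \<open>m\<close>, the subtraction below is truncated, but the
  coefficient is then \<open>0\<close>.\<close>

definition mpoly_pderiv :: "nat \<Rightarrow> 'a::comm_semiring_1 mpoly \<Rightarrow> 'a mpoly" where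
  "mpoly_pderiv i p =
     (\<Sum>m\<in>Poly_Mapping.keys p.
        Poly_Mapping.single (m - Poly_Mapping.single i 1)
          (of_nat (Poly_Mapping.lookup m i) * Poly_Mapping.lookup p m))"

text \<open>Homogeneous polynomials of degree \<open>d\<close> in \<open>x\<^sub>0, \<dots>, x\<^sub>N\<close>, including the zero polynomial.\<close>

definition forms :: "nat \<Rightarrow> nat \<Rightarrow> 'a::zero mpoly set" where
  "forms N d = {p. \<forall>m\<in>Poly_Mapping.keys p. Poly_Mapping.keys m \<subseteq> {..N} \<and>
     (\<Sum>i\<in>Poly_Mapping.keys m. Poly_Mapping.lookup m i) = d}"

text \<open>A point of \<open>\<P>\<^sup>N(K)\<close> is the set of all its homogeneous coordinate vectors. A vector
  \<open>(x\<^sub>0, \<dots>, x\<^sub>N)\<close> is a function on \<^typ>\<open>nat\<close> that vanishes beyond \<open>N\<close>.\<close>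

type_synonym 'a proj_pt = "(nat \<Rightarrow> 'a) set"

definition proj_point :: "nat \<Rightarrow> (nat \<Rightarrow> 'a::field) \<Rightarrow> 'a proj_pt" where
  "proj_point N x = {(\<lambda>i. if i \<le> N then c * x i else 0) | c. c \<noteq> 0}"

definition proj_space :: "nat \<Rightarrow> 'a::field proj_pt set" where
  "proj_space N = proj_point N ` {x. \<exists>i\<le>N. x i \<noteq> 0}"

definition proj_zeros :: "nat \<Rightarrow> 'a::field mpoly set \<Rightarrow> 'a proj_pt set" where
  "proj_zeros N E = {P \<in> proj_space N. \<forall>x\<in>P. \<forall>p\<in>E. mpoly_eval x p = 0}"

definition proj_closed :: "nat \<Rightarrow> 'a::field proj_pt set \<Rightarrow> bool" where
  "proj_closed N X \<longleftrightarrow> (\<exists>E. E \<subseteq> (\<Union>d. forms N d) \<and> X = proj_zeros N E)"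

text \<open>Varieties are reduced and irreducible; over an algebraically closed field they are
  identified with their sets of closed points.\<close>

definition proj_variety :: "nat \<Rightarrow> 'a::field proj_pt set \<Rightarrow> bool" where
  "proj_variety N X \<longleftrightarrow> proj_closed N X \<and> X \<noteq> {} \<and>
     (\<forall>Y Z. proj_closed N Y \<and> proj_closed N Z \<and> X \<subseteq> Y \<union> Z \<longrightarrow> X \<subseteq> Y \<or> X \<subseteq> Z)"

text \<open>The Krull dimension of \<open>X\<close> in the Zariski topology.\<close>

definition proj_dim :: "nat \<Rightarrow> 'a::field proj_pt set \<Rightarrow> enat" where
  "proj_dim N X = Sup {enat k | k. \<exists>Z. (\<forall>i\<le>k. proj_variety N (Z i) \<and> Z i \<subseteq> X) \<and>
     (\<forall>i<k. Z i \<subset> Z (Suc i))}"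

text \<open>These polynomials generate the homogeneous ideal of \<open>X\<close>.\<close>

definition vanishing_forms :: "nat \<Rightarrow> 'a::field proj_pt set \<Rightarrow> 'a mpoly set" where
  "vanishing_forms N X = {p \<in> (\<Union>d. forms N d). \<forall>P\<in>X. \<forall>x\<in>P. mpoly_eval x p = 0}"

text \<open>A closed subscheme of \<open>\<P>\<^sup>N\<close> is given by a set \<open>E\<close> of homogeneous polynomials generating its
  ideal. If \<open>x\<close> is a coordinate vector of \<open>P\<close>, then \<open>T\<^sub>P \<P>\<^sup>N\<close> is \<open>K\<^sup>N\<^sup>+\<^sup>1 / K x\<close> (up to a twist), and
  the tangent space at a point \<open>P\<close> of the scheme is the image of the subspace
  \<open>tangent_lift N E P\<close> of \<open>K\<^sup>N\<^sup>+\<^sup>1\<close>. By Euler's formula the latter contains \<open>x\<close>, so that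
  intersections and codimensions can be computed in \<open>K\<^sup>N\<^sup>+\<^sup>1\<close>. Only generators of the ideal are
  needed because \<open>d(g p) = g dp\<close> at a zero of \<open>p\<close>, and the choice of \<open>x\<close> is irrelevant by
  homogeneity.\<close>

definition tangent_lift :: "nat \<Rightarrow> 'a::field mpoly set \<Rightarrow> 'a proj_pt \<Rightarrow> (nat \<Rightarrow> 'a) set" where
  "tangent_lift N E P = {w. (\<forall>i>N. w i = 0) \<and>
     (\<forall>x\<in>P. \<forall>p\<in>E. (\<Sum>i\<le>N. mpoly_eval x (mpoly_pderiv i p) * w i) = 0)}"

abbreviation fun_scale :: "'a::field \<Rightarrow> (nat \<Rightarrow> 'a) \<Rightarrow> nat \<Rightarrow> 'a" where
  "fun_scale \<equiv> (\<lambda>c w i. c * w i)"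

lemma vector_space_fun_scale: "vector_space (fun_scale :: 'a::field \<Rightarrow> _)"
  by unfold_locales (auto simp: fun_eq_iff algebra_simps)

text \<open>Codimension in \<open>K\<^sup>N\<^sup>+\<^sup>1\<close>; only used for subspaces of \<open>K\<^sup>N\<^sup>+\<^sup>1\<close>, so there is no truncation.\<close>

definition lift_codim :: "nat \<Rightarrow> (nat \<Rightarrow> 'a::field) set \<Rightarrow> nat" where
  "lift_codim N W = (N + 1) - vector_space.dim fun_scale W"

text \<open>Nonsingularity at \<open>P\<close> of a scheme that has codimension \<open>c\<close> at \<open>P\<close>: its tangent space there has
  codimension \<open>c\<close>.\<close>

definition nonsingular_at :: "nat \<Rightarrow> nat \<Rightarrow> 'a::field mpoly set \<Rightarrow> 'a proj_pt \<Rightarrow> bool" where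
  "nonsingular_at N c E P \<longleftrightarrow> lift_codim N (tangent_lift N E P) = c"

text \<open>A family, indexed by \<open>A\<close>, of closed subschemes with equations \<open>E j\<close> and codimensions \<open>c j\<close>.\<close>

definition transverse_family ::
    "nat \<Rightarrow> 'j set \<Rightarrow> ('j \<Rightarrow> 'a::field mpoly set) \<Rightarrow> ('j \<Rightarrow> nat) \<Rightarrow> bool" where
  "transverse_family N A E c \<longleftrightarrow>
     (\<forall>J P. J \<subseteq> A \<and> finite J \<and> card J \<ge> 2 \<and> P \<in> (\<Inter>j\<in>J. proj_zeros N (E j)) \<longrightarrow>
        (\<forall>j\<in>J. nonsingular_at N (c j) (E j) P) \<and>
        lift_codim N (\<Inter>j\<in>J. tangent_lift N (E j) P) = (\<Sum>j\<in>J. c j))"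

text \<open>Transversality of all intersections amongst \<open>D\<^sub>1, \<dots>, D\<^sub>q\<close>, where \<open>D\<^sub>i\<close> is the scheme
  \<open>Q\<^sub>i = 0\<close>, and a variety \<open>X\<close> of dimension \<open>n\<close>. The index \<open>None\<close> stands for \<open>X\<close> and
  \<open>Some i\<close> for \<open>D\<^sub>i\<close>.\<close>

definition all_transverse ::
    "nat \<Rightarrow> nat \<Rightarrow> 'a::field proj_pt set \<Rightarrow> nat \<Rightarrow> (nat \<Rightarrow> 'a mpoly) \<Rightarrow> bool" where
  "all_transverse N n X q Q \<longleftrightarrow>
     transverse_family N (insert None (Some ` {1..q}))
       (case_option (vanishing_forms N X) (\<lambda>i. {Q i}))
       (case_option (N - n) (\<lambda>_. 1))"

definition analytic_rep :: "('a::field \<Rightarrow> real) \<Rightarrow> nat \<Rightarrow> (nat \<Rightarrow> 'a fps) \<Rightarrow> bool" where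
  "analytic_rep v N f \<longleftrightarrow>
     (\<forall>i\<le>N. entire v (f i)) \<and> (\<forall>z. \<exists>i\<le>N. entire_eval v (f i) z \<noteq> 0)"

definition analytic_map :: "('a::field \<Rightarrow> real) \<Rightarrow> nat \<Rightarrow> (nat \<Rightarrow> 'a fps) \<Rightarrow> 'a \<Rightarrow> 'a proj_pt" where
  "analytic_map v N f z = proj_point N (\<lambda>i. entire_eval v (f i) z)"

definition rep_norm :: "('a::field \<Rightarrow> real) \<Rightarrow> nat \<Rightarrow> (nat \<Rightarrow> 'a fps) \<Rightarrow> real \<Rightarrow> real" where
  "rep_norm v N f r = (MAX i\<in>{..N}. gauss_norm v (f i) r)"

definition char_fun :: "('a::field \<Rightarrow> real) \<Rightarrow> nat \<Rightarrow> (nat \<Rightarrow> 'a fps) \<Rightarrow> real \<Rightarrow> real" where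
  "char_fun v N f r = ln (rep_norm v N f r)"

definition prox_fun ::
    "('a::field \<Rightarrow> real) \<Rightarrow> nat \<Rightarrow> (nat \<Rightarrow> 'a fps) \<Rightarrow> nat \<Rightarrow> 'a mpoly \<Rightarrow> real \<Rightarrow> real" where
  "prox_fun v N f d Q r = ln (rep_norm v N f r ^ d / gauss_norm v (mpoly_comp_fps f Q) r)"

end

theory Submission
  imports Defs
begin

text \<open>
  Fix a radius \<open>r \<ge> 1\<close>. The Gauss norm \<open>|\<cdot>|\<^sub>r\<close> is multiplicative and non-archimedean on entire functions
  (\<open>gauss_norm_mult\<close>). Dividing \<open>f\<close> by a component \<open>f\<^sub>i\<^sub>0\<close> of largest norm and substituting into polynomials
  gives a multiplicative seminorm on \<open>K[x\<^sub>0, \<dots>, x\<^sub>N]\<close> which is bounded by \<open>1\<close> on the variables, vanishes on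
  the ideal of \<open>X\<close>, and takes the value \<open>exp (- m\<^sub>f(r, D\<^sub>i))\<close> at \<open>Q\<^sub>i\<close>. So \<open>f\<close> at radius \<open>r\<close> behaves like a
  point of \<open>X\<close> over a valued field, and the proximity functions measure how close this point is to the
  hypersurfaces. All estimates have to be uniform in \<open>r\<close>. This is achieved by working with the set of polynomials
  whose seminorms are bounded, uniformly in \<open>r\<close>, in terms of given ones: it is an ideal (\<open>ring_ideal_dominated\<close>),
  so algebra over \<open>K\<close> applies to it, and the Nullstellensatz takes the place of compactness
  (\<open>bound_without_common_zero\<close>). Three facts then give the theorem.

  Firstly, at most \<open>n\<close> of the \<open>m\<^sub>f(r, D\<^sub>i)\<close> exceed a constant. The coordinate vector of a point lies in all
  lifted tangent spaces, by Euler's formula, so transversality prevents \<open>n + 1\<close> of the hypersurfaces from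
  meeting on \<open>X\<close> (\<open>transverse_intersection\<close>), and equations without common zero are not all small at once
  (\<open>more_than_n_bound\<close>).

  Secondly, \<open>m\<^sub>f(r, D\<^sub>i) / deg D\<^sub>i \<le> T\<^sub>f(r) + O(1)\<close>, because \<open>|Q\<^sub>i \<circ> f|\<^sub>r\<close> is bounded below for \<open>r \<ge> 1\<close>. These two
  facts alone bound the sum by \<open>n T\<^sub>f(r) + O(1)\<close>.

  Thirdly, among any \<open>n\<close> of the hypersurfaces there is one, depending on \<open>r\<close>, with
  \<open>m\<^sub>f(r, D\<^sub>i) \<le> T\<^sub>f(r) + O(1)\<close>, without the factor \<open>deg D\<^sub>i\<close> (\<open>exactly_n_bound\<close>). By transversality these
  hypersurfaces meet \<open>X\<close> in reduced isolated points only. Near such a point \<open>a\<close> the coordinate differences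
  \<open>x\<^sub>j - a\<^sub>j\<close> are combinations of the \<open>Q\<^sub>i\<close> and of equations of \<open>X\<close> (\<open>reduced_point_multiplier\<close>); so if all
  \<open>m\<^sub>f(r, D\<^sub>i)\<close> are large, \<open>f\<close> is just as close to \<open>a\<close> as to the hypersurfaces. But a nonconstant map cannot
  be closer to a point than \<open>T\<^sub>f(r) + O(1)\<close> allows, since some \<open>f\<^sub>j - a\<^sub>j f\<^sub>i\<^sub>0\<close> is not \<open>0\<close> and its norm is
  bounded below. This replaces one of the \<open>n\<close> summands \<open>T\<^sub>f(r)\<close> by \<open>T\<^sub>f(r) / deg D\<^sub>i\<close> (\<open>weighted_sum_bound\<close>).
\<close>

section \<open>Polynomials and substitution\<close>

definition mvar :: "nat \<Rightarrow> 'a::comm_ring_1 mpoly" where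
  "mvar i = Poly_Mapping.single (Poly_Mapping.single i 1) 1"

abbreviation mconst :: "'a::comm_ring_1 \<Rightarrow> 'a mpoly" where
  "mconst c \<equiv> Poly_Mapping.single 0 c"

text \<open>The polynomial rings in finitely many variables are kept as subrings of one type, which makes
  induction on the number of variables possible.\<close>

definition mpolys :: "nat \<Rightarrow> 'a::zero mpoly set" where
  "mpolys k = {p. \<forall>m\<in>Poly_Mapping.keys p. Poly_Mapping.keys m \<subseteq> {..<k}}"

lemma mpoly_terms_induct:
  fixes p :: "'a::comm_monoid_add mpoly"
  assumes "\<And>m. m \<in> Poly_Mapping.keys p \<Longrightarrow> P (Poly_Mapping.single m (Poly_Mapping.lookup p m))"
    and "P 0" and "\<And>a b. P a \<Longrightarrow> P b \<Longrightarrow> P (a + b)"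
  shows "P p"
proof -
  have "P (\<Sum>m\<in>S. Poly_Mapping.single m (Poly_Mapping.lookup p m))"
    if "S \<subseteq> Poly_Mapping.keys p" for S
    using finite_subset[OF that finite_keys] that
    by (induction S rule: finite_induct) (auto intro: assms)
  moreover have "(\<Sum>m\<in>Poly_Mapping.keys p. Poly_Mapping.single m (Poly_Mapping.lookup p m)) = p"
    by (rule poly_mapping_eqI)
      (auto simp: lookup_sum lookup_single when_def not_in_keys_iff_lookup_eq_zero)
  ultimately show ?thesis by force
qed

lemma monomial_induct [case_names zero add]:
  fixes m :: "nat \<Rightarrow>\<^sub>0 nat"
  assumes "P 0" and "\<And>m i e. P m \<Longrightarrow> P (m + Poly_Mapping.single i e)"
  shows "P m"
proof (induction m rule: Poly_Mapping.update_induct)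
  case (update f a b)
  have "Poly_Mapping.update a b f = f + Poly_Mapping.single a b"
    using update(1)
    by (intro poly_mapping_eqI)
      (auto simp: lookup_update lookup_add lookup_single when_def not_in_keys_iff_lookup_eq_zero)
  with update assms(2) show ?case by simp
qed (use assms in auto)

locale ring_morphism =
  fixes h :: "'a::comm_ring_1 \<Rightarrow> 'b::comm_ring_1"
  assumes add: "h (a + b) = h a + h b" and mult: "h (a * b) = h a * h b" and one: "h 1 = 1"
begin

lemma zero: "h 0 = 0"
  using add[of 0 0] by simp

lemma uminus: "h (- a) = - h a"
  using add[of a "- a"] by (simp add: zero eq_neg_iff_add_eq_0 add.commute)

lemma diff: "h (a - b) = h a - h b"
  using add[of a "- b"] by (simp add: uminus)

lemma power: "h (a ^ n) = h a ^ n"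
  by (induction n) (simp_all add: one mult)

lemma sum: "h (sum f A) = (\<Sum>x\<in>A. h (f x))"
  by (induction A rule: infinite_finite_induct) (simp_all add: add zero)

lemma prod: "h (prod f A) = (\<Prod>x\<in>A. h (f x))"
  by (induction A rule: infinite_finite_induct) (simp_all add: mult one)

end

definition monomial_value :: "(nat \<Rightarrow> 'b::comm_semiring_1) \<Rightarrow> (nat \<Rightarrow>\<^sub>0 nat) \<Rightarrow> 'b" where
  "monomial_value x m = (\<Prod>i\<in>Poly_Mapping.keys m. x i ^ Poly_Mapping.lookup m i)"

lemma monomial_value_superset:
  assumes "finite S" "Poly_Mapping.keys m \<subseteq> S"
  shows "monomial_value x m = (\<Prod>i\<in>S. x i ^ Poly_Mapping.lookup m i)"
  unfolding monomial_value_def using assms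
  by (intro prod.mono_neutral_left) (auto simp: not_in_keys_iff_lookup_eq_zero)

lemma monomial_value_add: "monomial_value x (m + m') = monomial_value x m * monomial_value x m'"
proof -
  let ?S = "Poly_Mapping.keys m \<union> Poly_Mapping.keys m'"
  have "finite ?S" "Poly_Mapping.keys (m + m') \<subseteq> ?S" by (auto simp: keys_add)
  then show ?thesis
    by (simp add: monomial_value_superset[of ?S] lookup_add power_add prod.distrib)
qed

lemma monomial_value_single [simp]: "monomial_value x (Poly_Mapping.single i e) = x i ^ e"
  by (simp add: monomial_value_def)

lemma monomial_value_0 [simp]: "monomial_value x 0 = 1"
  by (simp add: monomial_value_def)

lemma mpoly_subst_eq:
  "mpoly_subst h x p =
     (\<Sum>m\<in>Poly_Mapping.keys p. h (Poly_Mapping.lookup p m) * monomial_value x m)"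
  by (simp add: mpoly_subst_def monomial_value_def)

context ring_morphism begin

lemma mpoly_subst_single:
  "mpoly_subst h x (Poly_Mapping.single m c) = h c * monomial_value x m"
  by (simp add: mpoly_subst_eq zero)

lemma mpoly_subst_add: "mpoly_subst h x (p + q) = mpoly_subst h x p + mpoly_subst h x q"
  unfolding mpoly_subst_eq
  by (rule setsum_keys_plus_distrib) (simp_all add: zero add distrib_right)

lemma mpoly_subst_mult: "mpoly_subst h x (p * q) = mpoly_subst h x p * mpoly_subst h x q"
proof (rule mpoly_terms_induct[of p])
  show "mpoly_subst h x (Poly_Mapping.single m (Poly_Mapping.lookup p m) * q) =
    mpoly_subst h x (Poly_Mapping.single m (Poly_Mapping.lookup p m)) * mpoly_subst h x q" for m
    by (rule mpoly_terms_induct[of q])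
      (auto simp: mult_single mpoly_subst_single mult monomial_value_add mpoly_subst_add
        distrib_left mpoly_subst_def[of h x 0])
qed (auto simp: mpoly_subst_add distrib_right mpoly_subst_def[of h x 0])

lemma ring_morphism_mpoly_subst: "ring_morphism (mpoly_subst h x)"
  by unfold_locales
    (simp_all add: mpoly_subst_add mpoly_subst_mult one flip: single_one,
     simp add: mpoly_subst_single one del: single_one)

lemma mpoly_subst_mvar [simp]: "mpoly_subst h x (mvar i) = x i"
  by (simp add: mvar_def mpoly_subst_single one)

lemma mpoly_subst_mconst [simp]: "mpoly_subst h x (mconst c) = h c"
  by (simp add: mpoly_subst_single)

lemma mpoly_subst_compose:
  assumes "ring_morphism g"
  shows "mpoly_subst (\<lambda>c. g (h c)) (\<lambda>i. g (x i)) p = g (mpoly_subst h x p)"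
proof -
  interpret g: ring_morphism g by fact
  show ?thesis by (simp add: mpoly_subst_def g.sum g.mult g.prod g.power)
qed

end

lemma ring_morphism_id: "ring_morphism (\<lambda>c. c)"
  by unfold_locales auto

lemma ring_morphism_fps_const: "ring_morphism fps_const"
  by unfold_locales auto

lemmas ring_morphism_eval = ring_morphism.ring_morphism_mpoly_subst[OF ring_morphism_id]

interpretation eval: ring_morphism "mpoly_eval x" for x :: "nat \<Rightarrow> 'a::comm_ring_1"
  by (rule ring_morphism_eval)

lemmas mpoly_eval_single = ring_morphism.mpoly_subst_single[OF ring_morphism_id]
lemmas mpoly_eval_mvar [simp] = ring_morphism.mpoly_subst_mvar[OF ring_morphism_id]
lemmas mpoly_eval_mconst [simp] = ring_morphism.mpoly_subst_mconst[OF ring_morphism_id]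

lemma mpoly_subst_cong_vars:
  assumes "p \<in> mpolys k" and "\<And>i. i < k \<Longrightarrow> x i = y i"
  shows "mpoly_subst h x p = mpoly_subst h y p"
  unfolding mpoly_subst_def using assms
  by (intro sum.cong prod.cong arg_cong2[where f = "(*)"] arg_cong2[where f = "(^)"])
     (auto simp: mpolys_def)

lemma mpoly_subst_scale:
  assumes "p \<in> forms N d"
  shows "mpoly_subst h (\<lambda>i. c * x i) p = c ^ d * mpoly_subst h x p"
proof -
  have "monomial_value (\<lambda>i. c * x i) m = c ^ d * monomial_value x m"
    if "m \<in> Poly_Mapping.keys p" for m
    using assms that
    by (auto simp: forms_def monomial_value_def power_mult_distrib prod.distrib power_sum)
  then show ?thesis
    by (simp add: mpoly_subst_eq sum_distrib_left mult_ac cong: sum.cong)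
qed

lemma forms_subset_mpolys: "forms N d \<subseteq> mpolys (Suc N)"
  by (auto simp: forms_def mpolys_def lessThan_Suc_atMost)

lemma mpolys_mono: "k \<le> k' \<Longrightarrow> p \<in> mpolys k \<Longrightarrow> p \<in> mpolys k'"
  by (fastforce simp: mpolys_def)

lemma mpolys_mconst [simp]: "mconst c \<in> mpolys k"
  by (auto simp: mpolys_def)

lemma mpolys_mvar [simp]: "i < k \<Longrightarrow> mvar i \<in> mpolys k"
  by (auto simp: mpolys_def mvar_def)

lemma mpolys_0 [simp]: "0 \<in> mpolys k"
  by (auto simp: mpolys_def)

lemma mpolys_1 [simp]: "(1 :: 'a::comm_ring_1 mpoly) \<in> mpolys k"
  using mpolys_mconst[of 1] by simp

lemma mpolys_add [intro]: "p \<in> mpolys k \<Longrightarrow> q \<in> mpolys k \<Longrightarrow> p + q \<in> mpolys k"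
  using keys_add[of p q] unfolding mpolys_def by blast

lemma mpolys_uminus [intro]:
  fixes p :: "'a::comm_ring_1 mpoly"
  shows "p \<in> mpolys k \<Longrightarrow> - p \<in> mpolys k"
  by (auto simp: mpolys_def in_keys_iff)

lemma mpolys_diff [intro]:
  fixes p :: "'a::comm_ring_1 mpoly"
  shows "p \<in> mpolys k \<Longrightarrow> q \<in> mpolys k \<Longrightarrow> p - q \<in> mpolys k"
  using mpolys_add[of p k "- q"] by auto

lemma mpolys_mult [intro]:
  fixes p :: "'a::comm_ring_1 mpoly"
  assumes "p \<in> mpolys k" "q \<in> mpolys k"
  shows "p * q \<in> mpolys k"
proof -
  have "Poly_Mapping.keys m \<subseteq> {..<k}" if m: "m \<in> Poly_Mapping.keys (p * q)" for m
  proof -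
    obtain a b where "m = a + b" "a \<in> Poly_Mapping.keys p" "b \<in> Poly_Mapping.keys q"
      using keys_mult[of p q] m by blast
    with assms keys_add[of a b] show ?thesis unfolding mpolys_def by blast
  qed
  then show ?thesis by (auto simp: mpolys_def)
qed

lemma mpolys_power [intro]:
  fixes p :: "'a::comm_ring_1 mpoly"
  shows "p \<in> mpolys k \<Longrightarrow> p ^ n \<in> mpolys k"
  by (induction n) auto

lemma mpolys_sum [intro]:
  fixes f :: "'b \<Rightarrow> 'a::comm_ring_1 mpoly"
  shows "(\<And>x. x \<in> A \<Longrightarrow> f x \<in> mpolys k) \<Longrightarrow> sum f A \<in> mpolys k"
  by (induction A rule: infinite_finite_induct) auto

lemma mvar_power: "mvar i ^ e = Poly_Mapping.single (Poly_Mapping.single i e) 1"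
  by (induction e) (simp_all add: mvar_def mult_single single_add[symmetric])

text \<open>Substitutions are ring homomorphisms, so that it suffices to examine their values on constants
  and variables.\<close>

lemma mpolys_induct [consumes 1, case_names const var add mult]:
  fixes p :: "'a::comm_ring_1 mpoly"
  assumes p: "p \<in> mpolys k"
    and const: "\<And>c. P (mconst c)" and var: "\<And>i. i < k \<Longrightarrow> P (mvar i)"
    and add: "\<And>a b. a \<in> mpolys k \<Longrightarrow> b \<in> mpolys k \<Longrightarrow> P a \<Longrightarrow> P b \<Longrightarrow> P (a + b)"
    and mult: "\<And>a b. a \<in> mpolys k \<Longrightarrow> b \<in> mpolys k \<Longrightarrow> P a \<Longrightarrow> P b \<Longrightarrow> P (a * b)"
  shows "P p"
proof -
  let ?P = "\<lambda>q. q \<in> mpolys k \<and> P q"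
  have pow: "?P (mvar i ^ e)" if "i < k" for i e
  proof (induction e)
    case 0
    then show ?case using const[of 1] by simp
  next
    case (Suc e)
    with that show ?case using mult[OF mpolys_mvar[OF that] _ var[OF that]] by auto
  qed
  have mon: "Poly_Mapping.keys m \<subseteq> {..<k} \<Longrightarrow> ?P (Poly_Mapping.single m 1)" for m
  proof (induction m rule: monomial_induct)
    case zero
    then show ?case using const[of 1] by simp
  next
    case (add m i e)
    have keys: "Poly_Mapping.keys m \<subseteq> {..<k}" "e \<noteq> 0 \<longrightarrow> i < k"
      using add(2) by (auto simp: in_keys_iff lookup_add lookup_single when_def subset_iff)
    show ?case
    proof (cases "e = 0")
      case False
      have "?P (Poly_Mapping.single m 1 * mvar i ^ e)"
        using add(1)[OF keys(1)] pow[of i e] keys(2) False mult by auto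
      then show ?thesis by (simp add: mvar_power mult_single)
    qed (use add(1)[OF keys(1)] in simp)
  qed
  have "?P (Poly_Mapping.single m (Poly_Mapping.lookup p m))" if "m \<in> Poly_Mapping.keys p" for m
  proof -
    have "Poly_Mapping.keys m \<subseteq> {..<k}" using p that by (auto simp: mpolys_def)
    then have "?P (mconst (Poly_Mapping.lookup p m) * Poly_Mapping.single m 1)"
      using mon[of m] const mult[OF mpolys_mconst] by auto
    then show ?thesis by (simp add: mult_single)
  qed
  then have "?P p" by (rule mpoly_terms_induct) (use const[of 0] add in auto)
  then show ?thesis by simp
qed

text \<open>The step from \<open>k\<close> to \<open>k + 1\<close> variables thereby becomes a question on polynomials in one variable
  with coefficients in the subring \<open>mpolys k\<close>.\<close>

lemma mpolys_Suc_as_poly: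
  fixes p :: "'a::comm_ring_1 mpoly"
  assumes "p \<in> mpolys (Suc k)"
  shows "\<exists>P. (\<forall>i. coeff P i \<in> mpolys k) \<and> p = poly P (mvar k)"
  using assms
proof (induction p rule: mpolys_induct)
  case (const c)
  show ?case
    by (rule exI[of _ "[:mconst c:]"]) (auto simp: coeff_pCons split: nat.split)
next
  case (var i)
  show ?case
  proof (cases "i = k")
    case True
    then show ?thesis
      by (intro exI[of _ "[:0, 1:]"]) (auto simp: coeff_pCons split: nat.split)
  next
    case False
    with var show ?thesis
      by (intro exI[of _ "[:mvar i:]"]) (auto simp: coeff_pCons split: nat.split)
  qed
next
  case (add a b)
  then obtain P Q where "\<forall>i. coeff P i \<in> mpolys k" "a = poly P (mvar k)"
    "\<forall>i. coeff Q i \<in> mpolys k" "b = poly Q (mvar k)" by blast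
  then show ?case by (intro exI[of _ "P + Q"]) auto
next
  case (mult a b)
  then obtain P Q where "\<forall>i. coeff P i \<in> mpolys k" "a = poly P (mvar k)"
    "\<forall>i. coeff Q i \<in> mpolys k" "b = poly Q (mvar k)" by blast
  then show ?case by (intro exI[of _ "P * Q"]) (auto simp: coeff_mult)
qed

section \<open>Derivatives, Taylor expansion and Euler's formula\<close>

lemma mpoly_pderiv_add:
  "mpoly_pderiv i (p + q) = mpoly_pderiv i p + mpoly_pderiv i q"
  unfolding mpoly_pderiv_def
  by (rule setsum_keys_plus_distrib) (simp_all add: distrib_left single_add)

lemma mpoly_pderiv_single:
  "mpoly_pderiv i (Poly_Mapping.single m c) =
     Poly_Mapping.single (m - Poly_Mapping.single i 1) (of_nat (Poly_Mapping.lookup m i) * c)"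
  by (simp add: mpoly_pderiv_def)

lemma mpoly_pderiv_0 [simp]: "mpoly_pderiv i 0 = 0"
  by (simp add: mpoly_pderiv_def)

lemma mpoly_pderiv_mconst [simp]: "mpoly_pderiv i (mconst c) = 0"
  by (simp add: mpoly_pderiv_single)

lemma mpoly_pderiv_mvar: "mpoly_pderiv i (mvar j) = (if i = j then 1 else 0)"
  by (auto simp: mvar_def mpoly_pderiv_single lookup_single)

lemma mpoly_pderiv_mult:
  fixes p q :: "'a::comm_ring_1 mpoly"
  shows "mpoly_pderiv i (p * q) = mpoly_pderiv i p * q + p * mpoly_pderiv i q"
proof (rule mpoly_terms_induct[of p])
  fix m
  let ?c = "Poly_Mapping.lookup p m"
  have shift: "a - Poly_Mapping.single i 1 + b = a + b - Poly_Mapping.single i 1"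
    if "Poly_Mapping.lookup a i \<noteq> 0" for a b :: "nat \<Rightarrow>\<^sub>0 nat"
    using that by (intro poly_mapping_eqI) (auto simp: lookup_add lookup_minus lookup_single when_def)
  have "mpoly_pderiv i (Poly_Mapping.single m ?c * Poly_Mapping.single m' c') =
    mpoly_pderiv i (Poly_Mapping.single m ?c) * Poly_Mapping.single m' c' +
    Poly_Mapping.single m ?c * mpoly_pderiv i (Poly_Mapping.single m' c')" for m' c'
    using shift[of m m'] shift[of m' m]
    by (cases "Poly_Mapping.lookup m i = 0"; cases "Poly_Mapping.lookup m' i = 0")
      (simp_all add: mpoly_pderiv_single mult_single lookup_add single_add[symmetric] algebra_simps)
  then show "mpoly_pderiv i (Poly_Mapping.single m ?c * q) =
    mpoly_pderiv i (Poly_Mapping.single m ?c) * q + Poly_Mapping.single m ?c * mpoly_pderiv i q"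
    by (rule mpoly_terms_induct[of q]) (simp_all add: mpoly_pderiv_add algebra_simps)
qed (simp_all add: mpoly_pderiv_add algebra_simps)

text \<open>The quadratic remainder is not expanded: it is absorbed into coefficients \<open>M j\<close> that vanish at
  \<open>a\<close>. This is the form in which the linear system for the \<open>x\<^sub>j - a\<^sub>j\<close> can be solved later, since there
  only the values of the coefficients at \<open>a\<close> matter.\<close>

lemma taylor_first_order:
  fixes p :: "'a::comm_ring_1 mpoly"
  assumes "p \<in> mpolys k"
  shows "\<exists>M. (\<forall>j<k. M j \<in> mpolys k \<and> mpoly_eval a (M j) = 0) \<and>
    p = mconst (mpoly_eval a p) +
      (\<Sum>j<k. (mconst (mpoly_eval a (mpoly_pderiv j p)) + M j) * (mvar j - mconst (a j)))"
  using assms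
proof (induction p rule: mpolys_induct)
  case (const c)
  show ?case by (rule exI[of _ "\<lambda>_. 0"]) (auto simp: eval.zero)
next
  case (var i)
  have "(\<Sum>j<k. (mconst (mpoly_eval a (mpoly_pderiv j (mvar i))) + 0) * (mvar j - mconst (a j)))
    = (\<Sum>j<k. if j = i then mvar j - mconst (a j) else 0)"
    by (intro sum.cong) (auto simp: mpoly_pderiv_mvar eval.one eval.zero)
  with var show ?case by (intro exI[of _ "\<lambda>_. 0"]) (simp add: eval.zero)
next
  case (add p q)
  then obtain M L where M: "\<forall>j<k. M j \<in> mpolys k \<and> mpoly_eval a (M j) = 0"
      "p = mconst (mpoly_eval a p) +
      (\<Sum>j<k. (mconst (mpoly_eval a (mpoly_pderiv j p)) + M j) * (mvar j - mconst (a j)))"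
    and L: "\<forall>j<k. L j \<in> mpolys k \<and> mpoly_eval a (L j) = 0"
      "q = mconst (mpoly_eval a q) +
      (\<Sum>j<k. (mconst (mpoly_eval a (mpoly_pderiv j q)) + L j) * (mvar j - mconst (a j)))"
    by blast
  have "p + q = (mconst (mpoly_eval a p) +
      (\<Sum>j<k. (mconst (mpoly_eval a (mpoly_pderiv j p)) + M j) * (mvar j - mconst (a j)))) +
      (mconst (mpoly_eval a q) +
      (\<Sum>j<k. (mconst (mpoly_eval a (mpoly_pderiv j q)) + L j) * (mvar j - mconst (a j))))"
    using M(2) L(2) by (rule arg_cong2)
  also have "\<dots> = mconst (mpoly_eval a (p + q)) +
      (\<Sum>j<k. (mconst (mpoly_eval a (mpoly_pderiv j (p + q))) + (M j + L j)) *
        (mvar j - mconst (a j)))"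
    by (simp add: eval.add mpoly_pderiv_add single_add sum.distrib distrib_right add_ac)
  finally show ?case
    using M(1) L(1) by (intro exI[of _ "\<lambda>j. M j + L j"]) (auto simp: eval.add)
next
  case (mult p q)
  then obtain M L where M: "\<forall>j<k. M j \<in> mpolys k \<and> mpoly_eval a (M j) = 0"
      "p = mconst (mpoly_eval a p) +
      (\<Sum>j<k. (mconst (mpoly_eval a (mpoly_pderiv j p)) + M j) * (mvar j - mconst (a j)))"
    and L: "\<forall>j<k. L j \<in> mpolys k \<and> mpoly_eval a (L j) = 0"
      "q = mconst (mpoly_eval a q) +
      (\<Sum>j<k. (mconst (mpoly_eval a (mpoly_pderiv j q)) + L j) * (mvar j - mconst (a j)))"
    by blast
  define P0 Q0 where "P0 = mconst (mpoly_eval a p)" and "Q0 = mconst (mpoly_eval a q)"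
  define P1 Q1 where "P1 = (\<lambda>j. mconst (mpoly_eval a (mpoly_pderiv j p)))"
    and "Q1 = (\<lambda>j. mconst (mpoly_eval a (mpoly_pderiv j q)))"
  define b where "b = (\<lambda>j. mvar j - mconst (a j))"
  \<comment> \<open>The last summand collects the products of two increments: as \<open>q - Q0\<close> vanishes at \<open>a\<close>, it may be
    counted as part of the coefficient of the increment of \<open>p\<close>.\<close>
  let ?R = "\<lambda>j. P0 * L j + Q0 * M j + (P1 j + M j) * (q - Q0)"
  have p: "p = P0 + (\<Sum>j<k. (P1 j + M j) * b j)" using M(2) unfolding P0_def P1_def b_def .
  have q: "q = Q0 + (\<Sum>j<k. (Q1 j + L j) * b j)" using L(2) unfolding Q0_def Q1_def b_def .
  have eval_q: "mpoly_eval a (q - Q0) = 0" by (simp add: eval.diff Q0_def)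
  have coeff: "mconst (mpoly_eval a (mpoly_pderiv j (p * q))) = P1 j * Q0 + P0 * Q1 j" for j
    by (simp add: mpoly_pderiv_mult eval.add eval.mult single_add mult_single
        P0_def Q0_def P1_def Q1_def)
  have const: "mconst (mpoly_eval a (p * q)) = P0 * Q0"
    by (simp add: eval.mult mult_single P0_def Q0_def)
  have collect: "x * ((y + l) * c) + (z + m) * c * w + (z + m) * c * t =
      (z * w + x * y + (x * l + w * m + (z + m) * t)) * c" for x y z w l m c t :: "'a mpoly"
    by (simp add: algebra_simps)
  define S T where "S = (\<Sum>j<k. (P1 j + M j) * b j)" and "T = (\<Sum>j<k. (Q1 j + L j) * b j)"
  have "p = P0 + S" "q - Q0 = T" using p q unfolding S_def T_def by (simp_all only: add_diff_cancel_left')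
  then have "p * q = P0 * Q0 + P0 * T + S * Q0 + S * (q - Q0)"
    by (simp add: algebra_simps)
  also have "\<dots> = P0 * Q0 + (P0 * T + S * Q0 + S * (q - Q0))"
    by (simp only: add.assoc)
  also have "P0 * T + S * Q0 + S * (q - Q0) =
      (\<Sum>j<k. P0 * ((Q1 j + L j) * b j) + (P1 j + M j) * b j * Q0 + (P1 j + M j) * b j * (q - Q0))"
    unfolding S_def T_def sum_distrib_left sum_distrib_right by (simp only: sum.distrib)
  also have "\<dots> = (\<Sum>j<k. (P1 j * Q0 + P0 * Q1 j + ?R j) * b j)"
    by (rule sum.cong[OF refl], rule collect)
  finally have "p * q = mconst (mpoly_eval a (p * q)) +
      (\<Sum>j<k. (mconst (mpoly_eval a (mpoly_pderiv j (p * q))) + ?R j) * b j)"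
    unfolding coeff const .
  moreover have "\<forall>j<k. ?R j \<in> mpolys k \<and> mpoly_eval a (?R j) = 0"
    using M(1) L(1) mult(1,2) eval_q
    by (auto simp: eval.add eval.mult P0_def Q0_def P1_def
        intro!: mpolys_add mpolys_mult mpolys_diff)
  ultimately show ?case unfolding b_def by (intro exI[of _ ?R] conjI)
qed

lemma forms_0: "0 \<in> forms N d" by (simp add: forms_def)

lemma forms_add: "p \<in> forms N d \<Longrightarrow> q \<in> forms N d \<Longrightarrow> p + q \<in> forms N d"
  unfolding forms_def mem_Collect_eq using keys_add[of p q] by (meson Un_iff subsetD)

lemma forms_pderiv:
  fixes p :: "'a::comm_ring_1 mpoly"
  assumes "p \<in> forms N d"
  shows "mpoly_pderiv i p \<in> forms N (d - 1)"
proof -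
  have "mpoly_pderiv i (Poly_Mapping.single m (Poly_Mapping.lookup p m)) \<in> forms N (d - 1)"
    if m: "m \<in> Poly_Mapping.keys p" for m
  proof (cases "Poly_Mapping.lookup m i = 0")
    case False
    let ?m = "m - Poly_Mapping.single i 1"
    from m assms have keys: "Poly_Mapping.keys m \<subseteq> {..N}"
      and deg: "(\<Sum>j\<in>Poly_Mapping.keys m. Poly_Mapping.lookup m j) = d"
      unfolding forms_def by blast+
    have i: "i \<in> Poly_Mapping.keys m" using False by (simp add: in_keys_iff)
    have sub: "Poly_Mapping.keys ?m \<subseteq> Poly_Mapping.keys m"
      by (auto simp: in_keys_iff lookup_minus)
    have "(\<Sum>j\<in>Poly_Mapping.keys ?m. Poly_Mapping.lookup ?m j) =
        (\<Sum>j\<in>Poly_Mapping.keys m. Poly_Mapping.lookup ?m j)"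
      using sub by (intro sum.mono_neutral_left) (auto simp: in_keys_iff)
    also have "\<dots> = Poly_Mapping.lookup ?m i + (\<Sum>j\<in>Poly_Mapping.keys m - {i}. Poly_Mapping.lookup ?m j)"
      using i by (simp add: sum.remove)
    also have "(\<Sum>j\<in>Poly_Mapping.keys m - {i}. Poly_Mapping.lookup ?m j) =
        (\<Sum>j\<in>Poly_Mapping.keys m - {i}. Poly_Mapping.lookup m j)"
      by (intro sum.cong) (auto simp: lookup_minus lookup_single)
    also have "Poly_Mapping.lookup ?m i = Poly_Mapping.lookup m i - 1"
      by (simp add: lookup_minus)
    also have "Poly_Mapping.lookup m i - 1 + (\<Sum>j\<in>Poly_Mapping.keys m - {i}. Poly_Mapping.lookup m j)
      = d - 1"
      using deg i False by (simp add: sum.remove)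
    finally show ?thesis
      using subset_trans[OF sub keys] by (simp add: forms_def mpoly_pderiv_single)
  qed (simp add: mpoly_pderiv_single forms_0)
  then show ?thesis
    by (rule mpoly_terms_induct) (auto simp: mpoly_pderiv_add forms_0 forms_add)
qed

text \<open>The operator \<open>x\<^sub>i \<partial>/\<partial>x\<^sub>i\<close> multiplies a monomial by its exponent of \<open>x\<^sub>i\<close>, and these exponents add up
  to \<open>d\<close>. In positive characteristic the right-hand side may vanish identically, but only its
  vanishing at zeros of \<open>p\<close> will matter.\<close>

lemma euler:
  fixes p :: "'a::comm_ring_1 mpoly"
  assumes "p \<in> forms N d"
  shows "(\<Sum>i\<le>N. mpoly_eval x (mpoly_pderiv i p) * x i) = of_nat d * mpoly_eval x p"
proof (rule mpoly_terms_induct[of p])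
  fix m assume m: "m \<in> Poly_Mapping.keys p"
  let ?c = "Poly_Mapping.lookup p m"
  from m assms have keys: "Poly_Mapping.keys m \<subseteq> {..N}"
    and deg: "(\<Sum>j\<in>Poly_Mapping.keys m. Poly_Mapping.lookup m j) = d"
    unfolding forms_def by blast+
  have "mpoly_eval x (mpoly_pderiv i (Poly_Mapping.single m ?c)) * x i =
     of_nat (Poly_Mapping.lookup m i) * (?c * monomial_value x m)" for i
  proof (cases "Poly_Mapping.lookup m i = 0")
    case False
    then have "m - Poly_Mapping.single i 1 + Poly_Mapping.single i 1 = m"
      by (intro poly_mapping_eqI) (auto simp: lookup_add lookup_minus lookup_single when_def)
    then have "monomial_value x m = monomial_value x (m - Poly_Mapping.single i 1) * x i"
      using monomial_value_add[of x "m - Poly_Mapping.single i 1" "Poly_Mapping.single i 1"]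
      by (simp only: monomial_value_single power_one_right)
    then show ?thesis by (simp add: mpoly_pderiv_single mpoly_eval_single mult_ac)
  qed (simp add: mpoly_pderiv_single eval.zero)
  then have "(\<Sum>i\<le>N. mpoly_eval x (mpoly_pderiv i (Poly_Mapping.single m ?c)) * x i) =
      of_nat (\<Sum>i\<le>N. Poly_Mapping.lookup m i) * (?c * monomial_value x m)"
    by (simp add: sum_distrib_right)
  also have "(\<Sum>i\<le>N. Poly_Mapping.lookup m i) = d"
    unfolding deg[symmetric] using keys
    by (intro sum.mono_neutral_right) (auto simp: not_in_keys_iff_lookup_eq_zero)
  finally show "(\<Sum>i\<le>N. mpoly_eval x (mpoly_pderiv i (Poly_Mapping.single m ?c)) * x i) =
      of_nat d * mpoly_eval x (Poly_Mapping.single m ?c)"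
    by (simp add: mpoly_eval_single)
qed (simp_all add: mpoly_pderiv_add eval.add eval.zero sum.distrib distrib_left distrib_right)

section \<open>Ideals and Hilbert's Nullstellensatz\<close>

definition ring_ideal :: "'r::comm_ring_1 set \<Rightarrow> bool" where
  "ring_ideal I \<longleftrightarrow> 0 \<in> I \<and> (\<forall>a\<in>I. \<forall>b\<in>I. a + b \<in> I) \<and> (\<forall>r. \<forall>a\<in>I. r * a \<in> I)"

definition prime_ring_ideal :: "'r::comm_ring_1 set \<Rightarrow> bool" where
  "prime_ring_ideal P \<longleftrightarrow>
     ring_ideal P \<and> 1 \<notin> P \<and> (\<forall>a b. a * b \<in> P \<longrightarrow> a \<in> P \<or> b \<in> P)"

context
  fixes I :: "'r::comm_ring_1 set"
  assumes I: "ring_ideal I"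
begin

lemma ideal_0: "0 \<in> I" using I by (simp add: ring_ideal_def)

lemma ideal_add: "a \<in> I \<Longrightarrow> b \<in> I \<Longrightarrow> a + b \<in> I" using I by (simp add: ring_ideal_def)

lemma ideal_mult: "a \<in> I \<Longrightarrow> r * a \<in> I" using I by (simp add: ring_ideal_def)

lemma ideal_mult_right: "a \<in> I \<Longrightarrow> a * r \<in> I" using ideal_mult[of a r] by (simp add: mult.commute)

lemma ideal_uminus: "a \<in> I \<Longrightarrow> - a \<in> I" using ideal_mult[of a "-1"] by simp

lemma ideal_diff: "a \<in> I \<Longrightarrow> b \<in> I \<Longrightarrow> a - b \<in> I"
  using ideal_add[of a "- b"] ideal_uminus[of b] by simp

lemma ideal_sum: "(\<And>x. x \<in> A \<Longrightarrow> f x \<in> I) \<Longrightarrow> sum f A \<in> I"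
  by (induction A rule: infinite_finite_induct) (auto intro: ideal_0 ideal_add)

lemma ideal_poly: "(\<And>i. coeff p i \<in> I) \<Longrightarrow> poly p y \<in> I"
  by (auto simp: poly_altdef intro!: ideal_sum ideal_mult_right)

end

text \<open>An ideal \<open>M\<close> that is maximal among the proper ideals above \<open>I\<close> exists by Zorn's lemma. If \<open>a\<close> lies
  outside, then \<open>1 = m + r a\<close> with \<open>m \<in> M\<close>; multiplying by \<open>b\<close> shows that \<open>a b \<in> M\<close> forces \<open>b \<in> M\<close>.\<close>

lemma ex_prime_ideal_above:
  fixes I :: "'r::comm_ring_1 set"
  assumes "ring_ideal I" "1 \<notin> I"
  shows "\<exists>P. I \<subseteq> P \<and> prime_ring_ideal P"
proof -
  let ?A = "{J. ring_ideal J \<and> 1 \<notin> J \<and> I \<subseteq> J}"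
  have "\<exists>M\<in>?A. \<forall>J\<in>?A. M \<subseteq> J \<longrightarrow> J = M"
  proof (rule subset_Zorn_nonempty)
    show "?A \<noteq> {}" using assms by blast
    fix \<C> assume ne: "\<C> \<noteq> {}" and chain: "subset.chain ?A \<C>"
    have el: "ring_ideal J" "1 \<notin> J" "I \<subseteq> J" if "J \<in> \<C>" for J
      using chain that by (auto simp: subset.chain_def)
    have "a + b \<in> \<Union>\<C>" if ab: "a \<in> \<Union>\<C>" "b \<in> \<Union>\<C>" for a b
    proof -
      obtain J J' where J: "J \<in> \<C>" "a \<in> J" "J' \<in> \<C>" "b \<in> J'" using ab by blast
      then have "J \<subseteq> J' \<or> J' \<subseteq> J" using chain by (auto simp: subset.chain_def)
      then show ?thesis
        using J ideal_add[OF el(1)[OF J(1)], of a b] ideal_add[OF el(1)[OF J(3)], of a b] by blast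
    qed
    moreover have "0 \<in> \<Union>\<C>" using ne el(1) ideal_0 by blast
    moreover have "r * a \<in> \<Union>\<C>" if "a \<in> \<Union>\<C>" for r a
      using that el(1) ideal_mult by blast
    ultimately have "ring_ideal (\<Union>\<C>)" by (simp add: ring_ideal_def)
    then show "\<Union>\<C> \<in> ?A" using ne el by blast
  qed
  then obtain M where M: "ring_ideal M" "1 \<notin> M" "I \<subseteq> M"
    and max: "\<And>J. ring_ideal J \<Longrightarrow> 1 \<notin> J \<Longrightarrow> M \<subseteq> J \<Longrightarrow> J = M"
    by (smt (verit) mem_Collect_eq order_trans)
  have enlarge: "\<exists>m r. m \<in> M \<and> m + r * a = 1" if "a \<notin> M" for a
  proof (rule ccontr)
    assume no: "\<nexists>m r. m \<in> M \<and> m + r * a = 1"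
    let ?J = "{m + r * a | m r. m \<in> M}"
    have "ring_ideal ?J"
      unfolding ring_ideal_def
    proof (intro conjI ballI allI)
      show "0 \<in> ?J" using ideal_0[OF M(1)] by (auto intro!: exI[of _ 0])
      fix x assume "x \<in> ?J"
      then obtain m r where x: "x = m + r * a" "m \<in> M" by blast
      have "s * x = s * m + (s * r) * a" for s using x by (simp add: algebra_simps)
      then show "s * x \<in> ?J" for s
        using x ideal_mult[OF M(1), of m s] by blast
      fix y assume "y \<in> ?J"
      then obtain m' r' where y: "y = m' + r' * a" "m' \<in> M" by blast
      have "x + y = (m + m') + (r + r') * a" using x y by (simp add: algebra_simps)
      then show "x + y \<in> ?J"
        using x y ideal_add[OF M(1), of m m'] by blast
    qed
    moreover have "1 \<notin> ?J" using no by force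
    moreover have "M \<subseteq> ?J"
    proof
      fix x assume "x \<in> M"
      moreover have "x = x + 0 * a" by simp
      ultimately show "x \<in> ?J" by blast
    qed
    ultimately have "?J = M" by (rule max)
    moreover have "a = 0 + 1 * a" by simp
    then have "a \<in> ?J" using ideal_0[OF M(1)] by blast
    ultimately show False using that by blast
  qed
  have "a \<in> M \<or> b \<in> M" if ab: "a * b \<in> M" for a b
  proof (rule ccontr)
    assume "\<not> (a \<in> M \<or> b \<in> M)"
    then obtain m r where m: "m \<in> M" "m + r * a = 1" and b: "b \<notin> M" using enlarge[of a] by blast
    have "b = m * b + r * (a * b)" using m(2) by (metis distrib_right mult.assoc mult_1)
    also have "\<dots> \<in> M" by (intro ideal_add ideal_mult ideal_mult_right M(1) m(1) ab)
    finally show False using b by simp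
  qed
  then show ?thesis using M by (auto simp: prime_ring_ideal_def)
qed

lemma prime_ideal_power:
  assumes "prime_ring_ideal P" "a ^ n \<in> P"
  shows "a \<in> P"
  using assms(2) by (induction n) (use assms(1) in \<open>auto simp: prime_ring_ideal_def\<close>)

text \<open>The leading coefficient of \<open>g\<close> need not be invertible, so every step of the division first multiplies
  by it; only ring operations occur, and the coefficients stay in the subring.\<close>

lemma pseudo_division_in_subring:
  fixes f g :: "'a::comm_ring_1 mpoly poly"
  assumes f: "\<And>i. coeff f i \<in> mpolys k" and g: "\<And>i. coeff g i \<in> mpolys k"
  obtains m u r where "\<And>i. coeff u i \<in> mpolys k" "\<And>i. coeff r i \<in> mpolys k"
    "smult (lead_coeff g ^ m) f = u * g + r" "\<And>i. i \<ge> degree g \<Longrightarrow> coeff r i = 0"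
proof -
  let ?e = "degree g" and ?l = "lead_coeff g"
  have "\<exists>m u r. (\<forall>i. coeff u i \<in> mpolys k) \<and> (\<forall>i. coeff r i \<in> mpolys k) \<and>
    smult (?l ^ m) f = u * g + r \<and> (\<forall>i\<ge>?e. coeff r i = 0)"
    if "\<forall>i\<ge>n. coeff f i = 0" "\<forall>i. coeff f i \<in> mpolys k" for n and f :: "'a mpoly poly"
    using that
  proof (induction n arbitrary: f)
    case 0
    then show ?case by (intro exI[of _ 0] exI[of _ f]) auto
  next
    case (Suc n)
    show ?case
    proof (cases "n < ?e")
      case True
      with Suc.prems show ?thesis by (intro exI[of _ 0] exI[of _ f]) auto
    next
      case False
      let ?c = "coeff f n"
      let ?f = "smult ?l f - monom ?c (n - ?e) * g"
      have "coeff ?f i = 0" if "i \<ge> n" for i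
      proof (cases "i = n")
        case True
        with False show ?thesis by (simp add: coeff_monom_mult mult.commute[of "coeff f n"])
      next
        case i: False
        with that have "coeff f i = 0" "coeff g (i - (n - ?e)) = 0"
          using Suc.prems(1) False by (auto intro!: coeff_eq_0)
        then show ?thesis by (simp add: coeff_monom_mult)
      qed
      moreover have "coeff ?f i \<in> mpolys k" for i
        using Suc.prems(2) g by (auto simp: coeff_monom_mult)
      ultimately obtain m u r where *: "\<forall>i. coeff u i \<in> mpolys k" "\<forall>i. coeff r i \<in> mpolys k"
        "smult (?l ^ m) ?f = u * g + r" "\<forall>i\<ge>?e. coeff r i = 0"
        using Suc.IH[of ?f] by blast
      have "smult (?l ^ Suc m) f = smult (?l ^ m) ?f + smult (?l ^ m) (monom ?c (n - ?e)) * g"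
        by (simp add: smult_diff_right mult.commute)
      also have "\<dots> = (u + smult (?l ^ m) (monom ?c (n - ?e))) * g + r"
        by (simp only: *(3)) (simp add: algebra_simps)
      finally have "smult (?l ^ Suc m) f = (u + smult (?l ^ m) (monom ?c (n - ?e))) * g + r" .
      moreover have "coeff (u + smult (?l ^ m) (monom ?c (n - ?e))) i \<in> mpolys k" for i
        using *(1) g Suc.prems(2) by (auto intro!: mpolys_add mpolys_mult mpolys_power)
      ultimately show ?thesis using *(2,4) by blast
    qed
  qed
  from this[of "Suc (degree f)" f] f show ?thesis using that
    by (auto simp: coeff_eq_0 Suc_le_eq)
qed

text \<open>Terms with coefficients in \<open>P\<close> do not matter modulo \<open>P\<close>. Without the topmost of them, the degree of
  a polynomial is its degree modulo \<open>P\<close>, and minimal degrees can be compared over the domain of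
  residue classes.\<close>

lemma trim_to_leading_coeff_outside:
  fixes q :: "'r::comm_ring_1 poly"
  assumes P: "ring_ideal P" and "coeff q i \<notin> P"
  obtains q' where "\<And>i. coeff q' i = coeff q i \<or> coeff q' i = 0" "lead_coeff q' \<notin> P"
    "\<And>i. coeff (q - q') i \<in> P"
proof -
  let ?N = "{i. coeff q i \<notin> P}"
  have fin: "finite ?N"
    by (rule finite_subset[of _ "{..degree q}"])
      (use ideal_0[OF P] in \<open>auto intro: le_degree\<close>)
  define e where "e = Max ?N"
  have e: "coeff q e \<notin> P" using Max_in[OF fin] assms(2) unfolding e_def by blast
  have above: "coeff q j \<in> P" if "j > e" for j
    using Max_ge[OF fin, of j] that unfolding e_def by fastforce
  let ?q = "poly_cutoff (Suc e) q"
  have co: "coeff ?q j = (if j \<le> e then coeff q j else 0)" for j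
    by (simp add: coeff_poly_cutoff less_Suc_eq_le)
  have "degree ?q = e"
  proof (rule antisym)
    show "degree ?q \<le> e" by (rule degree_le) (simp add: co)
    have "coeff q e \<noteq> 0" using e ideal_0[OF P] by metis
    then show "e \<le> degree ?q" by (intro le_degree) (simp add: co)
  qed
  then show ?thesis
    using above e ideal_0[OF P] by (intro that[of ?q]) (auto simp: co)
qed

text \<open>Over a finite field \<open>\<Prod>\<^sub>a (T - a) + 1\<close> has no root.\<close>

lemma infinite_alg_closed: "infinite (UNIV :: 'a::alg_closed_field set)"
proof
  assume fin: "finite (UNIV :: 'a set)"
  let ?p = "(\<Prod>a\<in>UNIV. [:- a, 1:]) + 1 :: 'a poly"
  have "degree (\<Prod>a\<in>UNIV. [:- a, 1:] :: 'a poly) = (\<Sum>a\<in>(UNIV :: 'a set). 1)"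
    by (subst degree_prod_eq_sum_degree) auto
  then have "degree ?p > 0"
    using fin by (subst degree_add_eq_left) (auto simp: card_gt_0_iff)
  then obtain x where "poly ?p x = 0" using alg_closed_imp_poly_has_root by blast
  moreover have "poly (\<Prod>a\<in>UNIV. [:- a, 1:]) x = 0"
    using fin by (auto simp: poly_prod)
  ultimately show False by simp
qed

lemma mpoly_eval_update_poly:
  fixes a :: "nat \<Rightarrow> 'a::comm_ring_1"
  assumes "\<And>i. coeff p i \<in> mpolys k"
  shows "mpoly_eval (a(k := t)) (poly p (mvar k)) = poly (map_poly (mpoly_eval a) p) t"
  using assms
proof (induction p)
  case 0
  then show ?case by (simp add: eval.zero)
next
  case (pCons c p)
  have c: "c \<in> mpolys k" and p: "coeff p i \<in> mpolys k" for i
    using pCons(3)[of 0] pCons(3)[of "Suc i"] by auto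
  have "mpoly_eval (a(k := t)) c = mpoly_eval a c"
    by (rule mpoly_subst_cong_vars[OF c]) simp
  with pCons(2)[OF p] show ?case
    by (simp del: fun_upd_apply add: fun_upd_same eval.add eval.mult map_poly_pCons[of "mpoly_eval a", OF eval.zero] eval.zero)
qed

lemma poly_in_mpolys_Suc:
  assumes "\<And>i. coeff p i \<in> mpolys k"
  shows "poly p (mvar k :: 'a::comm_ring_1 mpoly) \<in> mpolys (Suc k)"
proof -
  have "mpolys k \<subseteq> (mpolys (Suc k) :: 'a mpoly set)" using mpolys_mono[of k "Suc k"] by auto
  with assms show ?thesis
    unfolding poly_altdef by (intro mpolys_sum mpolys_mult mpolys_power mpolys_mvar) auto
qed

definition zero_of_ideal where
  "zero_of_ideal k P a \<longleftrightarrow> (\<forall>q\<in>P \<inter> mpolys k. mpoly_eval a q = 0)"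

text \<open>Modulo \<open>P\<close>, the polynomials in \<open>x\<^sub>0, \<dots>, x\<^sub>k\<close> form a domain \<open>A[y]\<close>, where \<open>A\<close> is generated by the first
  \<open>k\<close> variables and \<open>y\<close> is the class of \<open>x\<^sub>k\<close>. A zero \<open>a\<close> of \<open>P\<close> in the first \<open>k\<close> coordinates is a
  homomorphism \<open>A \<rightarrow> K\<close>, to be extended to \<open>A[y]\<close> without killing \<open>b\<close>.

  If \<open>y\<close> is transcendental over \<open>A\<close>, then \<open>y\<close> may be sent to any value, and \<open>b\<close> survives for all but
  finitely many values if one of its coefficients does. If \<open>y\<close> is algebraic, it must be sent to a root
  of the image of its minimal polynomial \<open>p\<close>, which exists if the leading coefficient of \<open>p\<close> survives;
  and \<open>b\<close> divides a nonzero element \<open>c0\<close> of \<open>A\<close>, so that it survives if \<open>c0\<close> does. In all cases \<open>a\<close> is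
  only required not to be a zero of a single element outside \<open>P\<close>, which the induction hypothesis
  provides. This is why the statement carries the element \<open>b\<close> along.\<close>

lemma extend_zero_by_one_coordinate:
  fixes P :: "'a::alg_closed_field mpoly set"
  assumes P: "prime_ring_ideal P"
    and IH: "\<And>b. b \<in> mpolys k \<Longrightarrow> b \<notin> P \<Longrightarrow> \<exists>a. zero_of_ideal k P a \<and> mpoly_eval a b \<noteq> 0"
    and b: "b \<in> mpolys (Suc k)" "b \<notin> P"
  shows "\<exists>a. zero_of_ideal (Suc k) P a \<and> mpoly_eval a b \<noteq> 0"
proof -
  define y :: "'a mpoly" where "y = mvar k"
  have I: "ring_ideal P" and prime: "\<And>a b. a * b \<in> P \<Longrightarrow> a \<in> P \<or> b \<in> P"
    and one: "1 \<notin> P"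
    using P by (auto simp: prime_ring_ideal_def)
  define poly_over :: "'a mpoly poly \<Rightarrow> bool" where "poly_over p \<longleftrightarrow> (\<forall>i. coeff p i \<in> mpolys k)" for p
  have ev: "mpoly_eval (a(k := t)) (poly p y) = poly (map_poly (mpoly_eval a) p) t"
    if "poly_over p" for a t p
    using mpoly_eval_update_poly[of p k a t] that by (simp add: y_def poly_over_def)
  have ev0: "mpoly_eval (a(k := t)) c = mpoly_eval a c" if "c \<in> mpolys k" for a t c
    by (rule mpoly_subst_cong_vars[OF that]) simp
  have kill: "mpoly_eval (a(k := t)) (poly p y) = 0"
    if "poly_over p" "\<And>i. coeff p i \<in> P" "zero_of_ideal k P a" for a t p
  proof -
    have "map_poly (mpoly_eval a) p = 0"
      using that by (intro poly_eqI) (auto simp: coeff_map_poly eval.zero poly_over_def zero_of_ideal_def)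
    with ev[OF that(1)] show ?thesis by simp
  qed
  obtain B where B: "poly_over B" "b = poly B y"
    using mpolys_Suc_as_poly[OF b(1)] by (auto simp: poly_over_def y_def)
  show ?thesis
  proof (cases "\<forall>q. poly_over q \<and> poly q y \<in> P \<longrightarrow> (\<forall>i. coeff q i \<in> P)")
    \<comment> \<open>The class of \<open>x\<^sub>k\<close> is transcendental: only polynomials with coefficients in \<open>P\<close> vanish at it modulo \<open>P\<close>.\<close>
    case True
    obtain i where i: "coeff B i \<notin> P" using ideal_poly[OF I, of B y] b(2) B(2) by blast
    then obtain a where a: "zero_of_ideal k P a" "mpoly_eval a (coeff B i) \<noteq> 0"
      using IH[of "coeff B i"] B(1) by (auto simp: poly_over_def)
    have "coeff (map_poly (mpoly_eval a) B) i \<noteq> 0"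
      using a(2) by (simp add: coeff_map_poly eval.zero)
    then have "map_poly (mpoly_eval a) B \<noteq> 0" by force
    then obtain t where t: "poly (map_poly (mpoly_eval a) B) t \<noteq> 0"
      using poly_roots_finite[of "map_poly (mpoly_eval a) B"] infinite_alg_closed
      by (metis (mono_tags, lifting) UNIV_eq_I mem_Collect_eq)
    have "mpoly_eval (a(k := t)) q = 0" if q: "q \<in> P \<inter> mpolys (Suc k)" for q
    proof -
      obtain Qp where "poly_over Qp" "q = poly Qp y"
        using mpolys_Suc_as_poly[of q k] q by (auto simp: poly_over_def y_def)
      then show ?thesis using True q kill[of Qp a t] a(1) by blast
    qed
    then have "zero_of_ideal (Suc k) P (a(k := t))" by (simp add: zero_of_ideal_def)
    moreover have "mpoly_eval (a(k := t)) b \<noteq> 0" using t ev[OF B(1)] B(2) by simp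
    ultimately show ?thesis by blast
  next
    case False
    \<comment> \<open>The class of \<open>x\<^sub>k\<close> is algebraic. The polynomials with value \<open>0\<close> modulo \<open>P\<close>, and those with value in
      the ideal generated by \<open>b\<close> modulo \<open>P\<close>, are compared through elements \<open>p\<close> and \<open>g\<close> of least degree.\<close>
    define L where "L J = {q. poly_over q \<and> lead_coeff q \<notin> P \<and> poly q y \<in> J}" for J
    define J where "J = {z + c * b | z c. z \<in> P \<and> c \<in> mpolys (Suc k)}"
    have PJ: "P \<subseteq> J" unfolding J_def by (force intro: exI[of _ 0])
    have J_add: "x + x' \<in> J" if J: "x \<in> J" "x' \<in> J" for x x'
    proof -
      obtain z c z' c' where "x = z + c * b" "z \<in> P" "c \<in> mpolys (Suc k)"
        "x' = z' + c' * b" "z' \<in> P" "c' \<in> mpolys (Suc k)"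
        using J unfolding J_def by blast
      moreover have "z + c * b + (z' + c' * b) = (z + z') + (c + c') * b" by (simp add: algebra_simps)
      ultimately show ?thesis unfolding J_def using ideal_add[OF I] by blast
    qed
    have J_mult: "u * x \<in> J" if J: "x \<in> J" "u \<in> mpolys (Suc k)" for u x
    proof -
      obtain z c where "x = z + c * b" "z \<in> P" "c \<in> mpolys (Suc k)"
        using J unfolding J_def by blast
      moreover have "u * (z + c * b) = u * z + (u * c) * b" by (simp add: algebra_simps)
      ultimately show ?thesis unfolding J_def using ideal_mult[OF I] J(2) by blast
    qed
    have over_eval: "poly p y \<in> mpolys (Suc k)" if "poly_over p" for p
      using poly_in_mpolys_Suc[of p k] that by (simp add: poly_over_def y_def)
    have trim: "\<exists>q'\<in>L K. degree q' \<le> degree q \<and> (\<forall>i. coeff (q - q') i \<in> P)"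
      if q: "poly_over q" "coeff q i \<notin> P" "poly q y \<in> K" and K: "K = P \<or> K = J" for q i K
    proof -
      obtain q' where q': "\<And>i. coeff q' i = coeff q i \<or> coeff q' i = 0" "lead_coeff q' \<notin> P"
        "\<And>i. coeff (q - q') i \<in> P"
        using trim_to_leading_coeff_outside[OF I q(2)] by metis
      have "poly q' y = poly q y + - poly (q - q') y" by simp
      moreover have "- poly (q - q') y \<in> P" using ideal_poly[OF I q'(3)] ideal_uminus[OF I] by blast
      ultimately have "poly q' y \<in> K"
        using K q(3) J_add PJ ideal_add[OF I] by (metis subset_iff)
      moreover have "poly_over q'" using q(1) q'(1) by (metis poly_over_def mpolys_0)
      moreover have "degree q' \<le> degree q" by (rule degree_le) (metis q'(1) coeff_eq_0)
      ultimately show ?thesis using q'(2,3) by (auto simp: L_def)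
    qed
    have small: "coeff q i \<in> P"
      if q: "poly_over q" "poly q y \<in> K" "K = P \<or> K = J" "\<And>q'. q' \<in> L K \<Longrightarrow> d \<le> degree q'"
        "\<And>i. i \<ge> d \<Longrightarrow> coeff q i = 0" for q K d i
    proof (rule ccontr)
      assume "coeff q i \<notin> P"
      then obtain q' where "q' \<in> L K" "degree q' \<le> degree q" using trim q(1-3) by blast
      then have "d \<le> degree q" using q(4) by fastforce
      then have "lead_coeff q = 0" using q(5) by blast
      then show False using \<open>coeff q i \<notin> P\<close> ideal_0[OF I] by simp
    qed
    have "L P \<noteq> {}" using False trim[of _ _ P] by blast
    then obtain p where p: "p \<in> L P" and p_min: "\<And>q. q \<in> L P \<Longrightarrow> degree p \<le> degree q"
      using ex_has_least_nat[of "\<lambda>q. q \<in> L P" _ degree] by blast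
    have "L P \<subseteq> L J" using PJ by (auto simp: L_def)
    then obtain g where g: "g \<in> L J" and g_min: "\<And>q. q \<in> L J \<Longrightarrow> degree g \<le> degree q"
      using ex_has_least_nat[of "\<lambda>q. q \<in> L J" _ degree] p by blast
    define l where "l = lead_coeff p"
    have p': "poly_over p" "l \<notin> P" "poly p y \<in> P" using p by (auto simp: L_def l_def)
    have g': "poly_over g" "lead_coeff g \<notin> P" "poly g y \<in> J" using g by (auto simp: L_def)
    have deg_p: "degree p > 0"
    proof (rule ccontr)
      assume "\<not> degree p > 0"
      then obtain c where "p = [:c:]" using degree_eq_zeroE by blast
      then show False using p' by (simp add: l_def)
    qed
    have lP: "l ^ m * x \<in> P \<Longrightarrow> x \<in> P" for m x using prime prime_ideal_power[OF P] p'(2) by blast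
    \<comment> \<open>That \<open>g\<close> is constant says that \<open>b\<close> divides a nonzero element of \<open>A\<close>. Otherwise division of \<open>p\<close>
      by \<open>g\<close> gives \<open>u g = 0\<close> in the domain \<open>A[y]\<close>. If \<open>g\<close> vanishes there, it has at least the degree of
      \<open>p\<close>, and the remainder of \<open>B\<close> modulo \<open>p\<close>, of smaller degree, must be \<open>0\<close>, contrary to \<open>b \<noteq> 0\<close>.
      If \<open>u\<close> vanishes, its degree is too small for that.\<close>
    have "degree g = 0"
    proof (rule ccontr)
      assume "degree g \<noteq> 0"
      obtain m u r where ur: "poly_over u" "poly_over r"
        "smult (lead_coeff g ^ m) p = u * g + r" "\<And>i. i \<ge> degree g \<Longrightarrow> coeff r i = 0"
        using pseudo_division_in_subring[of p k g] p'(1) g'(1) unfolding poly_over_def by metis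
      have eq: "poly r y = lead_coeff g ^ m * poly p y + (- poly u y) * poly g y"
        using arg_cong[OF ur(3), of "\<lambda>q. poly q y"] by simp
      have "lead_coeff g ^ m * poly p y \<in> J" using PJ ideal_mult[OF I p'(3)] by blast
      moreover have "(- poly u y) * poly g y \<in> J"
        using over_eval[OF ur(1)] by (intro J_mult g'(3) mpolys_uminus)
      ultimately have "poly r y \<in> J" unfolding eq by (rule J_add)
      then have rP: "coeff r i \<in> P" for i
        using small[OF ur(2) _ _ g_min, of J] ur(4) by blast
      have "poly u y * poly g y = lead_coeff g ^ m * poly p y - poly r y"
        using eq by simp
      also have "\<dots> \<in> P" by (intro ideal_diff[OF I] ideal_mult[OF I] p'(3) ideal_poly[OF I] rP)
      finally consider "poly g y \<in> P" | "poly u y \<in> P" using prime by blast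
      then show False
      proof cases
        case 1
        then have "g \<in> L P" using g' by (simp add: L_def)
        then have pg: "degree p \<le> degree g" by (rule p_min)
        obtain m' w s where ws: "poly_over w" "poly_over s"
          "smult (l ^ m') B = w * p + s" "\<And>i. i \<ge> degree p \<Longrightarrow> coeff s i = 0"
          using pseudo_division_in_subring[of B k p] p'(1) B(1) unfolding poly_over_def l_def by metis
        have eq': "l ^ m' * b = poly w y * poly p y + poly s y"
          using arg_cong[OF ws(3), of "\<lambda>q. poly q y"] B(2) by simp
        then have "poly s y = - (poly w y * poly p y) + l ^ m' * b" by simp
        also have "\<dots> \<in> J"
        proof -
          have "l ^ m' \<in> mpolys (Suc k)"
            using p'(1) mpolys_mono[of k "Suc k"] by (auto simp: l_def poly_over_def)
          then show ?thesis
            unfolding J_def using ideal_uminus[OF I] ideal_mult[OF I] p'(3) by blast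
        qed
        finally have "coeff s i \<in> P" for i
          using small[of s J "degree p"] ws(2,4) pg g_min by (meson order_trans)
        then have "l ^ m' * b \<in> P"
          unfolding eq' by (intro ideal_add[OF I] ideal_mult[OF I] p'(3) ideal_poly[OF I])
        then show False using lP b(2) by blast
      next
        case 2
        have "\<exists>i. coeff u i \<notin> P"
        proof (rule ccontr)
          assume "\<not> ?thesis"
          then have "coeff (u * g + r) (degree p) \<in> P"
            unfolding coeff_add coeff_mult
            by (intro ideal_add[OF I] ideal_sum[OF I] ideal_mult_right[OF I] rP) auto
          then have "lead_coeff g ^ m * l \<in> P" by (simp add: ur(3)[symmetric] l_def)
          then show False using prime prime_ideal_power[OF P] p'(2) g'(2) by blast
        qed
        then obtain u' where u': "u' \<in> L P" "\<And>i. coeff (u - u') i \<in> P"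
          using trim[OF ur(1) _ 2] by blast
        let ?j = "degree u' + degree g"
        have "degree p < ?j" using p_min[OF u'(1)] \<open>degree g \<noteq> 0\<close> by linarith
        then have "coeff (u * g) ?j = 0"
          using arg_cong[OF ur(3), of "\<lambda>q. coeff q ?j"] ur(4)[of ?j] by (simp add: coeff_eq_0)
        moreover have "u * g = u' * g + (u - u') * g" by (simp add: algebra_simps)
        ultimately have "lead_coeff u' * lead_coeff g = - coeff ((u - u') * g) ?j"
          by (simp add: coeff_mult_degree_sum eq_neg_iff_add_eq_0)
        also have "\<dots> \<in> P"
          unfolding coeff_mult
          by (intro ideal_uminus[OF I] ideal_sum[OF I] ideal_mult_right[OF I] u'(2))
        finally show False using prime g'(2) u'(1) by (auto simp: L_def)
      qed
    qed
    then obtain c0 where c0: "g = [:c0:]" using degree_eq_zeroE by blast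
    then have c0': "c0 \<in> mpolys k" "c0 \<notin> P" "c0 \<in> J"
      using g' by (auto simp: poly_over_def dest: spec[of _ 0])
    obtain z c where zc: "c0 = z + c * b" "z \<in> P" "c \<in> mpolys (Suc k)"
      using c0'(3) unfolding J_def by blast
    have lk: "l \<in> mpolys k" using p'(1) by (simp add: poly_over_def l_def)
    obtain a where a: "zero_of_ideal k P a" "mpoly_eval a (c0 * l) \<noteq> 0"
      using IH[of "c0 * l"] lk c0' p'(2) prime by blast
    then have al: "mpoly_eval a l \<noteq> 0" "mpoly_eval a c0 \<noteq> 0" by (auto simp: eval.mult)
    have "degree (map_poly (mpoly_eval a) p) = degree p"
      using al by (intro antisym degree_le le_degree)
        (auto simp: coeff_map_poly eval.zero l_def coeff_eq_0)
    then obtain t where t: "poly (map_poly (mpoly_eval a) p) t = 0"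
      using alg_closed_imp_poly_has_root deg_p by metis
    let ?a = "a(k := t)"
    have evp: "mpoly_eval ?a (poly p y) = 0" using ev[OF p'(1)] t by simp
    have zero: "mpoly_eval ?a q = 0" if q: "q \<in> P \<inter> mpolys (Suc k)" for q
    proof -
      obtain Qp where Qp: "poly_over Qp" "q = poly Qp y"
        using mpolys_Suc_as_poly[of q k] q by (auto simp: poly_over_def y_def)
      obtain m' w s where ws: "poly_over w" "poly_over s"
        "smult (l ^ m') Qp = w * p + s" "\<And>i. i \<ge> degree p \<Longrightarrow> coeff s i = 0"
        using pseudo_division_in_subring[of Qp k p] p'(1) Qp(1) unfolding poly_over_def l_def by metis
      have eq': "l ^ m' * q = poly w y * poly p y + poly s y"
        using arg_cong[OF ws(3), of "\<lambda>q. poly q y"] Qp(2) by simp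
      then have "poly s y = l ^ m' * q - poly w y * poly p y" by simp
      also have "\<dots> \<in> P" using q p'(3) by (intro ideal_diff[OF I] ideal_mult[OF I]) auto
      finally have "coeff s i \<in> P" for i
        using small[of s P "degree p"] ws(2,4) p_min by blast
      then have "mpoly_eval ?a (poly s y) = 0" using kill[OF ws(2) _ a(1)] by blast
      then have "mpoly_eval a l ^ m' * mpoly_eval ?a q = 0"
        using arg_cong[OF eq', of "mpoly_eval ?a"]
        by (simp add: eval.add eval.mult eval.power evp ev0[OF lk])
      then show ?thesis using al by simp
    qed
    have "z = c0 - c * b" using zc(1) by simp
    moreover have "c0 \<in> mpolys (Suc k)" using c0'(1) mpolys_mono[of k "Suc k"] by auto
    ultimately have "z \<in> mpolys (Suc k)" using zc(3) b(1) by auto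
    then have "mpoly_eval ?a z = 0" using zero zc(2) by blast
    then have "mpoly_eval ?a c * mpoly_eval ?a b \<noteq> 0"
      using al(2) ev0[OF c0'(1), of a t] zc(1) by (simp add: eval.add eval.mult)
    then show ?thesis using zero unfolding zero_of_ideal_def by (intro exI[of _ ?a]) auto
  qed
qed

text \<open>Starting with no coordinates and \<open>b = 1\<close>, the zero of a prime ideal above \<open>I\<close> is built up by
  adding one coordinate at a time.\<close>

theorem nullstellensatz:
  fixes I :: "'a::alg_closed_field mpoly set"
  assumes "ring_ideal I" "1 \<notin> I"
  shows "\<exists>a. \<forall>q\<in>I \<inter> mpolys k. mpoly_eval a q = 0"
proof -
  obtain P where P: "I \<subseteq> P" "prime_ring_ideal P" using ex_prime_ideal_above[OF assms] by blast
  have "\<exists>a. zero_of_ideal k P a \<and> mpoly_eval a b \<noteq> 0" if "b \<in> mpolys k" "b \<notin> P" for b and k :: nat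
    using that
  proof (induction k arbitrary: b)
    case 0
    have const: "\<exists>c. q = mconst c" if "q \<in> mpolys 0" for q :: "'a mpoly"
    proof -
      have "Poly_Mapping.lookup q m = 0" if "m \<noteq> 0" for m
        using \<open>q \<in> mpolys 0\<close> that by (auto simp: mpolys_def in_keys_iff)
      then have "q = mconst (Poly_Mapping.lookup q 0)"
        by (intro poly_mapping_eqI) (auto simp: lookup_single when_def)
      then show ?thesis by blast
    qed
    have "c = 0" if "mconst c \<in> P" for c
    proof (rule ccontr)
      assume "c \<noteq> 0"
      then have "mconst (inverse c) * mconst c = (1 :: 'a mpoly)" by (simp add: mult_single)
      then show False using P(2) that by (metis prime_ring_ideal_def ideal_mult)
    qed
    then have "zero_of_ideal 0 P a" for a
      using const by (fastforce simp: zero_of_ideal_def)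
    moreover obtain c where "b = mconst c" using const 0(1) by blast
    moreover have "0 \<in> P" using P(2) by (simp add: prime_ring_ideal_def ring_ideal_def)
    ultimately show ?case using 0(2) by (intro exI) auto
  next
    case (Suc k)
    then show ?case using extend_zero_by_one_coordinate[OF P(2)] by blast
  qed
  from this[of 1 k] show ?thesis
    using P by (auto simp: zero_of_ideal_def prime_ring_ideal_def)
qed

section \<open>Entire functions and the Gauss norm\<close>

text \<open>One of the two indices is large and the other factor is bounded. Both the decay of the coefficients
  of a product and the convergence of Cauchy products rest on this.\<close>

lemma null_product_double_index:
  fixes x y :: "nat \<Rightarrow> real"
  assumes "x \<longlonglongrightarrow> 0" "y \<longlonglongrightarrow> 0" "\<And>i. x i \<ge> 0" "\<And>i. y i \<ge> 0" "\<epsilon> > 0"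
  obtains n where "\<And>i j. i + j \<ge> n \<Longrightarrow> x i * y j < \<epsilon>"
proof -
  obtain B where B: "B > 0" "\<And>i. \<bar>x i\<bar> \<le> B" "\<And>i. \<bar>y i\<bar> \<le> B"
  proof -
    have "Bseq x" "Bseq y" using assms(1,2) by (auto intro: convergent_imp_Bseq convergentI)
    then obtain K L where "K > 0" "\<And>i. \<bar>x i\<bar> \<le> K" "L > 0" "\<And>i. \<bar>y i\<bar> \<le> L"
      unfolding Bseq_def by auto
    then show ?thesis by (intro that[of "max K L"]) (auto simp: le_max_iff_disj)
  qed
  have "\<epsilon> / B > 0" using B(1) assms(5) by simp
  then have "\<forall>\<^sub>F i in sequentially. x i < \<epsilon> / B" "\<forall>\<^sub>F i in sequentially. y i < \<epsilon> / B"
    using assms(1,2) by (auto dest: order_tendstoD)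
  then have "\<forall>\<^sub>F i in sequentially. x i < \<epsilon> / B \<and> y i < \<epsilon> / B" by eventually_elim auto
  then obtain m where m: "\<And>i. i \<ge> m \<Longrightarrow> x i < \<epsilon> / B \<and> y i < \<epsilon> / B"
    unfolding eventually_sequentially by blast
  have "x i * y j < \<epsilon>" if "i + j \<ge> 2 * m" for i j
  proof (cases "i \<ge> m")
    case True
    have "x i * y j \<le> x i * B" using assms(3,4) B(3)[of j] by (intro mult_left_mono) auto
    also have "\<dots> < \<epsilon>" using m[OF True] B(1) by (simp add: field_simps)
    finally show ?thesis .
  next
    case False
    then have "j \<ge> m" using that by simp
    have "x i * y j \<le> B * y j" using assms(3,4) B(2)[of i] by (intro mult_right_mono) auto
    also have "\<dots> < \<epsilon>" using m[OF \<open>j \<ge> m\<close>] B(1) by (simp add: field_simps)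
    finally show ?thesis .
  qed
  then show ?thesis by (rule that)
qed

lemma null_sequence_attains_max:
  fixes x :: "nat \<Rightarrow> real"
  assumes "x \<longlonglongrightarrow> 0" "\<And>i. x i \<ge> 0"
  obtains i where "\<And>j. x j \<le> x i"
proof (cases "\<exists>k. x k > 0")
  case True
  then obtain k where k: "x k > 0" by blast
  then obtain n where n: "\<And>i. i \<ge> n \<Longrightarrow> x i < x k"
    using order_tendstoD(2)[OF assms(1) k] unfolding eventually_sequentially by blast
  have "Max (x ` {..max n k}) \<in> x ` {..max n k}" by (rule Max_in) auto
  then obtain i where i: "x i = Max (x ` {..max n k})" by force
  have le: "x j \<le> x i" if "j \<le> max n k" for j unfolding i using that by (intro Max_ge) auto
  have "x j \<le> x i" for j
  proof (cases "j \<le> max n k")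
    case False
    then have "x j < x k" by (intro n) auto
    also have "\<dots> \<le> x i" by (rule le) auto
    finally show ?thesis by simp
  qed (rule le)
  then show ?thesis by (rule that)
next
  case False
  then show ?thesis using assms(2) by (intro that[of 0]) (metis linorder_not_less order_trans)
qed

context nonarch_absval begin

lemma v_0 [simp]: "v 0 = 0" by (simp add: eq_0_iff)

lemma v_1 [simp]: "v 1 = 1" using mult[of 1 1] eq_0_iff[of 1] by simp

lemma v_power: "v (x ^ n) = v x ^ n" by (induction n) (simp_all add: mult)

lemma v_uminus [simp]: "v (- x) = v x"
proof -
  have "v (-1) ^ 2 = 1" using v_power[of "-1" 2] by simp
  then have "v (-1) = 1" using nonneg[of "-1"] by (auto simp: power2_eq_1_iff)
  then show ?thesis using mult[of "-1" x] by simp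
qed

lemma v_diff_commute: "v (x - y) = v (y - x)"
  using v_uminus[of "x - y"] by simp

lemma v_add_le: "v (x + y) \<le> v x + v y"
  using ultrametric[of x y] nonneg[of x] nonneg[of y] by linarith

lemma v_sum_le: "B \<ge> 0 \<Longrightarrow> (\<And>x. x \<in> A \<Longrightarrow> v (f x) \<le> B) \<Longrightarrow> v (sum f A) \<le> B"
proof (induction A rule: infinite_finite_induct)
  case (insert x A)
  then show ?case using ultrametric[of "f x" "sum f A"] by fastforce
qed auto

lemma v_sum_less: "B > 0 \<Longrightarrow> (\<And>x. x \<in> A \<Longrightarrow> v (f x) < B) \<Longrightarrow> v (sum f A) < B"
proof (induction A rule: infinite_finite_induct)
  case (insert x A)
  then show ?case using ultrametric[of "f x" "sum f A"] by fastforce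
qed auto

lemma v_add_eq_left: "v y < v x \<Longrightarrow> v (x + y) = v x"
  using ultrametric[of x y] ultrametric[of "x + y" "- y"] by (auto simp: max_def split: if_splits)

text \<open>The trivial absolute value is complete, and its entire functions are the polynomials. Arguments that
  evaluate at points of large or small absolute value need a separate treatment of this case.\<close>

lemma trivial_or_large: "(\<forall>x. x \<noteq> 0 \<longrightarrow> v x = 1) \<or> (\<exists>x. v x > 1)"
proof (rule ccontr)
  assume *: "\<not> ?thesis"
  then obtain x where x: "x \<noteq> 0" "v x \<noteq> 1" and le: "\<And>y. v y \<le> 1" by (auto simp: not_less)
  have "v x * v (inverse x) = 1" using x mult[of x "inverse x"] by simp
  moreover have "v x < 1" "v x \<ge> 0" using le[of x] x nonneg by auto
  ultimately show False
    using le[of "inverse x"] mult_left_le[of "v (inverse x)" "v x"] by linarith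
qed

text \<open>The coefficient condition satisfied by entire functions. It is preserved by ring operations, as
  estimates of coefficients show, and suffices for all properties of the Gauss norm.\<close>

definition decays :: "'a fps \<Rightarrow> bool" where
  "decays g \<longleftrightarrow> (\<forall>r\<ge>0. (\<lambda>i. v (fps_nth g i) * r ^ i) \<longlonglongrightarrow> 0)"

lemma fps_sums_at_iff:
  "fps_sums_at v g z s \<longleftrightarrow> (\<lambda>k. v ((\<Sum>i<k. fps_nth g i * z ^ i) - s)) \<longlonglongrightarrow> 0"
  by (simp add: fps_sums_at_def Metric_space.limit_metric_sequentially[OF Metric_space_absval]
      absval_dist_def LIMSEQ_def dist_real_def nonneg)

lemma fps_sums_at_unique: "fps_sums_at v g z s \<Longrightarrow> fps_sums_at v g z t \<Longrightarrow> s = t"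
  unfolding fps_sums_at_def
  by (rule Metric_space.limitin_metric_unique[OF Metric_space_absval]) auto

lemma entire_eval_eq: "fps_sums_at v g z s \<Longrightarrow> entire_eval v g z = s"
  unfolding entire_eval_def using fps_sums_at_unique by blast

lemma entire_sums_at_eval: "entire v g \<Longrightarrow> fps_sums_at v g z (entire_eval v g z)"
  using entire_eval_eq unfolding entire_def by metis

lemma fps_sums_at_terms_null:
  assumes "fps_sums_at v g z s"
  shows "(\<lambda>k. v (fps_nth g k) * v z ^ k) \<longlonglongrightarrow> 0"
proof -
  let ?S = "\<lambda>k. \<Sum>i<k. fps_nth g i * z ^ i"
  have lim: "(\<lambda>k. v (?S k - s)) \<longlonglongrightarrow> 0" using assms by (simp add: fps_sums_at_iff)
  have "(\<lambda>k. v (?S (Suc k) - s) + v (?S k - s)) \<longlonglongrightarrow> 0"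
    using tendsto_add[OF LIMSEQ_Suc[OF lim] lim] by simp
  moreover have "norm (v (fps_nth g k) * v z ^ k) \<le> v (?S (Suc k) - s) + v (?S k - s)" for k
  proof -
    have "v (fps_nth g k) * v z ^ k = v ((?S (Suc k) - s) + (s - ?S k))"
      by (simp add: mult v_power)
    also have "\<dots> \<le> v (?S (Suc k) - s) + v (?S k - s)"
      by (rule order_trans[OF v_add_le]) (simp add: v_diff_commute)
    finally show ?thesis by (simp add: nonneg)
  qed
  ultimately show ?thesis by (rule Lim_null_comparison[OF always_eventually, rule_format, rotated])
qed

text \<open>If \<open>v x > 1\<close>, convergence at a power of \<open>x\<close> of absolute value above \<open>r\<close> forces decay at radius \<open>r\<close>.
  For the trivial absolute value, coefficients that tend to \<open>0\<close> are eventually \<open>0\<close>.\<close>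

lemma entire_decays:
  assumes "entire v g"
  shows "decays g"
  unfolding decays_def
proof (intro allI impI)
  fix r :: real assume r: "r \<ge> 0"
  have null: "(\<lambda>k. v (fps_nth g k) * v z ^ k) \<longlonglongrightarrow> 0" for z
    using assms fps_sums_at_terms_null unfolding entire_def by blast
  consider "\<forall>x. x \<noteq> 0 \<longrightarrow> v x = 1" | x where "v x > 1" using trivial_or_large by blast
  then show "(\<lambda>i. v (fps_nth g i) * r ^ i) \<longlonglongrightarrow> 0"
  proof cases
    case 1
    have "\<forall>\<^sub>F k in sequentially. v (fps_nth g k) < 1"
      using order_tendstoD(2)[OF null[of 1], of 1] by simp
    then have "\<forall>\<^sub>F k in sequentially. v (fps_nth g k) * r ^ k = 0"
    proof eventually_elim
      case (elim k)
      then have "fps_nth g k = 0" using 1 by (metis less_irrefl)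
      then show ?case by simp
    qed
    then show ?thesis by (rule tendsto_eventually)
  next
    case 2
    obtain m where m: "r < v x ^ m" using real_arch_pow[OF 2] by blast
    show ?thesis
    proof (rule Lim_null_comparison[OF always_eventually null[of "x ^ m"]], rule allI)
      fix k
      have "v (fps_nth g k) * r ^ k \<le> v (fps_nth g k) * v (x ^ m) ^ k"
        using r m by (intro mult_left_mono power_mono) (auto simp: nonneg v_power)
      then show "norm (v (fps_nth g k) * r ^ k) \<le> v (fps_nth g k) * v (x ^ m) ^ k"
        using r by (simp add: nonneg)
    qed
  qed
qed

lemma decays_const [simp]: "decays (fps_const c)"
  unfolding decays_def
proof (intro allI impI)
  fix r :: real
  have "\<forall>\<^sub>F k in sequentially. v (fps_nth (fps_const c) k) * r ^ k = 0"
    using eventually_gt_at_top[of 0] by eventually_elim simp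
  then show "(\<lambda>k. v (fps_nth (fps_const c) k) * r ^ k) \<longlonglongrightarrow> 0" by (rule tendsto_eventually)
qed

lemma decays_0 [simp]: "decays 0" and decays_1 [simp]: "decays 1"
  using decays_const[of 0] decays_const[of 1] by simp_all

lemma decays_add: "decays g \<Longrightarrow> decays h \<Longrightarrow> decays (g + h)"
  unfolding decays_def
proof (intro allI impI)
  fix r :: real assume r: "r \<ge> 0"
    and "\<forall>r\<ge>0. (\<lambda>i. v (fps_nth g i) * r ^ i) \<longlonglongrightarrow> 0" "\<forall>r\<ge>0. (\<lambda>i. v (fps_nth h i) * r ^ i) \<longlonglongrightarrow> 0"
  then have "(\<lambda>i. v (fps_nth g i) * r ^ i) \<longlonglongrightarrow> 0" "(\<lambda>i. v (fps_nth h i) * r ^ i) \<longlonglongrightarrow> 0"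
    by blast+
  from tendsto_add[OF this]
  have "(\<lambda>i. v (fps_nth g i) * r ^ i + v (fps_nth h i) * r ^ i) \<longlonglongrightarrow> 0" by simp
  then show "(\<lambda>i. v (fps_nth (g + h) i) * r ^ i) \<longlonglongrightarrow> 0"
  proof (rule Lim_null_comparison[OF always_eventually, rotated], intro allI)
    fix i
    have "v (fps_nth g i + fps_nth h i) * r ^ i \<le> (v (fps_nth g i) + v (fps_nth h i)) * r ^ i"
      using r by (intro mult_right_mono v_add_le) auto
    then show "norm (v (fps_nth (g + h) i) * r ^ i) \<le> v (fps_nth g i) * r ^ i + v (fps_nth h i) * r ^ i"
      using r by (simp add: nonneg distrib_right)
  qed
qed

lemma coeff_mult_bound:
  assumes r: "r \<ge> 0" and "B \<ge> 0"
    and B: "\<And>i j. i + j = n \<Longrightarrow> (v (fps_nth g i) * r ^ i) * (v (fps_nth h j) * r ^ j) \<le> B"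
  shows "v (fps_nth (g * h) n) * r ^ n \<le> B"
proof (cases "r ^ n = 0")
  case False
  then have rn: "r ^ n > 0" using zero_le_power[OF r, of n] by linarith
  have "v (fps_nth (g * h) n) \<le> B / r ^ n"
    unfolding fps_mult_nth
  proof (rule v_sum_le)
    fix i assume "i \<in> {0..n}"
    then have n: "i + (n - i) = n" by simp
    then have rr: "r ^ n = r ^ i * r ^ (n - i)" by (metis power_add)
    show "v (fps_nth g i * fps_nth h (n - i)) \<le> B / r ^ n"
      using B[OF n] rn by (simp add: mult field_simps rr)
  qed (use assms rn in auto)
  with rn show ?thesis by (simp add: field_simps)
next
  case True
  show ?thesis unfolding True mult_zero_right by fact
qed

lemma decays_mult:
  assumes "decays g" "decays h"
  shows "decays (g * h)"
  unfolding decays_def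
proof (intro allI impI)
  fix r :: real assume r: "r \<ge> 0"
  let ?x = "\<lambda>i. v (fps_nth g i) * r ^ i" and ?y = "\<lambda>i. v (fps_nth h i) * r ^ i"
  show "(\<lambda>i. v (fps_nth (g * h) i) * r ^ i) \<longlonglongrightarrow> 0"
  proof (rule LIMSEQ_I)
    fix \<epsilon> :: real assume "\<epsilon> > 0"
    then obtain n where n: "\<And>i j. i + j \<ge> n \<Longrightarrow> ?x i * ?y j < \<epsilon> / 2"
      using null_product_double_index[of ?x ?y "\<epsilon> / 2"] assms r
      by (auto simp: decays_def nonneg)
    have "v (fps_nth (g * h) k) * r ^ k \<le> \<epsilon> / 2" if "k \<ge> n" for k
      using n that \<open>\<epsilon> > 0\<close> r by (intro coeff_mult_bound) (auto intro: less_imp_le)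
    then show "\<exists>n. \<forall>k\<ge>n. norm (v (fps_nth (g * h) k) * r ^ k - 0) < \<epsilon>"
      using \<open>\<epsilon> > 0\<close> r by (intro exI[of _ n]) (force simp: nonneg)
  qed
qed

lemma decays_power: "decays g \<Longrightarrow> decays (g ^ n)"
  by (induction n) (auto intro: decays_mult)

lemma decays_mpoly_comp:
  assumes "p \<in> mpolys k" "\<And>i. i < k \<Longrightarrow> decays (f i)"
  shows "decays (mpoly_comp_fps f p)"
  using assms(1)
proof (induction p rule: mpolys_induct)
qed (use assms(2) in \<open>auto simp: ring_morphism.mpoly_subst_mconst[OF ring_morphism_fps_const]
    ring_morphism.mpoly_subst_mvar[OF ring_morphism_fps_const]
    ring_morphism.mpoly_subst_add[OF ring_morphism_fps_const]
    ring_morphism.mpoly_subst_mult[OF ring_morphism_fps_const] intro: decays_add decays_mult\<close>)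

text \<open>The index is the least one at which the supremum is attained: the strict inequality below it is
  what makes the norm multiplicative.\<close>

lemma gauss_norm_max:
  assumes "decays g" "r \<ge> 0"
  obtains i where "gauss_norm v g r = v (fps_nth g i) * r ^ i"
    "\<And>j. v (fps_nth g j) * r ^ j \<le> gauss_norm v g r"
    "\<And>j. j < i \<Longrightarrow> v (fps_nth g j) * r ^ j < gauss_norm v g r"
proof -
  let ?x = "\<lambda>i. v (fps_nth g i) * r ^ i"
  obtain i where i: "\<And>j. ?x j \<le> ?x i"
    using null_sequence_attains_max[of ?x] assms by (auto simp: decays_def nonneg)
  define k where "k = (LEAST i. \<forall>j. ?x j \<le> ?x i)"
  have k: "\<And>j. ?x j \<le> ?x k"
    unfolding k_def by (rule LeastI2[of "\<lambda>i. \<forall>j. ?x j \<le> ?x i" i]) (use i in auto)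
  have less: "?x j < ?x k" if "j < k" for j
  proof (rule ccontr)
    assume "\<not> ?x j < ?x k"
    then have "\<forall>l. ?x l \<le> ?x j" using k by (meson not_less order_trans)
    then have "k \<le> j" unfolding k_def by (rule Least_le)
    with that show False by simp
  qed
  have "gauss_norm v g r = ?x k"
    unfolding gauss_norm_def by (rule cSup_eq_maximum) (use k in auto)
  then show ?thesis using k less by (intro that[of k]) auto
qed

lemma gauss_norm_nonneg:
  assumes "decays g" "r \<ge> 0" shows "gauss_norm v g r \<ge> 0"
  using gauss_norm_max[OF assms] assms(2) nonneg by (metis mult_nonneg_nonneg zero_le_power)

lemma coeff_le_gauss_norm:
  assumes "decays g" "r \<ge> 0" shows "v (fps_nth g j) * r ^ j \<le> gauss_norm v g r"
  using gauss_norm_max[OF assms] by blast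

lemma gauss_norm_leI:
  assumes "decays g" "r \<ge> 0" "\<And>j. v (fps_nth g j) * r ^ j \<le> B" shows "gauss_norm v g r \<le> B"
  using gauss_norm_max[OF assms(1,2)] assms(3) by metis

lemma gauss_norm_add:
  assumes "decays g" "decays h" "r \<ge> 0"
  shows "gauss_norm v (g + h) r \<le> max (gauss_norm v g r) (gauss_norm v h r)"
proof (rule gauss_norm_leI[OF decays_add[OF assms(1,2)] assms(3)])
  fix j
  have "v (fps_nth (g + h) j) * r ^ j \<le> max (v (fps_nth g j)) (v (fps_nth h j)) * r ^ j"
    using assms(3) by (intro mult_right_mono) (auto simp: ultrametric)
  also have "\<dots> \<le> max (gauss_norm v g r) (gauss_norm v h r)"
    using coeff_le_gauss_norm[OF assms(1,3), of j] coeff_le_gauss_norm[OF assms(2,3), of j]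
    by (auto simp: max_def)
  finally show "v (fps_nth (g + h) j) * r ^ j \<le> max (gauss_norm v g r) (gauss_norm v h r)" .
qed

text \<open>As in Gauss's lemma: if \<open>i\<close> and \<open>j\<close> are the least indices at which the two norms are attained, then
  in the coefficient of index \<open>i + j\<close> of the product the term \<open>g\<^sub>i h\<^sub>j\<close> strictly dominates all others.\<close>

lemma gauss_norm_mult:
  assumes g: "decays g" and h: "decays h" and r: "r \<ge> 0"
  shows "gauss_norm v (g * h) r = gauss_norm v g r * gauss_norm v h r"
proof (rule antisym)
  let ?x = "\<lambda>i. v (fps_nth g i) * r ^ i" and ?y = "\<lambda>i. v (fps_nth h i) * r ^ i"
  let ?G = "gauss_norm v g r" and ?H = "gauss_norm v h r"
  note nn = gauss_norm_nonneg[OF g r] gauss_norm_nonneg[OF h r]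
  have xy: "?x i * ?y j \<le> ?G * ?H" for i j
    using coeff_le_gauss_norm[OF g r] coeff_le_gauss_norm[OF h r] nn r
    by (intro mult_mono) (auto simp: nonneg)
  show "gauss_norm v (g * h) r \<le> ?G * ?H"
    using xy nn r by (intro gauss_norm_leI[OF decays_mult[OF g h] r] coeff_mult_bound) auto
  show "?G * ?H \<le> gauss_norm v (g * h) r"
  proof (cases "?G = 0 \<or> ?H = 0")
    case True
    then show ?thesis using gauss_norm_nonneg[OF decays_mult[OF g h] r] by auto
  next
    case False
    with nn have pos: "?G > 0" "?H > 0" by auto
    obtain i where i: "?G = ?x i" "\<And>j. j < i \<Longrightarrow> ?x j < ?G" using gauss_norm_max[OF g r] by metis
    obtain j where j: "?H = ?y j" "\<And>k. k < j \<Longrightarrow> ?y k < ?H" using gauss_norm_max[OF h r] by metis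
    let ?n = "i + j"
    have rn: "r ^ ?n > 0" using pos i(1) j(1) r by (auto simp: power_add zero_less_mult_iff)
    have lt: "v (fps_nth g k * fps_nth h (?n - k)) < ?G * ?H / r ^ ?n"
      if k: "k \<in> {0..?n} - {i}" for k
    proof -
      have n: "k + (?n - k) = ?n" using k by simp
      then have rr: "r ^ ?n = r ^ k * r ^ (?n - k)" by (metis power_add)
      have "?x k * ?y (?n - k) < ?G * ?H"
      proof (cases "k < i")
        case True
        have "?x k * ?y (?n - k) \<le> ?x k * ?H"
          using coeff_le_gauss_norm[OF h r] r by (intro mult_left_mono) (auto simp: nonneg)
        also have "\<dots> < ?G * ?H" using i(2)[OF True] pos(2) by (rule mult_strict_right_mono)
        finally show ?thesis .
      next
        case False
        then have "?n - k < j" using k by auto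
        have "?x k * ?y (?n - k) \<le> ?G * ?y (?n - k)"
          using coeff_le_gauss_norm[OF g r] r by (intro mult_right_mono) (auto simp: nonneg)
        also have "\<dots> < ?G * ?H" using j(2)[OF \<open>?n - k < j\<close>] pos(1) by (rule mult_strict_left_mono)
        finally show ?thesis .
      qed
      with rn show ?thesis by (simp add: mult field_simps rr)
    qed
    have main: "v (fps_nth g i * fps_nth h j) = ?G * ?H / r ^ ?n"
    proof -
      have "?G * ?H = v (fps_nth g i * fps_nth h j) * r ^ ?n"
        by (simp only: i(1) j(1) mult power_add mult_ac)
      with rn show ?thesis by (metis nonzero_mult_div_cancel_right less_irrefl)
    qed
    have "fps_nth (g * h) ?n = fps_nth g i * fps_nth h j +
        (\<Sum>k\<in>{0..?n} - {i}. fps_nth g k * fps_nth h (?n - k))"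
      unfolding fps_mult_nth by (subst sum.remove[of _ i]) auto
    moreover have "v (\<Sum>k\<in>{0..?n} - {i}. fps_nth g k * fps_nth h (?n - k)) < ?G * ?H / r ^ ?n"
      using lt pos rn by (intro v_sum_less) auto
    ultimately have "v (fps_nth (g * h) ?n) = ?G * ?H / r ^ ?n"
      using main v_add_eq_left by presburger
    then have "?G * ?H = v (fps_nth (g * h) ?n) * r ^ ?n"
      using rn by (metis nonzero_eq_divide_eq less_irrefl)
    also have "\<dots> \<le> gauss_norm v (g * h) r" by (rule coeff_le_gauss_norm[OF decays_mult[OF g h] r])
    finally show ?thesis .
  qed
qed

lemma gauss_norm_const:
  assumes "r \<ge> 0" shows "gauss_norm v (fps_const c) r = v c"
proof -
  obtain i where i: "gauss_norm v (fps_const c) r = v (fps_nth (fps_const c) i) * r ^ i"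
    using gauss_norm_max[OF decays_const assms] by metis
  have "v c \<le> gauss_norm v (fps_const c) r"
    using coeff_le_gauss_norm[OF decays_const assms, of c 0] by simp
  with i show ?thesis using nonneg[of c] by (cases "i = 0") auto
qed

lemma gauss_norm_0 [simp]: "r \<ge> 0 \<Longrightarrow> gauss_norm v 0 r = 0"
  and gauss_norm_1 [simp]: "r \<ge> 0 \<Longrightarrow> gauss_norm v 1 r = 1"
  using gauss_norm_const[of r 0] gauss_norm_const[of r 1] by simp_all

lemma gauss_norm_power: "decays g \<Longrightarrow> r \<ge> 0 \<Longrightarrow> gauss_norm v (g ^ n) r = gauss_norm v g r ^ n"
  by (induction n) (simp_all add: gauss_norm_mult decays_power)

text \<open>For \<open>r \<ge> 1\<close> the absolute value of a single nonzero coefficient is a lower bound. This is what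
  makes the error terms independent of \<open>r\<close>.\<close>

lemma gauss_norm_lower_bound:
  assumes "decays g" "g \<noteq> 0"
  obtains c where "c > 0" "\<And>r. r \<ge> 1 \<Longrightarrow> gauss_norm v g r \<ge> c"
proof -
  obtain k where k: "fps_nth g k \<noteq> 0" using assms(2) by (auto simp: fps_eq_iff)
  have "v (fps_nth g k) \<le> gauss_norm v g r" if "r \<ge> 1" for r
  proof -
    have "v (fps_nth g k) * 1 \<le> v (fps_nth g k) * r ^ k"
      using that by (intro mult_left_mono) (auto simp: nonneg)
    also have "\<dots> \<le> gauss_norm v g r" using that by (intro coeff_le_gauss_norm assms(1)) auto
    finally show ?thesis by simp
  qed
  moreover have "v (fps_nth g k) > 0" using k nonneg eq_0_iff by (simp add: order_less_le)
  ultimately show ?thesis using that by blast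
qed

lemma fps_sums_at_const: "fps_sums_at v (fps_const c) z c"
  unfolding fps_sums_at_iff
proof (rule tendsto_eventually)
  show "\<forall>\<^sub>F k in sequentially. v ((\<Sum>i<k. fps_nth (fps_const c) i * z ^ i) - c) = 0"
    using eventually_gt_at_top[of 0]
  proof eventually_elim
    case (elim k)
    have "(\<Sum>i<k. fps_nth (fps_const c) i * z ^ i) = (\<Sum>i\<in>{0}. fps_nth (fps_const c) i * z ^ i)"
      using elim by (intro sum.mono_neutral_right) auto
    then show ?case by simp
  qed
qed

lemma fps_sums_at_add:
  assumes "fps_sums_at v g z s" "fps_sums_at v h z t"
  shows "fps_sums_at v (g + h) z (s + t)"
  unfolding fps_sums_at_iff
proof (rule Lim_null_comparison[OF always_eventually])
  let ?S = "\<lambda>g k. \<Sum>i<k. fps_nth g i * z ^ i"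
  show "(\<lambda>k. v (?S g k - s) + v (?S h k - t)) \<longlonglongrightarrow> 0"
    using tendsto_add[OF assms[unfolded fps_sums_at_iff]] by simp
  show "\<forall>k. norm (v (?S (g + h) k - (s + t))) \<le> v (?S g k - s) + v (?S h k - t)"
  proof
    fix k
    have eq: "?S (g + h) k - (s + t) = (?S g k - s) + (?S h k - t)"
      by (simp add: distrib_right sum.distrib)
    show "norm (v (?S (g + h) k - (s + t))) \<le> v (?S g k - s) + v (?S h k - t)"
      unfolding eq real_norm_def abs_of_nonneg[OF nonneg] by (rule v_add_le)
  qed
qed

text \<open>The product of two partial sums differs from the partial sum of the product by terms of total
  degree at least \<open>k\<close>, and by the ultrametric inequality it suffices that each of them is small.\<close>

lemma fps_sums_at_mult:
  assumes g: "fps_sums_at v g z s" and h: "fps_sums_at v h z t"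
  shows "fps_sums_at v (g * h) z (s * t)"
proof -
  define x y where "x = (\<lambda>i. fps_nth g i * z ^ i)" and "y = (\<lambda>i. fps_nth h i * z ^ i)"
  define S T where "S = (\<lambda>k. \<Sum>i<k. x i)" and "T = (\<lambda>k. \<Sum>i<k. y i)"
  define U where "U = (\<lambda>k. \<Sum>i<k. fps_nth (g * h) i * z ^ i)"
  have S: "(\<lambda>k. v (S k - s)) \<longlonglongrightarrow> 0" and T: "(\<lambda>k. v (T k - t)) \<longlonglongrightarrow> 0"
    using g h by (simp_all add: fps_sums_at_iff S_def T_def x_def y_def)
  have xy: "(\<lambda>k. v (x k)) \<longlonglongrightarrow> 0" "(\<lambda>k. v (y k)) \<longlonglongrightarrow> 0"
    using fps_sums_at_terms_null[OF g] fps_sums_at_terms_null[OF h]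
    by (simp_all add: x_def y_def mult v_power)
  have U: "U k = (\<Sum>(i, j)\<in>{(i, j). i + j < k}. x i * y j)" for k
  proof -
    have "fps_nth (g * h) n * z ^ n = (\<Sum>i\<le>n. x i * y (n - i))" for n
      unfolding fps_mult_nth sum_distrib_right atLeast0AtMost x_def y_def
      by (intro sum.cong) (auto simp: mult_ac simp flip: power_add)
    then show ?thesis unfolding U_def by (simp add: sum.triangle_reindex)
  qed
  have ST: "S k * T k = (\<Sum>(i, j)\<in>{..<k} \<times> {..<k}. x i * y j)" for k
    unfolding S_def T_def sum_product sum.cartesian_product ..
  have diff: "(\<lambda>k. v (U k - S k * T k)) \<longlonglongrightarrow> 0"
  proof (rule LIMSEQ_I)
    fix \<epsilon> :: real assume "\<epsilon> > 0"
    then obtain n where n: "\<And>i j. i + j \<ge> n \<Longrightarrow> v (x i) * v (y j) < \<epsilon>"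
      using null_product_double_index[OF xy _ _ \<open>\<epsilon> > 0\<close>] nonneg by metis
    have "v (U k - S k * T k) < \<epsilon>" if "k \<ge> n" for k
    proof -
      have "S k * T k = U k + (\<Sum>(i, j)\<in>{..<k} \<times> {..<k} - {(i, j). i + j < k}. x i * y j)"
        unfolding ST U by (subst sum.subset_diff[of "{(i, j). i + j < k}"]) (auto simp: add.commute)
      then have "v (U k - S k * T k) = v (\<Sum>(i, j)\<in>{..<k} \<times> {..<k} - {(i, j). i + j < k}. x i * y j)"
        by simp
      also have "\<dots> < \<epsilon>"
        using n that \<open>\<epsilon> > 0\<close> by (intro v_sum_less) (auto simp: mult)
      finally show ?thesis .
    qed
    then show "\<exists>n. \<forall>k\<ge>n. norm (v (U k - S k * T k) - 0) < \<epsilon>" by (auto simp: nonneg)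
  qed
  let ?B = "\<lambda>k. v (U k - S k * T k) + (v (S k - s) * (v (T k - t) + v t) + v s * v (T k - t))"
  have "?B \<longlonglongrightarrow> 0 + (0 * (0 + v t) + v s * 0)"
    by (intro tendsto_intros diff S T)
  then have B: "?B \<longlonglongrightarrow> 0" by simp
  have "norm (v (U k - s * t)) \<le> ?B k" for k
  proof -
    have eq: "U k - s * t = (U k - S k * T k) + ((S k - s) * T k + s * (T k - t))"
      by (simp add: algebra_simps)
    have "v (U k - s * t) \<le> v (U k - S k * T k) + (v (S k - s) * v (T k) + v s * v (T k - t))"
      unfolding eq mult[symmetric]
      by (rule order_trans[OF v_add_le add_left_mono[OF v_add_le]])
    moreover have "v (T k) \<le> v (T k - t) + v t" using v_add_le[of "T k - t" t] by simp
    then have "v (S k - s) * v (T k) \<le> v (S k - s) * (v (T k - t) + v t)"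
      by (intro mult_left_mono) (auto simp: nonneg)
    ultimately show ?thesis by (simp add: nonneg)
  qed
  then have "(\<lambda>k. v (U k - s * t)) \<longlonglongrightarrow> 0"
    by (intro Lim_null_comparison[OF always_eventually B]) auto
  then show ?thesis by (simp add: fps_sums_at_iff U_def)
qed

lemma fps_sums_at_mpoly_comp:
  assumes "p \<in> mpolys k" "\<And>i. i < k \<Longrightarrow> fps_sums_at v (f i) z (x i)"
  shows "fps_sums_at v (mpoly_comp_fps f p) z (mpoly_eval x p)"
  using assms(1)
proof (induction p rule: mpolys_induct)
qed (use assms(2) in \<open>auto simp: ring_morphism.mpoly_subst_mconst[OF ring_morphism_fps_const]
    ring_morphism.mpoly_subst_mvar[OF ring_morphism_fps_const]
    ring_morphism.mpoly_subst_add[OF ring_morphism_fps_const]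
    ring_morphism.mpoly_subst_mult[OF ring_morphism_fps_const] eval.add eval.mult
    intro: fps_sums_at_add fps_sums_at_mult fps_sums_at_const\<close>)

end

text \<open>The first nonzero term strictly dominates all others at points close to \<open>0\<close>, so the sum there is not
  \<open>0\<close>. For the trivial absolute value there are no such points other than \<open>0\<close>, but then the series is a
  polynomial with infinitely many roots.\<close>

lemma (in nonarch_absval) fps_eq_0_if_sums_0_everywhere:
  assumes inf: "infinite (UNIV :: 'a set)" and sums: "\<And>z. fps_sums_at v g z 0"
  shows "g = 0"
proof (rule ccontr)
  assume "g \<noteq> 0"
  define m where "m = subdegree g"
  have m: "fps_nth g m \<noteq> 0" "\<And>i. i < m \<Longrightarrow> fps_nth g i = 0"
    using nth_subdegree_nonzero[OF \<open>g \<noteq> 0\<close>] nth_less_subdegree_zero unfolding m_def by blast+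
  have null: "(\<lambda>k. v (fps_nth g k)) \<longlonglongrightarrow> 0" using fps_sums_at_terms_null[OF sums, of 1] by simp
  consider "\<forall>x. x \<noteq> 0 \<longrightarrow> v x = 1" | x where "v x > 1" using trivial_or_large by blast
  then show False
  proof cases
    case 1
    then obtain n where n: "\<And>i. i \<ge> n \<Longrightarrow> fps_nth g i = 0"
      using order_tendstoD(2)[OF null, of 1] unfolding eventually_sequentially by force
    let ?p = "\<Sum>i<n. monom (fps_nth g i) i"
    have "poly ?p z = 0" for z
    proof -
      have "(\<Sum>i<k. fps_nth g i * z ^ i) = poly ?p z" if "k \<ge> n" for k
        unfolding poly_sum poly_monom using that n
        by (intro sum.mono_neutral_right) auto
      then have "\<forall>\<^sub>F k in sequentially. v ((\<Sum>i<k. fps_nth g i * z ^ i) - 0) = v (poly ?p z)"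
        unfolding eventually_sequentially by (intro exI[of _ n]) auto
      then have "(\<lambda>k. v ((\<Sum>i<k. fps_nth g i * z ^ i) - 0)) \<longlonglongrightarrow> v (poly ?p z)"
        by (rule tendsto_eventually)
      then have "v (poly ?p z) = 0"
        using sums[of z] LIMSEQ_unique unfolding fps_sums_at_iff by blast
      then show ?thesis by (simp add: eq_0_iff)
    qed
    then have "?p = 0" using poly_roots_finite[of ?p] inf by auto
    then have "coeff ?p m = 0" by simp
    moreover have "m < n" using m(1) n by (meson not_less)
    ultimately show False using m(1) by (simp add: coeff_sum)
  next
    case 2
    obtain i0 where B: "\<And>j. v (fps_nth g j) \<le> v (fps_nth g i0)"
      using null_sequence_attains_max[OF null] nonneg by metis
    let ?a = "v (fps_nth g m)" and ?B = "v (fps_nth g i0)"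
    have a: "?a > 0" using m(1) nonneg eq_0_iff by (simp add: order_less_le)
    obtain l where l: "?B / ?a < v x ^ l" using real_arch_pow[OF 2] by blast
    define z where "z = inverse (x ^ l)"
    have x: "x \<noteq> 0" using 2 by auto
    have vz: "v z * v x ^ l = 1"
      using mult[of z "x ^ l"] x by (simp add: z_def v_power)
    have z: "v z > 0" "v z \<le> 1" "?B * v z < ?a"
    proof -
      have xl: "v x ^ l \<ge> 1" using 2 by simp
      show "v z > 0" using vz nonneg[of z] by (cases "v z = 0") auto
      then show "v z \<le> 1" using vz xl mult_left_mono[OF xl, of "v z"] by simp
      have "?B < ?a * v x ^ l" using l a by (simp add: field_simps)
      then have "?B * v z < ?a * v x ^ l * v z" using \<open>v z > 0\<close> by (rule mult_strict_right_mono)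
      also have "?a * v x ^ l * v z = ?a * (v z * v x ^ l)" by (simp only: mult_ac)
      finally show "?B * v z < ?a" unfolding vz by simp
    qed
    have const: "v (\<Sum>i<k. fps_nth g i * z ^ i) = ?a * v z ^ m" if "k > m" for k
    proof -
      have "(\<Sum>i<k. fps_nth g i * z ^ i) = fps_nth g m * z ^ m + (\<Sum>i\<in>{..<k} - {m}. fps_nth g i * z ^ i)"
        using that by (subst sum.remove[of _ m]) auto
      moreover have "v (\<Sum>i\<in>{..<k} - {m}. fps_nth g i * z ^ i) < ?a * v z ^ m"
      proof (rule v_sum_less)
        fix i assume i: "i \<in> {..<k} - {m}"
        show "v (fps_nth g i * z ^ i) < ?a * v z ^ m"
        proof (cases "i < m")
          case False
          with i have "i = m + Suc (i - Suc m)" by auto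
          then obtain d where d: "i = m + Suc d" by blast
          have "v (fps_nth g i * z ^ i) = v (fps_nth g i) * v z * v z ^ d * v z ^ m"
            by (simp add: d mult v_power power_add)
          also have "\<dots> \<le> ?B * v z * 1 * v z ^ m"
            using B z by (intro mult_mono power_le_one) (auto simp: nonneg)
          also have "\<dots> < ?a * v z ^ m" using z by (intro mult_strict_right_mono) auto
          finally show ?thesis .
        qed (use m(2) a z(1) in simp)
      qed (use a z in simp)
      ultimately show ?thesis using v_add_eq_left by (simp add: mult v_power)
    qed
    have "\<forall>\<^sub>F k in sequentially. v ((\<Sum>i<k. fps_nth g i * z ^ i) - 0) = ?a * v z ^ m"
      using eventually_gt_at_top[of m] by eventually_elim (simp add: const)
    then have "(\<lambda>k. v ((\<Sum>i<k. fps_nth g i * z ^ i) - 0)) \<longlonglongrightarrow> ?a * v z ^ m"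
      by (rule tendsto_eventually)
    then have "?a * v z ^ m = 0"
      using sums[of z] LIMSEQ_unique unfolding fps_sums_at_iff by blast
    with a z(1) show False by simp
  qed
qed

section \<open>Multiplicative seminorms on polynomial rings\<close>

text \<open>Such seminorms are the points, in the sense of Berkovich, of the closed unit polydisc over \<open>K\<close>: a
  curve will define one for each radius. Being a zero of \<open>p\<close> becomes \<open>W p = 0\<close>, being close to a zero
  becomes that \<open>W p\<close> is small.\<close>

definition mult_seminorm :: "('a::field \<Rightarrow> real) \<Rightarrow> ('a mpoly \<Rightarrow> real) \<Rightarrow> bool" where
  "mult_seminorm v W \<longleftrightarrow> (\<forall>p. W p \<ge> 0) \<and> (\<forall>p q. W (p + q) \<le> W p + W q) \<and>
     (\<forall>p q. W (p * q) = W p * W q) \<and> (\<forall>c. W (mconst c) = v c) \<and> (\<forall>i. W (mvar i) \<le> 1)"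

text \<open>\<open>p\<close> is small at each point of \<open>\<W>\<close> at which all members of \<open>E\<close> are small, with a rate that does not
  depend on the point; for this only finitely many members of \<open>E\<close> may be involved.\<close>

definition dominated :: "('a::field mpoly \<Rightarrow> real) set \<Rightarrow> 'a mpoly set \<Rightarrow> 'a mpoly set" where
  "dominated \<W> E = {p. \<exists>F C. finite F \<and> F \<subseteq> E \<and> C \<ge> 0 \<and> (\<forall>W\<in>\<W>. W p \<le> C * (\<Sum>e\<in>F. W e))}"

lemma mpolys_exhaust: "\<exists>k. p \<in> mpolys k"
proof -
  have "finite (\<Union>m\<in>Poly_Mapping.keys p. Poly_Mapping.keys m)" by auto
  then obtain k where "(\<Union>m\<in>Poly_Mapping.keys p. Poly_Mapping.keys m) \<subseteq> {..<k}"
    using finite_nat_iff_bounded by blast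
  then show ?thesis by (auto simp: mpolys_def)
qed

lemma mult_seminorm_bounded:
  fixes p :: "'a::field mpoly"
  shows "\<exists>B\<ge>0. \<forall>W. mult_seminorm v W \<longrightarrow> W p \<le> B"
proof -
  obtain k where "p \<in> mpolys k" using mpolys_exhaust by blast
  then show ?thesis
  proof (induction p rule: mpolys_induct)
    case (const c)
    show ?case by (intro exI[of _ "max 0 (v c)"]) (auto simp: mult_seminorm_def)
  next
    case (var i)
    show ?case by (intro exI[of _ 1]) (auto simp: mult_seminorm_def)
  next
    case (add a b)
    then obtain A B where AB: "\<forall>W. mult_seminorm v W \<longrightarrow> W a \<le> A" "\<forall>W. mult_seminorm v W \<longrightarrow> W b \<le> B"
      "A \<ge> 0" "B \<ge> 0" by blast
    have "W (a + b) \<le> A + B" if "mult_seminorm v W" for W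
    proof -
      have "W (a + b) \<le> W a + W b" using that by (simp add: mult_seminorm_def)
      also have "\<dots> \<le> A + B" using AB that by (intro add_mono) auto
      finally show ?thesis .
    qed
    then show ?case using AB by (intro exI[of _ "A + B"]) auto
  next
    case (mult a b)
    then obtain A B where "\<forall>W. mult_seminorm v W \<longrightarrow> W a \<le> A" "\<forall>W. mult_seminorm v W \<longrightarrow> W b \<le> B"
      "A \<ge> 0" "B \<ge> 0" by blast
    then show ?case
      by (intro exI[of _ "A * B"]) (auto simp: mult_seminorm_def intro!: mult_mono)
  qed
qed

lemma dominated_base: "e \<in> E \<Longrightarrow> e \<in> dominated \<W> E"
  unfolding dominated_def by (intro CollectI exI[of _ "{e}"] exI[of _ "1::real"]) auto

lemma dominated_zero: "(\<And>W. W \<in> \<W> \<Longrightarrow> W p = 0) \<Longrightarrow> p \<in> dominated \<W> E"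
  unfolding dominated_def by (intro CollectI exI[of _ "{}"] exI[of _ "0::real"]) (simp add: order_eq_refl)

text \<open>Every polynomial is bounded on the unit polydisc, so domination survives multiplication. Uniform
  estimates thereby become statements on ideals, to which the Nullstellensatz applies.\<close>

lemma ring_ideal_dominated:
  assumes W: "\<And>W. W \<in> \<W> \<Longrightarrow> mult_seminorm v W" and "v 0 = 0"
  shows "ring_ideal (dominated \<W> E)"
  unfolding ring_ideal_def
proof (intro conjI ballI allI)
  have "W 0 = 0" if "W \<in> \<W>" for W
    using W[OF that] assms(2) by (metis mult_seminorm_def single_zero)
  then show "0 \<in> dominated \<W> E" by (rule dominated_zero)
next
  fix p q assume "p \<in> dominated \<W> E" "q \<in> dominated \<W> E"
  then obtain F C F' C' where F: "finite F" "F \<subseteq> E" "C \<ge> 0" "\<And>W. W \<in> \<W> \<Longrightarrow> W p \<le> C * (\<Sum>e\<in>F. W e)"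
    "finite F'" "F' \<subseteq> E" "C' \<ge> 0" "\<And>W. W \<in> \<W> \<Longrightarrow> W q \<le> C' * (\<Sum>e\<in>F'. W e)"
    unfolding dominated_def mem_Collect_eq by metis
  have "W (p + q) \<le> (C + C') * (\<Sum>e\<in>F \<union> F'. W e)" if "W \<in> \<W>" for W
  proof -
    have nn: "W e \<ge> 0" for e using W[OF that] by (simp add: mult_seminorm_def)
    have "W (p + q) \<le> W p + W q" using W[OF that] by (simp add: mult_seminorm_def)
    also have "\<dots> \<le> C * (\<Sum>e\<in>F. W e) + C' * (\<Sum>e\<in>F'. W e)" using F that by (intro add_mono)
    also have "\<dots> \<le> C * (\<Sum>e\<in>F \<union> F'. W e) + C' * (\<Sum>e\<in>F \<union> F'. W e)"
      using F nn by (intro add_mono mult_left_mono sum_mono2) auto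
    finally show ?thesis by (simp add: distrib_right)
  qed
  then show "p + q \<in> dominated \<W> E"
    unfolding dominated_def using F by (intro CollectI exI[of _ "F \<union> F'"] exI[of _ "C + C'"]) auto
next
  fix a p assume "p \<in> dominated \<W> E"
  then obtain F C where F: "finite F" "F \<subseteq> E" "C \<ge> 0" "\<And>W. W \<in> \<W> \<Longrightarrow> W p \<le> C * (\<Sum>e\<in>F. W e)"
    unfolding dominated_def mem_Collect_eq by metis
  obtain B where B: "B \<ge> 0" "\<And>W. mult_seminorm v W \<Longrightarrow> W a \<le> B" using mult_seminorm_bounded[of v a] by blast
  have "W (a * p) \<le> (B * C) * (\<Sum>e\<in>F. W e)" if "W \<in> \<W>" for W
  proof -
    have "W (a * p) = W a * W p" using W[OF that] by (simp add: mult_seminorm_def)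
    also have "\<dots> \<le> B * (C * (\<Sum>e\<in>F. W e))"
      using B W[OF that] F(4)[OF that] by (intro mult_mono) (auto simp: mult_seminorm_def)
    finally show ?thesis by (simp add: mult.assoc)
  qed
  then show "a * p \<in> dominated \<W> E"
    unfolding dominated_def using F B(1) by (intro CollectI exI[of _ F] exI[of _ "B * C"]) auto
qed

text \<open>This replaces a compactness argument: polynomials without common zero over \<open>K\<close> cannot become small
  simultaneously, not even along a family of points over extensions of \<open>K\<close>.\<close>

lemma bound_without_common_zero:
  fixes E :: "'a::alg_closed_field mpoly set"
  assumes W: "\<And>W. W \<in> \<W> \<Longrightarrow> mult_seminorm v W" and "v 0 = 0" "v 1 = 1"
    and no_zero: "\<And>a. \<exists>p\<in>dominated \<W> E \<inter> mpolys k. mpoly_eval a p \<noteq> 0"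
  obtains F C where "finite F" "F \<subseteq> E" "C \<ge> 0" "\<And>W. W \<in> \<W> \<Longrightarrow> 1 \<le> C * (\<Sum>e\<in>F. W e)"
proof -
  have "1 \<in> dominated \<W> E"
    using nullstellensatz[of "dominated \<W> E" k] ring_ideal_dominated[OF W assms(2)] no_zero by blast
  moreover have "W 1 = 1" if "W \<in> \<W>" for W
    using W[OF that] assms(3) by (metis mult_seminorm_def single_one)
  ultimately show ?thesis unfolding dominated_def using that by (smt (verit) mem_Collect_eq)
qed

section \<open>Reduced points\<close>

text \<open>Gaussian elimination for the system with matrix \<open>diag(t) - A\<close>. The elements of \<open>T\<close> stay in \<open>T\<close> when
  changed by elements of \<open>M\<close>, so all pivots lie in \<open>T\<close>, and rows are multiplied by pivots instead of
  being divided. With \<open>M\<close> a prime ideal and \<open>T\<close> its complement this is Nakayama's lemma for the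
  localization at \<open>M\<close>, in a form that exhibits the denominator \<open>g\<close>.\<close>

lemma eliminate_by_units:
  fixes D T M :: "'r::comm_ring_1 set" and n :: nat
  assumes D: "ring_ideal D"
    and T: "1 \<in> T" "\<And>s t. s \<in> T \<Longrightarrow> t \<in> T \<Longrightarrow> s * t \<in> T" "\<And>t x. t \<in> T \<Longrightarrow> x \<in> M \<Longrightarrow> t - x \<in> T"
    and M: "\<And>x y. x \<in> M \<Longrightarrow> y \<in> M \<Longrightarrow> x + y \<in> M" "\<And>x y. x \<in> M \<Longrightarrow> y \<in> M \<Longrightarrow> x * y \<in> M"
      "\<And>t x. t \<in> T \<Longrightarrow> x \<in> M \<Longrightarrow> t * x \<in> M"
    and A: "\<And>j k. j < n \<Longrightarrow> k < n \<Longrightarrow> A j k \<in> M" and t: "\<And>j. j < n \<Longrightarrow> t j \<in> T"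
    and b: "\<And>j. j < n \<Longrightarrow> t j * b j - (\<Sum>k<n. A j k * b k) \<in> D"
  shows "\<exists>g\<in>T. \<forall>j<n. g * b j \<in> D"
  using A t b
proof (induction n arbitrary: A t)
  case 0
  then show ?case using T(1) by blast
next
  case (Suc n)
  define s where "s = t n - A n n"
  have s: "s \<in> T" unfolding s_def using Suc.prems(1,2) T(3) by blast
  let ?last = "s * b n - (\<Sum>k<n. A n k * b k)"
  have last: "?last \<in> D" using Suc.prems(3)[of n] by (simp add: s_def algebra_simps)
  have "\<exists>g\<in>T. \<forall>j<n. g * b j \<in> D"
  proof (rule Suc.IH[of "\<lambda>j k. s * A j k + A j n * A n k" "\<lambda>j. s * t j"])
    fix j assume j: "j < n"
    show "s * t j \<in> T" using s Suc.prems(2) j T(2) by simp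
    show "s * A j k + A j n * A n k \<in> M" if "k < n" for k
      using s Suc.prems(1) j that M by simp
    have "(s * t j) * b j - (\<Sum>k<n. (s * A j k + A j n * A n k) * b k) =
      s * (t j * b j - (\<Sum>k<Suc n. A j k * b k)) + A j n * ?last"
      by (simp add: algebra_simps sum.distrib sum_distrib_left)
    also have "\<dots> \<in> D" using Suc.prems(3)[of j] j last by (intro ideal_add[OF D] ideal_mult[OF D]) auto
    finally show "(s * t j) * b j - (\<Sum>k<n. (s * A j k + A j n * A n k) * b k) \<in> D" .
  qed
  then obtain g where g: "g \<in> T" "\<And>j. j < n \<Longrightarrow> g * b j \<in> D" by blast
  have "g * s * b n = g * ?last + (\<Sum>k<n. A n k * (g * b k))"
    by (simp add: algebra_simps sum_distrib_left)
  also have "\<dots> \<in> D" by (intro ideal_add[OF D] ideal_mult[OF D] ideal_sum[OF D] g(2) last) auto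
  finally have "g * s * b n \<in> D" .
  moreover have "g * s * b j \<in> D" if "j < n" for j
    using ideal_mult[OF D g(2)[OF that], of s] by (simp add: mult_ac)
  ultimately show ?case using T(2)[OF g(1) s] by (intro bexI[of _ "g * s"]) (auto simp: less_Suc_eq)
qed

text \<open>Duality for subspaces of \<open>K\<^sup>k\<close>, coordinates from \<open>k\<close> on being ignored. Some element of \<open>U\<close> has last
  coordinate \<open>1\<close>, and with its help every annihilator of the elements with last coordinate \<open>0\<close> extends
  to an annihilator of \<open>U\<close>; this allows induction on \<open>k\<close>.\<close>

lemma subspace_without_annihilator:
  fixes U :: "(nat \<Rightarrow> 'a::field) set"
  assumes "\<And>u w. u \<in> U \<Longrightarrow> w \<in> U \<Longrightarrow> (\<lambda>i. u i + w i) \<in> U"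
    and "\<And>c u. u \<in> U \<Longrightarrow> (\<lambda>i. c * u i) \<in> U" and "(\<lambda>_. 0) \<in> U"
    and "\<And>w. (\<And>u. u \<in> U \<Longrightarrow> (\<Sum>j<k. u j * w j) = 0) \<Longrightarrow> (\<And>j. j < k \<Longrightarrow> w j = 0)"
    and "i < k"
  shows "\<exists>u\<in>U. \<forall>j<k. u j = (if j = i then 1 else 0)"
  using assms
proof (induction k arbitrary: U i)
  case 0
  then show ?case by simp
next
  case (Suc k)
  note add = Suc.prems(1) and scale = Suc.prems(2) and zero = Suc.prems(3) and ann = Suc.prems(4)
  have lincomb: "(\<lambda>i. u i - c * w i) \<in> U" if "u \<in> U" "w \<in> U" for u w c
    using add[OF that(1) scale[OF that(2), of "- c"]] by simp
  have "\<exists>u\<in>U. u k \<noteq> 0"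
  proof (rule ccontr)
    assume "\<not> ?thesis"
    then have "(\<Sum>j<Suc k. u j * (if j = k then 1 else 0)) = 0" if "u \<in> U" for u
      using that by simp
    from ann[OF this, of k] show False by simp
  qed
  then obtain u0 where "u0 \<in> U" "u0 k \<noteq> 0" by blast
  define p where "p = (\<lambda>i. inverse (u0 k) * u0 i)"
  have p: "p \<in> U" "p k = 1" using scale[OF \<open>u0 \<in> U\<close>] \<open>u0 k \<noteq> 0\<close> by (auto simp: p_def)
  let ?U = "{u \<in> U. u k = 0}"
  have IH: "\<exists>u\<in>?U. \<forall>j<k. u j = (if j = i then 1 else 0)" if "i < k" for i
  proof (rule Suc.IH[OF _ _ _ _ that])
    fix w j assume w: "\<And>u. u \<in> ?U \<Longrightarrow> (\<Sum>j<k. u j * w j) = 0" and j: "j < k"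
    define w' where "w' = w(k := - (\<Sum>j<k. p j * w j))"
    have "(\<Sum>j<Suc k. u j * w' j) = 0" if "u \<in> U" for u
    proof -
      have "(\<Sum>j<k. (u j - u k * p j) * w j) = 0"
        using w[of "\<lambda>j. u j - u k * p j"] lincomb[OF that p(1), of "u k"] p(2) by simp
      then show ?thesis
        by (simp add: w'_def left_diff_distrib sum_subtractf sum_distrib_left mult.assoc)
    qed
    from ann[OF this, of j] show "w j = 0" using j by (simp add: w'_def)
  qed (use add scale zero in auto)
  show ?case
  proof (cases "i < k")
    case True
    from IH[OF this] obtain u where "u \<in> U" "u k = 0" "\<forall>j<k. u j = (if j = i then 1 else 0)" by blast
    then show ?thesis using True by (intro bexI[of _ u]) (auto simp: less_Suc_eq)
  next
    case False
    then have "i = k" using Suc.prems(5) by simp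
    have "\<forall>i\<in>{..<k}. \<exists>u. u \<in> U \<and> u k = 0 \<and> (\<forall>j<k. u j = (if j = i then 1 else 0))"
      using IH by blast
    from bchoice[OF this] obtain e where
      e: "\<And>i. i < k \<Longrightarrow> e i \<in> U \<and> e i k = 0 \<and> (\<forall>j<k. e i j = (if j = i then 1 else 0))"
      by auto
    have red: "\<exists>u\<in>U. u k = 1 \<and> (\<forall>j<l. u j = 0)" if "l \<le> k" for l
      using that
    proof (induction l)
      case 0
      then show ?case using p by blast
    next
      case (Suc l)
      then obtain u where u: "u \<in> U" "u k = 1" "\<forall>j<l. u j = 0" by auto
      let ?u = "\<lambda>j. u j - u l * e l j"
      have el: "e l \<in> U" "e l k = 0" "\<And>j. j < k \<Longrightarrow> e l j = (if j = l then 1 else 0)"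
        using e[of l] Suc.prems by auto
      have "?u j = 0" if "j < Suc l" for j
        using that u(3) el(3)[of j] Suc.prems by (cases "j = l") simp_all
      moreover have "?u k = 1" using u(2) el(2) by simp
      moreover have "?u \<in> U" using lincomb[OF u(1) el(1)] .
      ultimately show ?case by (intro bexI[of _ ?u]) blast+
    qed
    from red[of k] obtain u where "u \<in> U" "u k = 1" "\<forall>j<k. u j = 0" by auto
    then show ?thesis using \<open>i = k\<close> by (intro bexI[of _ u]) (auto simp: less_Suc_eq)
  qed
qed

text \<open>If the gradients at the common zero \<open>a\<close> span \<open>K\<^sup>k\<close>, the equations \<open>G\<close> cut out a reduced isolated
  point there. By duality each \<open>x\<^sub>i - a\<^sub>i\<close> is the linear part of a combination of elements of \<open>G\<close>, so by
  Taylor expansion it equals an element of \<open>D\<close> plus a combination of the \<open>x\<^sub>j - a\<^sub>j\<close> with coefficients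
  vanishing at \<open>a\<close>. Solving this system for the \<open>x\<^sub>j - a\<^sub>j\<close> costs a single denominator \<open>g\<close>.\<close>

lemma reduced_point_multiplier:
  fixes D G :: "'a::field mpoly set"
  assumes D: "ring_ideal D" and G: "G \<subseteq> D \<inter> mpolys k"
    and a: "\<And>p. p \<in> G \<Longrightarrow> mpoly_eval a p = 0"
    and grad: "\<And>w. (\<And>p. p \<in> G \<Longrightarrow> (\<Sum>j<k. mpoly_eval a (mpoly_pderiv j p) * w j) = 0) \<Longrightarrow>
      (\<And>j. j < k \<Longrightarrow> w j = 0)"
  shows "\<exists>g\<in>mpolys k. mpoly_eval a g \<noteq> 0 \<and> (\<forall>j<k. g * (mvar j - mconst (a j)) \<in> D)"
proof -
  define b where "b = (\<lambda>j. mvar j - mconst (a j))"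
  define M where "M = {q \<in> mpolys k. mpoly_eval a q = 0}"
  \<comment> \<open>The linear forms that occur as linear parts at \<open>a\<close> of elements of \<open>D\<close>.\<close>
  define U where "U = {u. \<exists>A. (\<forall>j. A j \<in> M) \<and> (\<Sum>j<k. mconst (u j) * b j) - (\<Sum>j<k. A j * b j) \<in> D}"
  have M: "x + y \<in> M" "x * y \<in> M" "- x \<in> M" if "x \<in> M" "y \<in> M" for x y
    using that by (auto simp: M_def eval.add eval.mult eval.uminus)
  have M0: "0 \<in> M" by (simp add: M_def eval.zero)
  have unit: "\<exists>u\<in>U. \<forall>j<k. u j = (if j = i then 1 else 0)" if "i < k" for i
  proof (rule subspace_without_annihilator[OF _ _ _ _ that])
    fix u w assume "u \<in> U" "w \<in> U"
    then obtain A A' where A: "\<forall>j. A j \<in> M" "\<forall>j. A' j \<in> M"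
      "(\<Sum>j<k. mconst (u j) * b j) - (\<Sum>j<k. A j * b j) \<in> D"
      "(\<Sum>j<k. mconst (w j) * b j) - (\<Sum>j<k. A' j * b j) \<in> D" unfolding U_def by blast
    have "(\<Sum>j<k. mconst (u j + w j) * b j) - (\<Sum>j<k. (A j + A' j) * b j) =
      ((\<Sum>j<k. mconst (u j) * b j) - (\<Sum>j<k. A j * b j)) +
      ((\<Sum>j<k. mconst (w j) * b j) - (\<Sum>j<k. A' j * b j))"
      by (simp add: single_add distrib_right sum.distrib)
    also have "\<dots> \<in> D" by (intro ideal_add[OF D] A)
    finally show "(\<lambda>i. u i + w i) \<in> U"
      unfolding U_def using A(1,2) M(1) by (intro CollectI exI[of _ "\<lambda>j. A j + A' j"]) simp
  next
    fix c u assume "u \<in> U"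
    then obtain A where A: "\<forall>j. A j \<in> M" "(\<Sum>j<k. mconst (u j) * b j) - (\<Sum>j<k. A j * b j) \<in> D"
      unfolding U_def by blast
    have "(\<Sum>j<k. mconst (c * u j) * b j) - (\<Sum>j<k. (mconst c * A j) * b j) =
      mconst c * ((\<Sum>j<k. mconst (u j) * b j) - (\<Sum>j<k. A j * b j))"
      by (simp add: right_diff_distrib sum_distrib_left mult_single flip: mult.assoc)
    also have "\<dots> \<in> D" by (intro ideal_mult[OF D] A)
    finally show "(\<lambda>i. c * u i) \<in> U"
      unfolding U_def using A(1)
      by (intro CollectI exI[of _ "\<lambda>j. mconst c * A j"]) (auto simp: M_def eval.mult)
  next
    show "(\<lambda>_. 0) \<in> U" unfolding U_def using M0 ideal_0[OF D] by (intro CollectI exI[of _ "\<lambda>_. 0"]) simp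
  next
    fix w j assume w: "\<And>u. u \<in> U \<Longrightarrow> (\<Sum>j<k. u j * w j) = 0" and j: "j < k"
    show "w j = 0"
    proof (rule grad[OF _ j])
      fix p assume p: "p \<in> G"
      then obtain A where A: "\<forall>j<k. A j \<in> mpolys k \<and> mpoly_eval a (A j) = 0"
        "p = mconst (mpoly_eval a p) + (\<Sum>j<k. (mconst (mpoly_eval a (mpoly_pderiv j p)) + A j) * b j)"
        using taylor_first_order[of p k a] G unfolding b_def by blast
      let ?A = "\<lambda>j. if j < k then - A j else 0"
      have "(\<Sum>j<k. mconst (mpoly_eval a (mpoly_pderiv j p)) * b j) - (\<Sum>j<k. ?A j * b j) =
        (\<Sum>j<k. (mconst (mpoly_eval a (mpoly_pderiv j p)) + A j) * b j)"
        by (simp add: distrib_right sum.distrib sum_negf)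
      also have "\<dots> = p" using A(2) a[OF p] by simp
      also have "p \<in> D" using p G by blast
      finally have "(\<lambda>j. mpoly_eval a (mpoly_pderiv j p)) \<in> U"
        unfolding U_def using A(1)
        by (intro CollectI exI[of _ ?A] conjI) (auto simp: M_def eval.uminus eval.zero)
      from w[OF this] show "(\<Sum>j<k. mpoly_eval a (mpoly_pderiv j p) * w j) = 0" .
    qed
  qed
  have "\<forall>i. \<exists>A. i < k \<longrightarrow> (\<forall>j. A j \<in> M) \<and> b i - (\<Sum>j<k. A j * b j) \<in> D"
  proof
    fix i
    show "\<exists>A. i < k \<longrightarrow> (\<forall>j. A j \<in> M) \<and> b i - (\<Sum>j<k. A j * b j) \<in> D"
    proof (cases "i < k")
      case True
      then obtain u A where u: "\<forall>j<k. u j = (if j = i then 1 else 0)" "\<forall>j. A j \<in> M"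
        "(\<Sum>j<k. mconst (u j) * b j) - (\<Sum>j<k. A j * b j) \<in> D"
        using unit[OF True] unfolding U_def by blast
      have "(\<Sum>j<k. mconst (u j) * b j) = (\<Sum>j<k. if j = i then b j else 0)"
        using u(1) by (intro sum.cong) auto
      then show ?thesis using u(2,3) True by auto
    qed simp
  qed
  then obtain A where A: "\<And>i. i < k \<Longrightarrow> (\<forall>j. A i j \<in> M) \<and> b i - (\<Sum>j<k. A i j * b j) \<in> D"
    by metis
  have "\<exists>g\<in>{t \<in> mpolys k. mpoly_eval a t \<noteq> 0}. \<forall>j<k. g * b j \<in> D"
    by (rule eliminate_by_units[OF D, where M = M and A = A and t = "\<lambda>_. 1"])
      (use A M in \<open>auto simp: M_def eval.mult eval.diff eval.one eval.add\<close>)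
  then show ?thesis unfolding b_def by blast
qed

text \<open>Intended for intersections of lifted tangent spaces at a point, which contain the coordinate vector
  \<open>a\<close> of the point: their codimension is at most \<open>N\<close>, and if it is \<open>N\<close>, only the line through \<open>a\<close>
  remains.\<close>

lemma lift_codim_with_nonzero_vector:
  fixes W :: "(nat \<Rightarrow> 'a::field) set"
  assumes supp: "\<And>w i. w \<in> W \<Longrightarrow> i > N \<Longrightarrow> w i = 0" and a: "a \<in> W" "a i0 \<noteq> 0"
  shows "lift_codim N W \<le> N"
    and "lift_codim N W = N \<Longrightarrow> w \<in> W \<Longrightarrow> \<exists>c. \<forall>i. w i = c * a i"
proof -
  interpret vs: vector_space "fun_scale :: 'a \<Rightarrow> (nat \<Rightarrow> 'a) \<Rightarrow> nat \<Rightarrow> 'a" by (rule vector_space_fun_scale)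
  define T :: "(nat \<Rightarrow> 'a) set" where "T = (\<lambda>i j. if j = i then 1 else 0) ` {..N}"
  have T: "finite T" "card T \<le> N + 1"
    unfolding T_def using card_image_le[of "{..N}"] by auto
  have sum_apply: "(\<Sum>i\<in>A. f i) j = (\<Sum>i\<in>A. f i j)" for A and f :: "nat \<Rightarrow> nat \<Rightarrow> 'a" and j
    by (induction A rule: infinite_finite_induct) (simp_all add: zero_fun_def plus_fun_def)
  have WT: "W \<subseteq> vs.span T"
  proof
    fix w assume w: "w \<in> W"
    have "w = (\<Sum>i\<le>N. fun_scale (w i) (\<lambda>j. if j = i then 1 else 0))"
    proof
      fix j
      have "(\<Sum>i\<le>N. fun_scale (w i) (\<lambda>j. if j = i then 1 else 0)) j =
        (\<Sum>i\<le>N. w i * (if j = i then 1 else 0))"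
        by (rule sum_apply)
      also have "\<dots> = (\<Sum>i\<le>N. if j = i then w i else 0)" by (intro sum.cong) auto
      finally have "(\<Sum>i\<le>N. fun_scale (w i) (\<lambda>j. if j = i then 1 else 0)) j =
        (\<Sum>i\<le>N. if j = i then w i else 0)" .
      then show "w j = (\<Sum>i\<le>N. fun_scale (w i) (\<lambda>j. if j = i then 1 else 0)) j"
        using supp[OF w, of j] by (cases "j \<le> N") auto
    qed
    moreover have "(\<Sum>i\<le>N. fun_scale (w i) (\<lambda>j. if j = i then 1 else 0)) \<in> vs.span T"
      by (intro vs.span_sum vs.span_scale vs.span_base) (auto simp: T_def)
    ultimately show "w \<in> vs.span T" by simp
  qed
  obtain B where B: "B \<subseteq> W" "vs.independent B" "W \<subseteq> vs.span B" "card B = vs.dim W"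
    using vs.basis_exists by blast
  have fin: "finite B" "card B \<le> N + 1"
    using vs.independent_span_bound[OF T(1) B(2) subset_trans[OF B(1) WT]] T(2) by auto
  have "B \<noteq> {}"
  proof
    assume "B = {}"
    then have "a = 0" using B(3) a(1) by auto
    then show False using a(2) by simp
  qed
  then have "card B \<ge> 1" using fin by (simp add: Suc_le_eq card_gt_0_iff)
  then show "lift_codim N W \<le> N" unfolding lift_codim_def using B(4) by simp
  assume "lift_codim N W = N" and w: "w \<in> W"
  then have "card B = 1" unfolding lift_codim_def using B(4) fin \<open>card B \<ge> 1\<close> by simp
  then obtain \<beta> where "B = {\<beta>}" using card_1_singletonE by blast
  then have "w \<in> range (\<lambda>c. fun_scale c \<beta>)" "a \<in> range (\<lambda>c. fun_scale c \<beta>)"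
    using B(3) w a(1) unfolding \<open>B = {\<beta>}\<close> vs.span_singleton by blast+
  then obtain c d where "w = fun_scale c \<beta>" "a = fun_scale d \<beta>" by blast
  moreover have "d \<noteq> 0" using a(2) calculation(2) by auto
  ultimately show "\<exists>c. \<forall>i. w i = c * a i" by (intro exI[of _ "c / d"]) simp
qed

section \<open>Transverse intersections\<close>

lemma proj_pointE:
  assumes "x \<in> proj_point N a"
  obtains c where "c \<noteq> 0" "\<And>i. i \<le> N \<Longrightarrow> x i = c * a i"
  using assms by (auto simp: proj_point_def)

lemma mpoly_eval_proj_point:
  fixes p :: "'a::field mpoly"
  assumes p: "p \<in> forms N d" and x: "\<And>i. i \<le> N \<Longrightarrow> x i = c * a i"
  shows "mpoly_eval x p = c ^ d * mpoly_eval a p"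
proof -
  have "mpoly_eval x p = mpoly_eval (\<lambda>i. c * a i) p"
    using forms_subset_mpolys p x by (intro mpoly_subst_cong_vars[of p "Suc N"]) auto
  then show ?thesis using mpoly_subst_scale[OF p] by simp
qed

lemma in_proj_zerosI:
  assumes "i0 \<le> N" "a i0 \<noteq> 0" "E \<subseteq> (\<Union>d. forms N d)" "\<And>p. p \<in> E \<Longrightarrow> mpoly_eval a p = 0"
  shows "proj_point N a \<in> proj_zeros N E"
proof -
  have "mpoly_eval x p = 0" if x: "x \<in> proj_point N a" and p: "p \<in> E" for x p
  proof -
    obtain c where c: "\<And>i. i \<le> N \<Longrightarrow> x i = c * a i" using proj_pointE[OF x] by metis
    obtain d where "p \<in> forms N d" using p assms(3) by blast
    then show ?thesis using mpoly_eval_proj_point[of p N d x c a] c assms(4)[OF p] by simp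
  qed
  then show ?thesis using assms(1,2) by (auto simp: proj_zeros_def proj_space_def)
qed

lemma in_tangent_liftI:
  fixes a :: "nat \<Rightarrow> 'a::field"
  assumes E: "E \<subseteq> (\<Union>d. forms N d)" and supp: "\<And>i. i > N \<Longrightarrow> w i = 0"
    and w: "\<And>p. p \<in> E \<Longrightarrow> (\<Sum>i\<le>N. mpoly_eval a (mpoly_pderiv i p) * w i) = 0"
  shows "w \<in> tangent_lift N E (proj_point N a)"
proof -
  have "(\<Sum>i\<le>N. mpoly_eval x (mpoly_pderiv i p) * w i) = 0"
    if x: "x \<in> proj_point N a" and p: "p \<in> E" for x p
  proof -
    obtain c where c: "\<And>i. i \<le> N \<Longrightarrow> x i = c * a i" using proj_pointE[OF x] by metis
    obtain d where "p \<in> forms N d" using p E by blast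
    then have "mpoly_eval x (mpoly_pderiv i p) = c ^ (d - 1) * mpoly_eval a (mpoly_pderiv i p)" for i
      using mpoly_eval_proj_point[OF forms_pderiv, of p N d x c a] c by blast
    then have "(\<Sum>i\<le>N. mpoly_eval x (mpoly_pderiv i p) * w i) =
        c ^ (d - 1) * (\<Sum>i\<le>N. mpoly_eval a (mpoly_pderiv i p) * w i)"
      by (simp add: sum_distrib_left mult.assoc)
    then show ?thesis using w[OF p] by simp
  qed
  then show ?thesis using supp by (auto simp: tangent_lift_def)
qed

text \<open>By Euler's formula the lifted tangent spaces at \<open>a\<close> of \<open>X\<close> and of the \<open>D\<^sub>j\<close> all contain the vector \<open>a\<close>,
  so their intersection has codimension at most \<open>N\<close>, whereas transversality prescribes
  \<open>(N - n) + card J\<close>. Therefore more than \<open>n\<close> of the hypersurfaces do not meet on \<open>X\<close>, and where \<open>n\<close> of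
  them meet, their intersection with \<open>X\<close> has no tangent direction: the point is reduced and isolated.\<close>

lemma transverse_intersection:
  fixes X :: "'a::field proj_pt set"
  assumes trans: "all_transverse N n X q Q"
    and Q: "\<And>i. i \<in> {1..q} \<Longrightarrow> Q i \<in> forms N (deg i)"
    and J: "J \<subseteq> {1..q}" "J \<noteq> {}"
    and a: "i0 \<le> N" "a i0 \<noteq> 0" "\<And>p. p \<in> vanishing_forms N X \<Longrightarrow> mpoly_eval a p = 0"
      "\<And>j. j \<in> J \<Longrightarrow> mpoly_eval a (Q j) = 0"
  shows "card J \<le> n"
    and "card J = n \<Longrightarrow> \<lbrakk>\<And>p. p \<in> vanishing_forms N X \<union> Q ` J \<Longrightarrow>
        (\<Sum>i\<le>N. mpoly_eval a (mpoly_pderiv i p) * w i) = 0\<rbrakk> \<Longrightarrow>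
      \<exists>c. \<forall>i\<le>N. w i = c * a i"
proof -
  define E where "E = case_option (vanishing_forms N X) (\<lambda>i. {Q i})"
  define c :: "nat option \<Rightarrow> nat" where "c = case_option (N - n) (\<lambda>_. 1)"
  define J' where "J' = insert None (Some ` J)"
  define P where "P = proj_point N a"
  define T where "T = (\<Inter>j\<in>J'. tangent_lift N (E j) P)"
  have finJ: "finite J" using J(1) finite_subset by blast
  have E: "E j \<subseteq> (\<Union>d. forms N d)" if "j \<in> J'" for j
  proof (cases j)
    case None
    then show ?thesis by (auto simp: E_def vanishing_forms_def)
  next
    case (Some i)
    then have "Q i \<in> forms N (deg i)" using that Q J(1) by (auto simp: J'_def)
    then show ?thesis using Some by (auto simp: E_def)
  qed
  have aE: "mpoly_eval a p = 0" if "j \<in> J'" "p \<in> E j" for j p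
    using that a(3,4) by (auto simp: E_def J'_def)
  have "finite J'" using finJ by (simp add: J'_def)
  moreover have card: "card J' = Suc (card J)"
    using finJ by (simp add: J'_def card_image)
  then have "card J' \<ge> 2" using finJ J(2) by (simp add: Suc_le_eq card_gt_0_iff)
  moreover have "J' \<subseteq> insert None (Some ` {1..q})" using J(1) by (auto simp: J'_def)
  moreover have "P \<in> (\<Inter>j\<in>J'. proj_zeros N (E j))"
    using in_proj_zerosI[of i0 N a "E j" for j] a(1,2) E aE by (auto simp: P_def)
  ultimately have "lift_codim N T = (\<Sum>j\<in>J'. c j)"
    using trans unfolding all_transverse_def transverse_family_def T_def E_def c_def by blast
  also have "\<dots> = (N - n) + card J"
    using finJ by (simp add: J'_def c_def sum.reindex)
  finally have codim: "lift_codim N T = (N - n) + card J" .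
  define a' where "a' = (\<lambda>i. if i \<le> N then a i else 0)"
  have "a' \<in> T"
    unfolding T_def P_def
  proof (intro INT_I in_tangent_liftI)
    fix j p assume j: "j \<in> J'" and p: "p \<in> E j"
    obtain d where "p \<in> forms N d" using E[OF j] p by blast
    then have "(\<Sum>i\<le>N. mpoly_eval a (mpoly_pderiv i p) * a i) = 0"
      using euler[of p N d a] aE[OF j p] by simp
    then show "(\<Sum>i\<le>N. mpoly_eval a (mpoly_pderiv i p) * a' i) = 0"
      by (simp add: a'_def)
  qed (use E in \<open>auto simp: a'_def\<close>)
  moreover have "a' i0 \<noteq> 0" using a(1,2) by (simp add: a'_def)
  moreover have "w i = 0" if "w \<in> T" "i > N" for w i
    using that by (auto simp: T_def J'_def tangent_lift_def)
  ultimately have dims: "lift_codim N T \<le> N"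
    "\<And>w. lift_codim N T = N \<Longrightarrow> w \<in> T \<Longrightarrow> \<exists>c. \<forall>i. w i = c * a' i"
    using lift_codim_with_nonzero_vector[of T N a' i0] by blast+
  show "card J \<le> n" using dims(1) codim by linarith
  assume "card J = n" and w: "\<And>p. p \<in> vanishing_forms N X \<union> Q ` J \<Longrightarrow>
        (\<Sum>i\<le>N. mpoly_eval a (mpoly_pderiv i p) * w i) = 0"
  then have eq: "lift_codim N T = N" using dims(1) codim by linarith
  define w' where "w' = (\<lambda>i. if i \<le> N then w i else 0)"
  have "w' \<in> T"
    unfolding T_def P_def
  proof (intro INT_I in_tangent_liftI)
    fix j p assume "j \<in> J'" "p \<in> E j"
    then have "p \<in> vanishing_forms N X \<union> Q ` J" by (auto simp: E_def J'_def)
    from w[OF this] show "(\<Sum>i\<le>N. mpoly_eval a (mpoly_pderiv i p) * w' i) = 0"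
      by (simp add: w'_def)
  qed (use E in \<open>auto simp: w'_def\<close>)
  from dims(2)[OF eq this] obtain c where "\<forall>i. w' i = c * a' i" by blast
  then show "\<exists>c. \<forall>i\<le>N. w i = c * a i" by (metis w'_def a'_def)
qed

context nonarch_absval begin

section \<open>The seminorms defined by an entire curve\<close>

lemma gauss_norm_pos:
  assumes "decays h" "h \<noteq> 0" "r \<ge> 1" shows "gauss_norm v h r > 0"
  using gauss_norm_lower_bound[OF assms(1,2)] assms(3) by (metis less_le_trans)

text \<open>The extension of the Gauss norm to quotients of decaying series; since the norm is multiplicative,
  the choice of the representation does not affect the value.\<close>

definition frac_norm :: "real \<Rightarrow> 'a fps fract \<Rightarrow> real" where
  "frac_norm r z = (SOME t. \<exists>g h. decays g \<and> decays h \<and> h \<noteq> 0 \<and> z = Fract g h \<and>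
     t = gauss_norm v g r / gauss_norm v h r)"

definition decaying_fracs :: "'a fps fract set" where
  "decaying_fracs = {Fract g h | g h. decays g \<and> decays h \<and> h \<noteq> 0}"

lemma decaying_fracsI: "decays g \<Longrightarrow> decays h \<Longrightarrow> h \<noteq> 0 \<Longrightarrow> Fract g h \<in> decaying_fracs"
  by (auto simp: decaying_fracs_def)

lemma frac_norm_Fract:
  assumes "decays g" "decays h" "h \<noteq> 0" "r \<ge> 1"
  shows "frac_norm r (Fract g h) = gauss_norm v g r / gauss_norm v h r"
  unfolding frac_norm_def
proof (rule some_equality)
  show "\<exists>g' h'. decays g' \<and> decays h' \<and> h' \<noteq> 0 \<and> Fract g h = Fract g' h' \<and>
     gauss_norm v g r / gauss_norm v h r = gauss_norm v g' r / gauss_norm v h' r"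
    using assms by blast
next
  fix t assume "\<exists>g' h'. decays g' \<and> decays h' \<and> h' \<noteq> 0 \<and> Fract g h = Fract g' h' \<and>
     t = gauss_norm v g' r / gauss_norm v h' r"
  then obtain g' h' where *: "decays g'" "decays h'" "h' \<noteq> 0" "Fract g h = Fract g' h'"
     "t = gauss_norm v g' r / gauss_norm v h' r" by blast
  have "g * h' = g' * h" using * assms by (simp add: eq_fract)
  then have "gauss_norm v g r * gauss_norm v h' r = gauss_norm v g' r * gauss_norm v h r"
    using gauss_norm_mult[of g h' r] gauss_norm_mult[of g' h r] assms * by simp
  then show "t = gauss_norm v g r / gauss_norm v h r"
    using gauss_norm_pos[OF assms(2-4)] gauss_norm_pos[OF *(2,3) assms(4)] *(5)
    by (simp add: frac_eq_eq)
qed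

lemma decaying_fracs_mult_closed:
  assumes "x \<in> decaying_fracs" "y \<in> decaying_fracs" shows "x * y \<in> decaying_fracs"
proof -
  obtain g h g' h' where "decays g" "decays h" "h \<noteq> 0" "x = Fract g h"
    "decays g'" "decays h'" "h' \<noteq> 0" "y = Fract g' h'"
    using assms by (auto simp: decaying_fracs_def)
  then show ?thesis by (simp add: decaying_fracsI decays_mult)
qed

lemma frac_norm_mult:
  assumes "x \<in> decaying_fracs" "y \<in> decaying_fracs" "r \<ge> 1"
  shows "frac_norm r (x * y) = frac_norm r x * frac_norm r y"
proof -
  obtain g h g' h' where *: "decays g" "decays h" "h \<noteq> 0" "x = Fract g h"
    "decays g'" "decays h'" "h' \<noteq> 0" "y = Fract g' h'"
    using assms(1,2) by (auto simp: decaying_fracs_def)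
  then show ?thesis
    using assms(3) by (simp add: frac_norm_Fract gauss_norm_mult decays_mult)
qed

lemma frac_norm_add:
  assumes "x \<in> decaying_fracs" "y \<in> decaying_fracs" "r \<ge> 1"
  shows "frac_norm r (x + y) \<le> frac_norm r x + frac_norm r y" "x + y \<in> decaying_fracs"
proof -
  obtain g h g' h' where *: "decays g" "decays h" "h \<noteq> 0" "x = Fract g h"
    "decays g'" "decays h'" "h' \<noteq> 0" "y = Fract g' h'"
    using assms(1,2) by (auto simp: decaying_fracs_def)
  have dec: "decays (g * h')" "decays (g' * h)" "decays (h * h')"
    by (intro decays_mult *)+
  have xy: "x + y = Fract (g * h' + g' * h) (h * h')" using * by simp
  show "x + y \<in> decaying_fracs"
    unfolding xy using * dec by (intro decaying_fracsI decays_add) auto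
  note nn = gauss_norm_nonneg[OF dec(1), of r] gauss_norm_nonneg[OF dec(2), of r]
  have "frac_norm r (x + y) = gauss_norm v (g * h' + g' * h) r / gauss_norm v (h * h') r"
    unfolding xy using * dec assms(3) by (intro frac_norm_Fract decays_add) auto
  also have "\<dots> \<le> (gauss_norm v (g * h') r + gauss_norm v (g' * h) r) / gauss_norm v (h * h') r"
    using gauss_norm_add[OF dec(1,2), of r] nn gauss_norm_nonneg[OF dec(3), of r] assms(3)
    by (intro divide_right_mono) (auto simp: max_def split: if_splits)
  also have "\<dots> = frac_norm r x + frac_norm r y"
    using * assms(3) gauss_norm_pos[OF *(2,3) assms(3)] gauss_norm_pos[OF *(6,7) assms(3)]
    by (simp add: frac_norm_Fract gauss_norm_mult field_simps)
  finally show "frac_norm r (x + y) \<le> frac_norm r x + frac_norm r y" .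
qed

lemma frac_norm_nonneg: "x \<in> decaying_fracs \<Longrightarrow> r \<ge> 1 \<Longrightarrow> frac_norm r x \<ge> 0"
  by (auto simp: decaying_fracs_def frac_norm_Fract gauss_norm_nonneg)

end

abbreviation const_frac :: "'a::field \<Rightarrow> 'a fps fract" where
  "const_frac c \<equiv> Fract (fps_const c) 1"

lemma ring_morphism_Fract: "ring_morphism (\<lambda>g :: 'a::field fps. Fract g 1)"
  by unfold_locales (auto simp: One_fract_def)

lemma ring_morphism_const_frac: "ring_morphism (const_frac :: 'a::field \<Rightarrow> _)"
  by unfold_locales (auto simp: One_fract_def)

text \<open>An entire curve in homogeneous coordinates, together with the choice of the chart \<open>x\<^sub>i\<^sub>0 \<noteq> 0\<close>.\<close>

locale entire_curve = nonarch_absval v for v :: "'a::field \<Rightarrow> real" +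
  fixes N :: nat and f :: "nat \<Rightarrow> 'a fps" and i0 :: nat
  assumes decays_f: "\<And>i. i \<le> N \<Longrightarrow> decays (f i)" and i0: "i0 \<le> N" "f i0 \<noteq> 0"
begin

text \<open>The affine coordinates \<open>f\<^sub>i / f\<^sub>i\<^sub>0\<close> of the curve. Variables beyond \<open>N\<close> are sent to \<open>0\<close>, so that a
  seminorm is defined on the whole type of polynomials.\<close>

definition chart :: "nat \<Rightarrow> 'a fps fract" where
  "chart i = (if i \<le> N then Fract (f i) (f i0) else 0)"

abbreviation pullback :: "'a mpoly \<Rightarrow> 'a fps fract" where
  "pullback \<equiv> mpoly_subst const_frac chart"

definition seminorm_at :: "real \<Rightarrow> 'a mpoly \<Rightarrow> real" where
  "seminorm_at r p = frac_norm r (pullback p)"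

text \<open>The radii at which \<open>f\<^sub>i\<^sub>0\<close> is a largest component, that is, \<open>f\<close> lies in the closed unit polydisc of the
  chart. For \<open>r \<ge> 1\<close> every radius belongs to this set for at least one choice of \<open>i0\<close>.\<close>

definition radii :: "real set" where
  "radii = {r. r \<ge> 1 \<and> (\<forall>i\<le>N. gauss_norm v (f i) r \<le> gauss_norm v (f i0) r)}"

lemmas pullback_simps =
  ring_morphism.mpoly_subst_mconst[OF ring_morphism_const_frac]
  ring_morphism.mpoly_subst_mvar[OF ring_morphism_const_frac]
  ring_morphism.mpoly_subst_add[OF ring_morphism_const_frac]
  ring_morphism.mpoly_subst_mult[OF ring_morphism_const_frac]
  ring_morphism.diff[OF ring_morphism.ring_morphism_mpoly_subst[OF ring_morphism_const_frac]]

lemma chart_decaying: "chart i \<in> decaying_fracs"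
proof (cases "i \<le> N")
  case True
  then show ?thesis using decays_f i0 by (auto simp: chart_def intro!: decaying_fracsI)
next
  case False
  then show ?thesis using decaying_fracsI[of 0 1] by (simp add: chart_def Zero_fract_def)
qed

lemma pullback_decaying: "pullback p \<in> decaying_fracs"
proof -
  obtain k where "p \<in> mpolys k" using mpolys_exhaust by blast
  then show ?thesis
    by (induction p rule: mpolys_induct)
      (auto simp: pullback_simps intro: chart_decaying decaying_fracs_mult_closed
        frac_norm_add(2)[of _ _ 1] decaying_fracsI)
qed

lemma mult_seminorm_at:
  assumes r: "r \<in> radii" shows "mult_seminorm v (seminorm_at r)"
proof -
  have r1: "r \<ge> 1" using r by (simp add: radii_def)
  have "frac_norm r (chart i) \<le> 1" for i
  proof (cases "i \<le> N")
    case True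
    then show ?thesis
      using r r1 decays_f i0 gauss_norm_pos[OF decays_f[OF i0(1)] i0(2) r1]
      by (simp add: chart_def frac_norm_Fract radii_def)
  next
    case False
    then show ?thesis
      using frac_norm_Fract[of 0 1 r] r1 by (simp add: chart_def Zero_fract_def)
  qed
  then show ?thesis
    using r1 by (auto simp: mult_seminorm_def seminorm_at_def pullback_simps frac_norm_nonneg
      frac_norm_add frac_norm_mult pullback_decaying frac_norm_Fract gauss_norm_const)
qed

text \<open>Homogeneity clears the denominators of the affine coordinates. For \<open>r \<in> radii\<close> the right-hand side is
  \<open>exp (- m\<^sub>f(r, D))\<close>, where \<open>D\<close> is the hypersurface \<open>p = 0\<close>.\<close>

lemma seminorm_at_form:
  assumes p: "p \<in> forms N d" and r: "r \<ge> 1"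
  shows "seminorm_at r p = gauss_norm v (mpoly_comp_fps f p) r / gauss_norm v (f i0) r ^ d"
proof -
  have pm: "p \<in> mpolys (Suc N)" using p forms_subset_mpolys by blast
  have pow: "Fract (f i0) 1 ^ d = Fract (f i0 ^ d) 1"
    using ring_morphism.power[OF ring_morphism_Fract] by metis
  have "Fract (f i0 ^ d) 1 * pullback p = mpoly_subst const_frac (\<lambda>i. Fract (f i0) 1 * chart i) p"
    unfolding pow[symmetric] by (rule mpoly_subst_scale[OF p, symmetric])
  also have "\<dots> = mpoly_subst const_frac (\<lambda>i. Fract (f i) 1) p"
    by (rule mpoly_subst_cong_vars[OF pm]) (use i0 in \<open>auto simp: chart_def eq_fract\<close>)
  also have "\<dots> = Fract (mpoly_comp_fps f p) 1"
    by (rule ring_morphism.mpoly_subst_compose[OF ring_morphism_fps_const ring_morphism_Fract])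
  finally have "Fract (f i0 ^ d) 1 * pullback p = Fract (mpoly_comp_fps f p) 1" .
  moreover have "Fract (f i0 ^ d) 1 \<noteq> 0" using i0(2) by (simp add: Zero_fract_def eq_fract)
  ultimately have "pullback p = Fract (mpoly_comp_fps f p) 1 / Fract (f i0 ^ d) 1"
    by (metis nonzero_mult_div_cancel_left)
  also have "\<dots> = Fract (mpoly_comp_fps f p) (f i0 ^ d)"
    using i0(2) by simp
  finally show ?thesis
    using frac_norm_Fract[of "mpoly_comp_fps f p" "f i0 ^ d" r] r i0 decays_f
      decays_mpoly_comp[OF pm, of f]
    by (simp add: seminorm_at_def decays_power gauss_norm_power less_Suc_eq_le)
qed

lemma seminorm_at_coordinate:
  assumes "j \<le> N" "r \<ge> 1"
  shows "seminorm_at r (mvar j - mconst c) =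
    gauss_norm v (f j - fps_const c * f i0) r / gauss_norm v (f i0) r"
    and "decays (f j - fps_const c * f i0)"
proof -
  have eq: "f j - fps_const c * f i0 = f j + fps_const (- c) * f i0" by (simp flip: fps_const_neg)
  show dec: "decays (f j - fps_const c * f i0)"
    unfolding eq by (intro decays_add decays_mult decays_const decays_f assms i0)
  have "pullback (mvar j - mconst c) = Fract (f j - fps_const c * f i0) (f i0)"
    using assms i0 by (simp add: pullback_simps chart_def)
  then show "seminorm_at r (mvar j - mconst c) =
      gauss_norm v (f j - fps_const c * f i0) r / gauss_norm v (f i0) r"
    using dec decays_f i0 assms(2) by (simp add: seminorm_at_def frac_norm_Fract)
qed

end

section \<open>Proximity to transverse hypersurfaces\<close>

text \<open>The last assumption expresses that the curve is not constant: in the chart it does not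
  coincide with any point \<open>a\<close>.\<close>

locale transverse_curve = entire_curve v N f i0
  for v :: "'a::alg_closed_field \<Rightarrow> real" and N f i0 +
  fixes n q :: nat and X :: "'a proj_pt set" and Q :: "nat \<Rightarrow> 'a mpoly" and deg :: "nat \<Rightarrow> nat"
  assumes trans: "all_transverse N n X q Q"
    and Q: "\<And>i. i \<in> {1..q} \<Longrightarrow> Q i \<in> forms N (deg i)"
    and vanish: "\<And>p. p \<in> vanishing_forms N X \<Longrightarrow> mpoly_comp_fps f p = 0"
    and nonconst: "\<And>a. a i0 = 1 \<Longrightarrow> \<exists>j\<le>N. f j \<noteq> fps_const (a j) * f i0"
begin

abbreviation seminorms :: "('a mpoly \<Rightarrow> real) set" where
  "seminorms \<equiv> seminorm_at ` radii"

lemma v_zero_one: "v 0 = 0" "v 1 = 1" by auto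

lemma seminorms: "W \<in> seminorms \<Longrightarrow> mult_seminorm v W"
  using mult_seminorm_at by blast

lemma equations_dominated:
  assumes "p \<in> vanishing_forms N X \<union> {mvar i0 - mconst 1}"
  shows "p \<in> dominated seminorms E \<inter> mpolys (Suc N)"
proof -
  have "seminorm_at r p = 0" if r: "r \<in> radii" for r
  proof (cases "p = mvar i0 - mconst 1")
    case True
    then show ?thesis using seminorm_at_coordinate(1)[of i0 r 1] i0 r by (simp add: radii_def)
  next
    case False
    then have p: "p \<in> vanishing_forms N X" using assms by blast
    then obtain d where "p \<in> forms N d" by (auto simp: vanishing_forms_def)
    then show ?thesis using seminorm_at_form[of p d r] vanish[OF p] r by (simp add: radii_def)
  qed
  moreover have "p \<in> mpolys (Suc N)"
    using assms forms_subset_mpolys i0(1) by (auto simp: vanishing_forms_def)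
  ultimately show ?thesis by (auto intro: dominated_zero)
qed

lemma sum_over_members_le:
  assumes W: "W \<in> seminorms" and J: "finite J" and F: "F \<subseteq> Q ` J"
  shows "sum W F \<le> (\<Sum>j\<in>J. W (Q j))"
proof -
  have nn: "W p \<ge> 0" for p using seminorms[OF W] by (simp add: mult_seminorm_def)
  have "sum W F \<le> sum W (Q ` J)" using J F nn by (intro sum_mono2) auto
  also have "\<dots> \<le> (\<Sum>j\<in>J. W (Q j))" using sum_image_le[OF J, of W Q] nn by (simp add: o_def)
  finally show ?thesis .
qed

text \<open>Together with the equations of \<open>X\<close> and of the chart, on which all seminorms vanish, the \<open>Q\<^sub>j\<close> have no
  common zero. So some \<open>m\<^sub>f(r, D\<^sub>j)\<close> is bounded.\<close>

lemma more_than_n_bound: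
  assumes J: "J \<subseteq> {1..q}" "card J > n"
  obtains C where "C \<ge> 0" "\<And>r. r \<in> radii \<Longrightarrow> 1 \<le> C * (\<Sum>j\<in>J. seminorm_at r (Q j))"
proof -
  have finJ: "finite J" using J(1) finite_subset by blast
  let ?D = "dominated seminorms (Q ` J)"
  have no_zero: "\<exists>p\<in>?D \<inter> mpolys (Suc N). mpoly_eval a p \<noteq> 0" for a
  proof (rule ccontr)
    assume "\<not> ?thesis"
    then have z: "\<And>p. p \<in> ?D \<inter> mpolys (Suc N) \<Longrightarrow> mpoly_eval a p = 0" by blast
    have "mpoly_eval a (mvar i0 - mconst 1) = 0" by (intro z equations_dominated) simp
    then have "a i0 = 1" by (simp add: eval.diff eval.one)
    moreover have "mpoly_eval a (Q j) = 0" if "j \<in> J" for j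
      using z[of "Q j"] dominated_base[of "Q j" "Q ` J"] Q forms_subset_mpolys J(1) that by blast
    moreover have "mpoly_eval a p = 0" if "p \<in> vanishing_forms N X" for p
      using z equations_dominated that by blast
    moreover have "J \<noteq> {}" using J(2) by auto
    ultimately have "card J \<le> n"
      by (intro transverse_intersection(1)[OF trans Q J(1) _ i0(1), where a = a]) auto
    then show False using J(2) by simp
  qed
  obtain F C where F: "F \<subseteq> Q ` J" "C \<ge> 0" "\<And>W. W \<in> seminorms \<Longrightarrow> 1 \<le> C * sum W F"
    using bound_without_common_zero[OF seminorms v_zero_one no_zero] by metis
  have "1 \<le> C * (\<Sum>j\<in>J. seminorm_at r (Q j))" if "r \<in> radii" for r
    using F(3)[of "seminorm_at r"] mult_left_mono[OF sum_over_members_le[OF _ finJ F(1)] F(2), of "seminorm_at r"] that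
    by (meson imageI order_trans)
  then show ?thesis using F(2) that by blast
qed

text \<open>Now common zeros may exist; they are reduced and isolated. Each such zero \<open>a\<close> has a multiplier \<open>g\<^sub>a\<close>
  with \<open>g\<^sub>a(a) \<noteq> 0\<close> for which all \<open>g\<^sub>a (x\<^sub>j - a\<^sub>j)\<close> are dominated by the \<open>Q\<^sub>j\<close>. The \<open>Q\<^sub>j\<close> and all \<open>g\<^sub>a\<close> together
  have no common zero, so at each radius some \<open>Q\<^sub>j\<close> or one of finitely many \<open>g\<^sub>a\<close> is not small. If it is
  \<open>g\<^sub>a\<close>, every \<open>x\<^sub>j - a\<^sub>j\<close> is as small as the \<open>Q\<^sub>j\<close> are. But some \<open>x\<^sub>j - a\<^sub>j\<close> does not vanish on the
  curve, and its seminorm is at least a constant divided by \<open>|f\<^sub>i\<^sub>0|\<^sub>r\<close>. Hence some \<open>m\<^sub>f(r, D\<^sub>j)\<close> is at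
  most \<open>T\<^sub>f(r) + O(1)\<close>, whatever the degree of \<open>D\<^sub>j\<close> is.\<close>

lemma exactly_n_bound:
  assumes J: "J \<subseteq> {1..q}" "card J = n" "n \<ge> 1"
  obtains C where "C \<ge> 0"
    "\<And>r. r \<in> radii \<Longrightarrow> 1 \<le> C * gauss_norm v (f i0) r * (\<Sum>j\<in>J. seminorm_at r (Q j))"
proof -
  have finJ: "finite J" using J(1) finite_subset by blast
  have Jne: "J \<noteq> {}" using J(2,3) by auto
  let ?S = "\<lambda>r. \<Sum>j\<in>J. seminorm_at r (Q j)"
  let ?D = "\<lambda>E. dominated seminorms E"
  let ?b = "\<lambda>a j. mvar j - mconst (a j)"
  have ideal: "ring_ideal (?D E)" for E by (rule ring_ideal_dominated[OF seminorms v_zero_one(1)])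
  have nn: "seminorm_at r p \<ge> 0" if "r \<in> radii" for r p
    using mult_seminorm_at[OF that] by (simp add: mult_seminorm_def)
  define Z where "Z = {a. a i0 = 1 \<and> (\<forall>p\<in>vanishing_forms N X. mpoly_eval a p = 0) \<and>
    (\<forall>j\<in>J. mpoly_eval a (Q j) = 0)}"
  have QD: "Q j \<in> ?D E \<inter> mpolys (Suc N)" if "j \<in> J" "Q ` J \<subseteq> E" for j E
    using dominated_base[of "Q j" E] Q forms_subset_mpolys J(1) that by blast
  have "\<exists>g\<in>mpolys (Suc N). mpoly_eval a g \<noteq> 0 \<and> (\<forall>j<Suc N. g * ?b a j \<in> ?D (Q ` J))" if a: "a \<in> Z" for a
  proof (rule reduced_point_multiplier[OF ideal])
    let ?G = "vanishing_forms N X \<union> {mvar i0 - mconst 1} \<union> Q ` J"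
    show "?G \<subseteq> ?D (Q ` J) \<inter> mpolys (Suc N)" using equations_dominated QD by blast
    show "mpoly_eval a p = 0" if "p \<in> ?G" for p using that a by (auto simp: Z_def eval.diff eval.one)
    fix w j assume w: "\<And>p. p \<in> ?G \<Longrightarrow> (\<Sum>j<Suc N. mpoly_eval a (mpoly_pderiv j p) * w j) = 0"
      and j: "j < Suc N"
    have "(\<Sum>i\<le>N. mpoly_eval a (mpoly_pderiv i p) * w i) = 0"
      if "p \<in> vanishing_forms N X \<union> Q ` J" for p
      using w[of p] that by (auto simp: lessThan_Suc_atMost)
    then obtain c where c: "\<forall>i\<le>N. w i = c * a i"
      using transverse_intersection(2)[OF trans Q J(1) Jne i0(1) _ _ _ J(2), of a w] a
      by (auto simp: Z_def)
    have pd: "mpoly_pderiv j (mvar i0 - mconst 1 :: 'a mpoly) = (if j = i0 then 1 else 0)" for j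
    proof -
      have "mpoly_pderiv j (mvar i0 + mconst (- 1) :: 'a mpoly) = (if j = i0 then 1 else 0)"
        unfolding mpoly_pderiv_add by (auto simp: mpoly_pderiv_mvar)
      then show ?thesis by (simp add: single_uminus)
    qed
    \<comment> \<open>The equation of the chart excludes the direction of \<open>a\<close> itself.\<close>
    have "(\<Sum>j<Suc N. mpoly_eval a (mpoly_pderiv j (mvar i0 - mconst 1)) * w j) =
      (\<Sum>j<Suc N. if j = i0 then w j else 0)"
      by (intro sum.cong) (auto simp: pd eval.one eval.zero simp del: single_one)
    also have "\<dots> = w i0" using i0(1) by simp
    finally have "w i0 = 0" using w by simp
    then have "c = 0" using c i0(1) a by (auto simp: Z_def)
    then show "w j = 0" using c j by simp
  qed
  then have "\<forall>a\<in>Z. \<exists>g. g \<in> mpolys (Suc N) \<and> mpoly_eval a g \<noteq> 0 \<and> (\<forall>j<Suc N. g * ?b a j \<in> ?D (Q ` J))"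
    by blast
  from bchoice[OF this] obtain g where g: "\<And>a. a \<in> Z \<Longrightarrow> g a \<in> mpolys (Suc N)"
    "\<And>a. a \<in> Z \<Longrightarrow> mpoly_eval a (g a) \<noteq> 0"
    "\<And>a j. a \<in> Z \<Longrightarrow> j \<le> N \<Longrightarrow> g a * ?b a j \<in> ?D (Q ` J)"
    by (auto simp: less_Suc_eq_le)
  let ?E = "Q ` J \<union> g ` Z"
  have no_zero: "\<exists>p\<in>?D ?E \<inter> mpolys (Suc N). mpoly_eval a p \<noteq> 0" for a
  proof (rule ccontr)
    assume "\<not> ?thesis"
    then have z: "\<And>p. p \<in> ?D ?E \<inter> mpolys (Suc N) \<Longrightarrow> mpoly_eval a p = 0" by blast
    have "mpoly_eval a (mvar i0 - mconst 1) = 0" by (intro z equations_dominated) simp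
    then have "a i0 = 1" by (simp add: eval.diff eval.one)
    moreover have "mpoly_eval a (Q j) = 0" if "j \<in> J" for j using z QD that by blast
    moreover have "mpoly_eval a p = 0" if "p \<in> vanishing_forms N X" for p
      using z equations_dominated that by blast
    ultimately have aZ: "a \<in> Z" by (simp add: Z_def)
    then have "g a \<in> ?D ?E" by (intro dominated_base) blast
    then have "mpoly_eval a (g a) = 0" using z g(1)[OF aZ] by blast
    then show False using g(2)[OF aZ] by simp
  qed
  obtain F C where F: "finite F" "F \<subseteq> ?E" "C \<ge> 0" "\<And>W. W \<in> seminorms \<Longrightarrow> 1 \<le> C * sum W F"
    using bound_without_common_zero[OF seminorms v_zero_one no_zero] by metis
  obtain c0 where c0: "c0 > 0" "\<And>r. r \<ge> 1 \<Longrightarrow> gauss_norm v (f i0) r \<ge> c0"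
    using gauss_norm_lower_bound[OF decays_f[OF i0(1)] i0(2)] by metis
  have "\<exists>K\<ge>0. \<forall>r\<in>radii. seminorm_at r e \<le> K * (gauss_norm v (f i0) r * ?S r)" if eF: "e \<in> F" for e
  proof (cases "e \<in> Q ` J")
    case True
    have "seminorm_at r e \<le> 1 / c0 * (gauss_norm v (f i0) r * ?S r)" if r: "r \<in> radii" for r
    proof -
      have "seminorm_at r e \<le> 1 * ?S r"
        using True sum_over_members_le[of "seminorm_at r" J "{e}"] finJ r by auto
      also have "\<dots> \<le> (gauss_norm v (f i0) r / c0) * ?S r"
        using c0 r nn by (intro mult_right_mono sum_nonneg) (auto simp: radii_def)
      finally show ?thesis by simp
    qed
    then show ?thesis using c0(1) by (intro exI[of _ "1 / c0"]) auto
  next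
    case False
    then obtain a where a: "a \<in> Z" "e = g a" using F(2) eF by blast
    then obtain j where j: "j \<le> N" "f j \<noteq> fps_const (a j) * f i0"
      using nonconst[of a] by (auto simp: Z_def)
    let ?h = "f j - fps_const (a j) * f i0"
    have "?h \<noteq> 0" using j(2) by simp
    then obtain c where c: "c > 0" "\<And>r. r \<ge> 1 \<Longrightarrow> gauss_norm v ?h r \<ge> c"
      using gauss_norm_lower_bound[OF seminorm_at_coordinate(2)[OF j(1) order_refl]] by metis
    obtain F' K where K: "F' \<subseteq> Q ` J" "K \<ge> 0"
        "\<And>W. W \<in> seminorms \<Longrightarrow> W (g a * ?b a j) \<le> K * sum W F'"
      using g(3)[OF a(1) j(1)] unfolding dominated_def by blast
    have "seminorm_at r e \<le> K / c * (gauss_norm v (f i0) r * ?S r)" if r: "r \<in> radii" for r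
    proof -
      have r1: "r \<ge> 1" using r by (simp add: radii_def)
      have pos: "gauss_norm v (f i0) r > 0" using c0 r1 by (metis less_le_trans)
      have "seminorm_at r e * (c / gauss_norm v (f i0) r) \<le> seminorm_at r e * seminorm_at r (?b a j)"
        using c(2)[OF r1] pos nn[OF r]
        by (intro mult_left_mono) (auto simp: seminorm_at_coordinate(1)[OF j(1) r1] divide_right_mono)
      also have "\<dots> = seminorm_at r (g a * ?b a j)"
        using mult_seminorm_at[OF r] by (simp add: mult_seminorm_def a(2))
      also have "\<dots> \<le> K * sum (seminorm_at r) F'" using K(3) r by blast
      also have "\<dots> \<le> K * ?S r" using sum_over_members_le[OF _ finJ K(1)] r K(2) by (intro mult_left_mono) auto
      finally show ?thesis using pos c(1) by (simp add: field_simps)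
    qed
    then show ?thesis using K(2) c(1) by (intro exI[of _ "K / c"]) auto
  qed
  then have "\<forall>e\<in>F. \<exists>K\<ge>0. \<forall>r\<in>radii. seminorm_at r e \<le> K * (gauss_norm v (f i0) r * ?S r)" by blast
  from bchoice[OF this] obtain K where K: "\<And>e. e \<in> F \<Longrightarrow> K e \<ge> 0"
    "\<And>e r. e \<in> F \<Longrightarrow> r \<in> radii \<Longrightarrow> seminorm_at r e \<le> K e * (gauss_norm v (f i0) r * ?S r)"
    by auto
  have "1 \<le> (C * sum K F) * gauss_norm v (f i0) r * ?S r" if r: "r \<in> radii" for r
  proof -
    have "1 \<le> C * sum (seminorm_at r) F" using F(4) r by blast
    also have "\<dots> \<le> C * (\<Sum>e\<in>F. K e * (gauss_norm v (f i0) r * ?S r))"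
      using K(2) r F(3) by (intro mult_left_mono sum_mono) auto
    also have "\<dots> = (C * sum K F) * gauss_norm v (f i0) r * ?S r"
      by (simp only: sum_distrib_right[symmetric] mult.assoc)
    finally show ?thesis .
  qed
  moreover have "C * sum K F \<ge> 0" using F(3) K(1) by (intro mult_nonneg_nonneg sum_nonneg)
  ultimately show ?thesis using that by blast
qed

end

lemma ex_large_summand:
  fixes x :: "'b \<Rightarrow> real"
  assumes "finite J" "J \<noteq> {}"
  shows "\<exists>j\<in>J. sum x J \<le> real (card J) * x j"
proof -
  have "Max (x ` J) \<in> x ` J" using assms by (intro Max_in) auto
  then obtain j where j: "j \<in> J" "x j = Max (x ` J)" by force
  then have "sum x J \<le> real (card J) * x j"
    using assms by (intro sum_bounded_above) auto
  then show ?thesis using j(1) by blast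
qed

lemma finite_uniform_constant:
  assumes "finite S" "\<And>s. s \<in> S \<Longrightarrow> \<exists>c>0. P s c"
    and mono: "\<And>s c c'. P s c \<Longrightarrow> 0 < c' \<Longrightarrow> c' \<le> c \<Longrightarrow> P s c'"
  shows "\<exists>c>0::real. \<forall>s\<in>S. P s c"
  using assms(1,2)
proof (induction S rule: finite_induct)
  case (insert s S)
  then obtain c d where "c > 0" "\<forall>s\<in>S. P s c" "d > 0" "P s d" by blast
  then show ?case using mono by (intro exI[of _ "min c d"]) auto
qed (auto intro: exI[of _ 1])

context transverse_curve begin

lemma radiiI:
  assumes "r \<ge> 1" "gauss_norm v (f i0) r = rep_norm v N f r"
  shows "r \<in> radii"
  using assms by (auto simp: radii_def rep_norm_def intro!: Max_ge)

text \<open>In terms of proximity functions: some \<open>m\<^sub>f(r, D\<^sub>j)\<close> is at most \<open>O(1)\<close>, respectively \<open>T\<^sub>f(r) + O(1)\<close>, at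
  the radii at which \<open>f\<^sub>i\<^sub>0\<close> is a largest component. The bound \<open>B\<close> in the proof is \<open>1\<close> in the first
  case and \<open>\<parallel>f\<parallel>\<^sub>r\<close> in the second.\<close>

lemma some_component_far:
  assumes J: "J \<subseteq> {1..q}"
  shows "card J > n \<Longrightarrow> \<exists>c>0. \<forall>r\<ge>1. gauss_norm v (f i0) r = rep_norm v N f r \<longrightarrow>
      (\<exists>j\<in>J. c * rep_norm v N f r ^ deg j \<le> gauss_norm v (mpoly_comp_fps f (Q j)) r)"
    and "card J = n \<Longrightarrow> n \<ge> 1 \<Longrightarrow> \<exists>c>0. \<forall>r\<ge>1. gauss_norm v (f i0) r = rep_norm v N f r \<longrightarrow>
      (\<exists>j\<in>J. c * rep_norm v N f r ^ deg j \<le>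
        rep_norm v N f r * gauss_norm v (mpoly_comp_fps f (Q j)) r)"
proof -
  have fin: "finite J" using J finite_subset by blast
  have conclude: "\<exists>c>0. \<forall>r\<ge>1. gauss_norm v (f i0) r = rep_norm v N f r \<longrightarrow>
      (\<exists>j\<in>J. c * rep_norm v N f r ^ deg j \<le>
        B r * gauss_norm v (mpoly_comp_fps f (Q j)) r)"
    if bound: "\<And>r. r \<in> radii \<Longrightarrow> 1 \<le> C * B r * (\<Sum>j\<in>J. seminorm_at r (Q j))"
      and "C \<ge> 0" and B: "\<And>r. r \<in> radii \<Longrightarrow> B r \<ge> 0" and ne: "J \<noteq> {}" for C B
  proof -
    \<comment> \<open>The summand \<open>1\<close> only makes the denominator positive.\<close>
    let ?C = "C * real (card J) + 1"
    have "\<exists>j\<in>J. 1 / ?C * rep_norm v N f r ^ deg j \<le> B r * gauss_norm v (mpoly_comp_fps f (Q j)) r"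
      if r: "r \<ge> 1" and att: "gauss_norm v (f i0) r = rep_norm v N f r" for r
    proof -
      have rad: "r \<in> radii" by (rule radiiI[OF r att])
      have pos: "rep_norm v N f r > 0"
        using gauss_norm_pos[OF decays_f[OF i0(1)] i0(2) r] att by simp
      obtain j where j: "j \<in> J" "(\<Sum>j\<in>J. seminorm_at r (Q j)) \<le> real (card J) * seminorm_at r (Q j)"
        using ex_large_summand[OF fin ne] by blast
      let ?g = "gauss_norm v (mpoly_comp_fps f (Q j)) r" and ?R = "rep_norm v N f r ^ deg j"
      have "j \<in> {1..q}" using j(1) J by blast
      then have sn: "seminorm_at r (Q j) = ?g / ?R"
        using seminorm_at_form[OF Q r] att by simp
      have g: "?g \<ge> 0"
        using mult_seminorm_at[OF rad] pos unfolding mult_seminorm_def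
        by (metis sn zero_le_divide_iff zero_less_power not_less)
      have "1 \<le> C * B r * (\<Sum>j\<in>J. seminorm_at r (Q j))" by (rule bound[OF rad])
      also have "\<dots> \<le> C * B r * (real (card J) * seminorm_at r (Q j))"
        using j(2) \<open>C \<ge> 0\<close> B[OF rad] by (intro mult_left_mono) auto
      also have "\<dots> = (C * real (card J)) * (B r * ?g) / ?R" by (simp add: sn)
      finally have "?R \<le> (C * real (card J)) * (B r * ?g)" using pos by (simp add: field_simps)
      also have "\<dots> \<le> ?C * (B r * ?g)" using B[OF rad] g by (intro mult_right_mono) auto
      finally have "?R \<le> ?C * (B r * ?g)" .
      moreover have "?C > 0" using \<open>C \<ge> 0\<close> by (simp add: add_nonneg_pos)
      ultimately have "1 / ?C * ?R \<le> B r * ?g" by (simp add: field_simps)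
      then show ?thesis using j(1) by blast
    qed
    moreover have "1 / ?C > 0" using \<open>C \<ge> 0\<close> by (simp add: add_nonneg_pos)
    ultimately show ?thesis by blast
  qed
  show "\<exists>c>0. \<forall>r\<ge>1. gauss_norm v (f i0) r = rep_norm v N f r \<longrightarrow>
      (\<exists>j\<in>J. c * rep_norm v N f r ^ deg j \<le> gauss_norm v (mpoly_comp_fps f (Q j)) r)"
    if card: "card J > n"
  proof -
    obtain C where "C \<ge> 0" "\<And>r. r \<in> radii \<Longrightarrow> 1 \<le> C * (\<Sum>j\<in>J. seminorm_at r (Q j))"
      using more_than_n_bound[OF J card] by blast
    moreover have "J \<noteq> {}" using card by auto
    ultimately show ?thesis using conclude[of C "\<lambda>_. 1"] by simp
  qed
  show "\<exists>c>0. \<forall>r\<ge>1. gauss_norm v (f i0) r = rep_norm v N f r \<longrightarrow>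
      (\<exists>j\<in>J. c * rep_norm v N f r ^ deg j \<le>
        rep_norm v N f r * gauss_norm v (mpoly_comp_fps f (Q j)) r)"
    if card: "card J = n" "n \<ge> 1"
  proof -
    obtain C where C: "C \<ge> 0"
      "\<And>r. r \<in> radii \<Longrightarrow> 1 \<le> C * gauss_norm v (f i0) r * (\<Sum>j\<in>J. seminorm_at r (Q j))"
      using exactly_n_bound[OF J card] by blast
    have "J \<noteq> {}" using card by auto
    moreover have "gauss_norm v (f i0) r \<ge> 0" if "r \<in> radii" for r
      using gauss_norm_nonneg[OF decays_f[OF i0(1)]] that by (simp add: radii_def)
    ultimately show ?thesis using conclude[OF C(2,1)] by fastforce
  qed
qed

end

section \<open>The sum of the proximity functions\<close>

text \<open>At most \<open>n\<close> of the \<open>m i\<close> exceed \<open>A\<close>; the others contribute at most a bounded amount. Each summand is at most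
  \<open>t + A\<close>, which settles the case of fewer than \<open>n\<close> large ones. If there are exactly \<open>n\<close>, one of them is
  even at most \<open>t + A\<close> before division by its degree, and contributes at most \<open>M (t + A)\<close>.\<close>

lemma weighted_sum_bound:
  fixes m :: "'i \<Rightarrow> real" and d :: "'i \<Rightarrow> nat" and t A M :: real
  assumes S: "finite S" and d: "\<And>i. i \<in> S \<Longrightarrow> d i \<ge> 1" and M: "\<And>i. i \<in> S \<Longrightarrow> 1 / real (d i) \<le> M" "M \<ge> 0"
    and A: "A \<ge> 0" "t + A \<ge> 0" and n: "n \<ge> 1"
    and each: "\<And>i. i \<in> S \<Longrightarrow> m i \<le> real (d i) * t + A"
    and more: "\<And>J. J \<subseteq> S \<Longrightarrow> card J = Suc n \<Longrightarrow> \<exists>j\<in>J. m j \<le> A"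
    and exactly: "\<And>J. J \<subseteq> S \<Longrightarrow> card J = n \<Longrightarrow> \<exists>j\<in>J. m j \<le> t + A"
  shows "(\<Sum>i\<in>S. m i / real (d i)) \<le> (real n - 1 + M) * t + (real n - 1 + M + real (card S)) * A"
proof -
  define B where "B = {i \<in> S. m i > A}"
  have B: "B \<subseteq> S" "finite B" using S by (auto simp: B_def)
  have "card B \<le> n"
  proof (rule ccontr)
    assume "\<not> card B \<le> n"
    then obtain J where "J \<subseteq> B" "card J = Suc n"
      using obtain_subset_with_card_n[of "Suc n" B] by (metis not_less_eq_eq)
    then show False using more[of J] by (force simp: B_def)
  qed
  have le: "m i / real (d i) \<le> t + A" if "i \<in> S" for i
  proof -
    have "m i / real (d i) \<le> (real (d i) * t + A) / real (d i)"
      using each[OF that] by (intro divide_right_mono) auto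
    also have "\<dots> = t + A / real (d i)" using d[OF that] by (simp add: add_divide_distrib)
    also have "A / real (d i) \<le> A" using d[OF that] A(1) by (simp add: divide_le_eq mult_le_cancel_left1)
    finally show ?thesis by simp
  qed
  have "(\<Sum>i\<in>S - B. m i / real (d i)) \<le> real (card (S - B)) * A"
  proof (rule sum_bounded_above)
    fix i assume i: "i \<in> S - B"
    have "m i / real (d i) \<le> A / real (d i)" using i by (intro divide_right_mono) (auto simp: B_def)
    also have "\<dots> \<le> A" using d[of i] i A(1) by (simp add: divide_le_eq mult_le_cancel_left1)
    finally show "m i / real (d i) \<le> A" .
  qed
  also have "\<dots> \<le> real (card S) * A" using S A(1) by (intro mult_right_mono) (auto intro: card_mono)
  finally have out: "(\<Sum>i\<in>S - B. m i / real (d i)) \<le> real (card S) * A" .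
  have "(\<Sum>i\<in>B. m i / real (d i)) \<le> (real n - 1 + M) * (t + A)"
  proof (cases "card B = n")
    case True
    then obtain j where j: "j \<in> B" "m j \<le> t + A" using exactly[OF B(1)] by blast
    have "(\<Sum>i\<in>B. m i / real (d i)) = m j / real (d j) + (\<Sum>i\<in>B - {j}. m i / real (d i))"
      using B(2) j(1) by (simp add: sum.remove)
    also have "m j / real (d j) \<le> (t + A) / real (d j)" using j(2) by (intro divide_right_mono) auto
    also have "\<dots> \<le> M * (t + A)"
      using mult_right_mono[OF M(1)[of j] A(2)] j(1) B(1) by auto
    also have "(\<Sum>i\<in>B - {j}. m i / real (d i)) \<le> real (card (B - {j})) * (t + A)"
      using le B(1) by (intro sum_bounded_above) auto
    also have "real (card (B - {j})) = real n - 1" using True j(1) n B(2) by (simp add: of_nat_diff)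
    finally show ?thesis by (simp add: algebra_simps)
  next
    case False
    with \<open>card B \<le> n\<close> have "real (card B) \<le> real n - 1" by linarith
    have "(\<Sum>i\<in>B. m i / real (d i)) \<le> real (card B) * (t + A)"
      using le B(1) by (intro sum_bounded_above) auto
    also have "\<dots> \<le> (real n - 1) * (t + A)" by (intro mult_right_mono) fact+
    also have "\<dots> \<le> (real n - 1 + M) * (t + A)" using M(2) A(2) by (intro mult_right_mono) auto
    finally show ?thesis .
  qed
  moreover have "(\<Sum>i\<in>S. m i / real (d i)) = (\<Sum>i\<in>S - B. m i / real (d i)) + (\<Sum>i\<in>B. m i / real (d i))"
    using S B(1) by (rule sum.subset_diff[rotated])
  ultimately show ?thesis using out by (simp add: algebra_simps)
qed

theorem theorem4:
  fixes v :: "'a::alg_closed_field \<Rightarrow> real"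
    and N n q :: nat
    and X :: "'a proj_pt set"
    and Q :: "nat \<Rightarrow> 'a mpoly"
    and deg :: "nat \<Rightarrow> nat"
    and f :: "nat \<Rightarrow> 'a fps"
  assumes "nonarch_absval v" and "complete_absval v"
    and "proj_variety N X" and "proj_dim N X = enat n" and "n \<ge> 1"
    and "q \<ge> 1"
    and "\<forall>i\<in>{1..q}. deg i \<ge> 1 \<and> Q i \<in> forms N (deg i) \<and> Q i \<noteq> 0"
    and "all_transverse N n X q Q"
    and "analytic_rep v N f"
    and "range (analytic_map v N f) \<subseteq> X"
    and "\<not> (analytic_map v N f) constant_on UNIV"
    and "\<forall>i\<in>{1..q}. \<not> range (analytic_map v N f) \<subseteq> proj_zeros N {Q i}"
  shows "(\<exists>C. \<forall>r\<ge>1.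
            (\<Sum>i=1..q. prox_fun v N f (deg i) (Q i) r / real (deg i))
              \<le> (real n - 1 + (MAX i\<in>{1..q}. 1 / real (deg i))) * char_fun v N f r + C) \<and>
         (\<forall>d. (\<forall>i\<in>{1..q}. deg i = d) \<longrightarrow>
            (\<exists>C. \<forall>r\<ge>1.
               1 / real d * (\<Sum>i=1..q. prox_fun v N f d (Q i) r)
                 \<le> (real n - 1 + 1 / real d) * char_fun v N f r + C))"
proof -
  interpret nonarch_absval v by fact
  define e where "e = (\<lambda>z i. entire_eval v (f i) z)"
  have ent: "\<And>i. i \<le> N \<Longrightarrow> entire v (f i)" and nz: "\<And>z. \<exists>i\<le>N. e z i \<noteq> 0"
    using assms(9) by (auto simp: analytic_rep_def e_def)
  have map_e: "analytic_map v N f z = proj_point N (e z)" for z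
    by (simp add: analytic_map_def e_def)
  have sums: "fps_sums_at v (f i) z (e z i)" if "i \<le> N" for i z
    using entire_sums_at_eval[OF ent[OF that]] by (simp add: e_def)
  have decays_f: "decays (f i)" if "i \<le> N" for i by (rule entire_decays[OF ent[OF that]])
  have Q: "\<And>i. i \<in> {1..q} \<Longrightarrow> Q i \<in> forms N (deg i)" using assms(7) by blast
  have comp_sums: "fps_sums_at v (mpoly_comp_fps f p) z (mpoly_eval (e z) p)"
    if "p \<in> forms N d" for p d z
    using that forms_subset_mpolys sums by (intro fps_sums_at_mpoly_comp[of p "Suc N"]) auto
  \<comment> \<open>The points of the curve lie on \<open>X\<close>; the identity theorem turns this into identities of power series.\<close>
  have vanish: "mpoly_comp_fps f p = 0" if p: "p \<in> vanishing_forms N X" for p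
  proof (rule fps_eq_0_if_sums_0_everywhere[OF infinite_alg_closed])
    fix z
    obtain d where d: "p \<in> forms N d" using p by (auto simp: vanishing_forms_def)
    define x where "x = (\<lambda>i. if i \<le> N then 1 * e z i else 0)"
    have "x \<in> analytic_map v N f z" 
      unfolding map_e proj_point_def x_def by (intro CollectI exI[of _ "1::'a"]) simp
    moreover have "analytic_map v N f z \<in> X" using assms(10) by blast
    ultimately have "mpoly_eval x p = 0"
      using p unfolding vanishing_forms_def by blast
    moreover have "mpoly_eval x p = mpoly_eval (e z) p"
      using d forms_subset_mpolys by (intro mpoly_subst_cong_vars[of p "Suc N"]) (auto simp: x_def)
    ultimately show "fps_sums_at v (mpoly_comp_fps f p) z 0" using comp_sums[OF d, of z] by simp
  qed
  have comp_nonzero: "mpoly_comp_fps f (Q i) \<noteq> 0" if i: "i \<in> {1..q}" for i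
  proof
    assume 0: "mpoly_comp_fps f (Q i) = 0"
    have "analytic_map v N f z \<in> proj_zeros N {Q i}" for z
    proof -
      have "fps_sums_at v 0 z (mpoly_eval (e z) (Q i))" using comp_sums[OF Q[OF i], of z] 0 by simp
      then have "mpoly_eval (e z) (Q i) = 0"
        using fps_sums_at_const[of 0 z] fps_sums_at_unique by auto
      moreover obtain i0 where "i0 \<le> N" "e z i0 \<noteq> 0" using nz by blast
      ultimately show ?thesis unfolding map_e using Q[OF i] by (intro in_proj_zerosI) auto
    qed
    then show False using assms(12) i by blast
  qed
  have nonconst: "\<exists>j\<le>N. f j \<noteq> fps_const (a j) * f i0" if i0: "i0 \<le> N" for a i0
  proof (rule ccontr)
    assume "\<not> ?thesis"
    then have eq: "\<And>j. j \<le> N \<Longrightarrow> f j = fps_const (a j) * f i0" by blast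
    have ej: "e z j = a j * e z i0" if "j \<le> N" for z j
      using fps_sums_at_unique[OF sums[OF that, of z]]
        fps_sums_at_mult[OF fps_sums_at_const sums[OF i0, of z], of "a j"] eq[OF that] by simp
    have "proj_point N (e z) = proj_point N a" for z
    proof -
      have z: "e z i0 \<noteq> 0" using nz[of z] ej by force
      have to_a: "(\<lambda>i. if i \<le> N then c * e z i else 0) =
          (\<lambda>i. if i \<le> N then (c * e z i0) * a i else 0)" for c
        using ej by (auto simp: fun_eq_iff)
      have from_a: "(\<lambda>i. if i \<le> N then c * a i else 0) =
          (\<lambda>i. if i \<le> N then (c / e z i0) * e z i else 0)" for c
        using ej z by (auto simp: fun_eq_iff)
      show ?thesis
      proof (intro subset_antisym subsetI)
        fix x assume "x \<in> proj_point N (e z)"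
        then obtain c where "c \<noteq> 0" "x = (\<lambda>i. if i \<le> N then c * e z i else 0)"
          unfolding proj_point_def by blast
        then have "c * e z i0 \<noteq> 0" "x = (\<lambda>i. if i \<le> N then (c * e z i0) * a i else 0)"
          using z to_a by simp_all
        then show "x \<in> proj_point N a" unfolding proj_point_def by blast
      next
        fix x assume "x \<in> proj_point N a"
        then obtain c where "c \<noteq> 0" "x = (\<lambda>i. if i \<le> N then c * a i else 0)"
          unfolding proj_point_def by blast
        then have "c / e z i0 \<noteq> 0" "x = (\<lambda>i. if i \<le> N then (c / e z i0) * e z i else 0)"
          using z from_a by simp_all
        then show "x \<in> proj_point N (e z)" unfolding proj_point_def by blast
      qed
    qed
    then show False using assms(11) unfolding constant_on_def map_e by blast
  qed
  define R where "R = rep_norm v N f"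
  define g where "g = (\<lambda>i. gauss_norm v (mpoly_comp_fps f (Q i)))"
  have dec_g: "decays (mpoly_comp_fps f (Q i))" if "i \<in> {1..q}" for i
    using Q[OF that] forms_subset_mpolys decays_f by (intro decays_mpoly_comp[of _ "Suc N"]) auto
  obtain i1 where i1: "i1 \<le> N" "f i1 \<noteq> 0"
  proof -
    obtain i where i: "i \<le> N" "e 0 i \<noteq> 0" using nz by blast
    have "f i \<noteq> 0"
      using sums[OF i(1), of 0] fps_sums_at_const[of 0 0] fps_sums_at_unique i(2) by auto
    then show ?thesis using i(1) that by blast
  qed
  have R_ge: "gauss_norm v (f i) r \<le> R r" if "i \<le> N" for i r
    unfolding R_def rep_norm_def using that by (intro Max_ge) auto
  have R_pos: "R r > 0" if "r \<ge> 1" for r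
    using R_ge[OF i1(1), of r] gauss_norm_pos[OF decays_f[OF i1(1)] i1(2) that] by linarith
  have R_att: "\<exists>i0\<in>{i. i \<le> N \<and> f i \<noteq> 0}. gauss_norm v (f i0) r = R r" if r: "r \<ge> 1" for r
  proof -
    have "R r \<in> (\<lambda>i. gauss_norm v (f i) r) ` {..N}"
      unfolding R_def rep_norm_def by (intro Max_in) auto
    then obtain i where i: "i \<le> N" "gauss_norm v (f i) r = R r" by auto
    then have "f i \<noteq> 0" using R_pos[OF r] r by auto
    then show ?thesis using i by blast
  qed
  have curve: "transverse_curve v N f i0 n q X Q deg" if "i0 \<le> N" "f i0 \<noteq> 0" for i0
    using decays_f that assms(8) Q vanish nonconst[OF that(1)] by unfold_locales blast+
  \<comment> \<open>Each radius belongs to one of finitely many charts, so the constants found for the charts can be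
    replaced by their minimum.\<close>
  have uniform: "\<exists>c>0. \<forall>r\<ge>1. \<exists>j\<in>J. c * R r ^ deg j \<le> b r * g j r"
    if "\<And>i0. i0 \<le> N \<Longrightarrow> f i0 \<noteq> 0 \<Longrightarrow> \<exists>c>0. \<forall>r\<ge>1. gauss_norm v (f i0) r = R r \<longrightarrow>
      (\<exists>j\<in>J. c * R r ^ deg j \<le> b r * g j r)" for J b
  proof -
    have "\<exists>c>0. \<forall>i0\<in>{i. i \<le> N \<and> f i \<noteq> 0}. \<forall>r\<ge>1. gauss_norm v (f i0) r = R r \<longrightarrow>
        (\<exists>j\<in>J. c * R r ^ deg j \<le> b r * g j r)"
    proof (rule finite_uniform_constant)
      fix i0 and c c' :: real
      assume *: "\<forall>r\<ge>1. gauss_norm v (f i0) r = R r \<longrightarrow> (\<exists>j\<in>J. c * R r ^ deg j \<le> b r * g j r)"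
        and c: "0 < c'" "c' \<le> c"
      have "c' * R r ^ deg j \<le> c * R r ^ deg j" if "r \<ge> 1" for r j
        using R_pos[OF that] c by (intro mult_right_mono) auto
      then show "\<forall>r\<ge>1. gauss_norm v (f i0) r = R r \<longrightarrow> (\<exists>j\<in>J. c' * R r ^ deg j \<le> b r * g j r)"
        using * by (meson order_trans)
    qed (use that in auto)
    then show ?thesis using R_att by meson
  qed
  have more: "\<exists>c>0. \<forall>r\<ge>1. \<exists>j\<in>J. c * R r ^ deg j \<le> g j r" if J: "J \<subseteq> {1..q}" "card J = Suc n" for J
  proof -
    have "\<exists>c>0. \<forall>r\<ge>1. \<exists>j\<in>J. c * R r ^ deg j \<le> 1 * g j r"
    proof (rule uniform)
      fix i0 assume "i0 \<le> N" "f i0 \<noteq> 0"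
      then interpret transverse_curve v N f i0 n q X Q deg by (rule curve)
      show "\<exists>c>0. \<forall>r\<ge>1. gauss_norm v (f i0) r = R r \<longrightarrow> (\<exists>j\<in>J. c * R r ^ deg j \<le> 1 * g j r)"
        unfolding R_def g_def mult_1 by (rule some_component_far(1)[OF J(1)]) (simp add: J(2))
    qed
    then show ?thesis by simp
  qed
  have exactly: "\<exists>c>0. \<forall>r\<ge>1. \<exists>j\<in>J. c * R r ^ deg j \<le> R r * g j r"
    if J: "J \<subseteq> {1..q}" "card J = n" for J
  proof (rule uniform)
    fix i0 assume "i0 \<le> N" "f i0 \<noteq> 0"
    then interpret transverse_curve v N f i0 n q X Q deg by (rule curve)
    show "\<exists>c>0. \<forall>r\<ge>1. gauss_norm v (f i0) r = R r \<longrightarrow> (\<exists>j\<in>J. c * R r ^ deg j \<le> R r * g j r)"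
      unfolding R_def g_def by (rule some_component_far(2)[OF J assms(5)])
  qed
  have shrink: "\<forall>r\<ge>1. \<exists>j\<in>J. c' * R r ^ deg j \<le> b r * g j r"
    if "\<forall>r\<ge>1. \<exists>j\<in>J. c * R r ^ deg j \<le> b r * g j r" "c' \<le> c" for J b c c'
  proof -
    have "c' * R r ^ deg j \<le> c * R r ^ deg j" if "r \<ge> 1" for r j
      using R_pos[OF that] \<open>c' \<le> c\<close> by (intro mult_right_mono) auto
    then show ?thesis using that(1) by (meson order_trans)
  qed
  have finJ: "finite {J. J \<subseteq> {1..q} \<and> card J = k}" for k by simp
  have "\<exists>c>0. \<forall>J\<in>{J. J \<subseteq> {1..q} \<and> card J = Suc n}. \<forall>r\<ge>1. \<exists>j\<in>J. c * R r ^ deg j \<le> g j r"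
    by (rule finite_uniform_constant[OF finJ]) (use more shrink[where b = "\<lambda>_. 1"] in auto)
  then obtain c1 where c1: "c1 > 0" "\<And>J r. J \<subseteq> {1..q} \<Longrightarrow> card J = Suc n \<Longrightarrow> r \<ge> 1 \<Longrightarrow>
      \<exists>j\<in>J. c1 * R r ^ deg j \<le> g j r" by blast
  have "\<exists>c>0. \<forall>J\<in>{J. J \<subseteq> {1..q} \<and> card J = n}. \<forall>r\<ge>1. \<exists>j\<in>J. c * R r ^ deg j \<le> R r * g j r"
    by (rule finite_uniform_constant[OF finJ]) (use exactly shrink[where b = R] in auto)
  then obtain c2 where c2: "c2 > 0" "\<And>J r. J \<subseteq> {1..q} \<Longrightarrow> card J = n \<Longrightarrow> r \<ge> 1 \<Longrightarrow>
      \<exists>j\<in>J. c2 * R r ^ deg j \<le> R r * g j r" by blast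
  have "\<exists>c>0. \<forall>i\<in>{1..q}. \<forall>r\<ge>1. c \<le> g i r"
  proof (rule finite_uniform_constant)
    show "\<exists>c>0. \<forall>r\<ge>1. c \<le> g i r" if "i \<in> {1..q}" for i
      using gauss_norm_lower_bound[OF dec_g[OF that] comp_nonzero[OF that]] unfolding g_def by metis
  qed (auto intro: order_trans)
  then obtain c3 where c3: "c3 > 0" "\<And>i r. i \<in> {1..q} \<Longrightarrow> r \<ge> 1 \<Longrightarrow> c3 \<le> g i r" by blast
  obtain c4 where c4: "c4 > 0" "\<And>r. r \<ge> 1 \<Longrightarrow> c4 \<le> gauss_norm v (f i1) r"
    using gauss_norm_lower_bound[OF decays_f[OF i1(1)] i1(2)] by blast
  \<comment> \<open>A single error term that serves for all bounds at once.\<close>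
  define A where "A = \<bar>ln c1\<bar> + \<bar>ln c2\<bar> + \<bar>ln c3\<bar> + \<bar>ln c4\<bar>"
  have A: "A \<ge> 0" "- ln c1 \<le> A" "- ln c2 \<le> A" "- ln c3 \<le> A" "- ln c4 \<le> A"
    unfolding A_def by linarith+
  define M where "M = (MAX i\<in>{1..q}. 1 / real (deg i))"
  have M: "1 / real (deg i) \<le> M" if "i \<in> {1..q}" for i
    unfolding M_def using that by (intro Max_ge) auto
  have "0 \<le> 1 / real (deg 1)" by simp
  also have "\<dots> \<le> M" using assms(6) by (intro M) simp
  finally have "M \<ge> 0" .
  define C where "C = (real n - 1 + M + real (card {1..q})) * A"
  have bound: "(\<Sum>i=1..q. prox_fun v N f (deg i) (Q i) r / real (deg i))
      \<le> (real n - 1 + M) * char_fun v N f r + C" if r: "r \<ge> 1" for r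
  proof -
    let ?t = "char_fun v N f r" and ?m = "\<lambda>i. prox_fun v N f (deg i) (Q i) r"
    have Rp: "R r > 0" by (rule R_pos[OF r])
    have gp: "g i r > 0" if "i \<in> {1..q}" for i using c3(1) c3(2)[OF that r] by linarith
    have t: "?t = ln (R r)" by (simp add: char_fun_def R_def)
    have m: "?m i = real (deg i) * ?t - ln (g i r)" if "i \<in> {1..q}" for i
    proof -
      have "?m i = ln (R r ^ deg i / g i r)" by (simp add: prox_fun_def R_def g_def)
      then show ?thesis using Rp gp[OF that] by (simp add: ln_div ln_realpow t)
    qed
    show ?thesis
      unfolding C_def
    proof (rule weighted_sum_bound)
      show "finite {1..q}" by simp
      show "1 \<le> deg i" if "i \<in> {1..q}" for i using assms(7) that by blast
      show "1 / real (deg i) \<le> M" if "i \<in> {1..q}" for i by (rule M[OF that])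
      have "ln c4 \<le> ?t" 
        unfolding t using c4(1) order_trans[OF c4(2)[OF r] R_ge[OF i1(1)]] Rp by simp
      then show "0 \<le> ?t + A" using A(5) by linarith
      fix i assume i: "i \<in> {1..q}"
      have "ln c3 \<le> ln (g i r)" using c3(1) c3(2)[OF i r] gp[OF i] by simp
      then show "?m i \<le> real (deg i) * ?t + A" using m[OF i] A(4) by linarith
    next
      fix J assume J: "J \<subseteq> {1..q}" "card J = Suc n"
      then obtain j where j: "j \<in> J" "c1 * R r ^ deg j \<le> g j r" using c1(2) r by blast
      then have jq: "j \<in> {1..q}" using J by blast
      have "ln (c1 * R r ^ deg j) \<le> ln (g j r)" using j(2) c1(1) Rp gp[OF jq] by simp
      then have "?m j \<le> A"
        using m[OF jq] A(2) c1(1) Rp by (simp add: ln_mult ln_realpow t)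
      then show "\<exists>j\<in>J. ?m j \<le> A" using j(1) by blast
    next
      fix J assume J: "J \<subseteq> {1..q}" "card J = n"
      then obtain j where j: "j \<in> J" "c2 * R r ^ deg j \<le> R r * g j r" using c2(2) r by blast
      then have jq: "j \<in> {1..q}" using J by blast
      have "ln (c2 * R r ^ deg j) \<le> ln (R r * g j r)" using j(2) c2(1) Rp gp[OF jq] by simp
      then have "?m j \<le> ?t + A"
        using m[OF jq] A(3) c2(1) Rp gp[OF jq] by (simp add: ln_mult ln_realpow t)
      then show "\<exists>j\<in>J. ?m j \<le> ?t + A" using j(1) by blast
    qed (use \<open>M \<ge> 0\<close> A(1) assms(5) in auto)
  qed
  show ?thesis
  proof (intro conjI allI impI)
    show "\<exists>C. \<forall>r\<ge>1. (\<Sum>i=1..q. prox_fun v N f (deg i) (Q i) r / real (deg i))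
        \<le> (real n - 1 + (MAX i\<in>{1..q}. 1 / real (deg i))) * char_fun v N f r + C"
      using bound unfolding M_def by blast
    fix d assume d: "\<forall>i\<in>{1..q}. deg i = d"
    have "(\<lambda>i. 1 / real (deg i)) ` {1..q} = {1 / real d}"
      using d assms(6) by (auto simp: image_iff intro!: bexI[of _ 1])
    then have Md: "M = 1 / real d" by (simp add: M_def)
    have "1 / real d * (\<Sum>i=1..q. prox_fun v N f d (Q i) r) =
        (\<Sum>i=1..q. prox_fun v N f (deg i) (Q i) r / real (deg i))" for r
      using d by (simp add: sum_divide_distrib)
    then show "\<exists>C. \<forall>r\<ge>1. 1 / real d * (\<Sum>i=1..q. prox_fun v N f d (Q i) r)
        \<le> (real n - 1 + 1 / real d) * char_fun v N f r + C"
      using bound unfolding Md by auto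
  qed
qed

end
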